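(* Let $\mu$ be an ergodic strongly minimizing measure of a globally positive diffeomorphism $f$ of $\mathbb{A}_n=\mathbb{T}^n\times\mathbb{R}^n$, all of whose Lyapunov exponents are zero. Then $\operatorname{supp}\mu$ is $C^1$-isotropic at $\mu$-almost every point.
   Context: $\mathbb{A}_n=\mathbb{T}^n\times\mathbb{R}^n$ with $\mathbb{T}^n=\mathbb{R}^n/\mathbb{Z}^n$ has symplectic form $\omega=\sum_i dq_i\wedge dp_i$. Globally positive diffeomorphism: a symplectic $C^1$-diffeomorphism $f$ of $\mathbb{A}_n$ homotopic to the identity which has a lift $F$ to $\mathbb{R}^n\times\mathbb{R}^n$ admitting a $C^2$ generating function $S:\mathbb{R}^n\times\mathbb{R}^n\to\mathbb{R}$ such that (1) there is $\alpha>0$ with $\frac{\partial^2S}{\partial q\partial Q}(q,Q)(v,v)\le-\alpha\|v\|^2$ for all $q,Q,v$; (2) $F(q,p)=(Q,P)\iff p=-\frac{\partial S}{\partial q}(q,Q),\ P=\frac{\partial S}{\partial Q}(q,Q)$. Let $\bar L\in\mathbb{R}$ be the unique constant (Garibaldi–Thieullen) for which there exist $\mathbb{Z}^n$-periodic continuous $u_-,u_+:\mathbb{R}^n\to\mathbb{R}$ with $u_-(y)=\inf_x(u_-(x)+S(x,y)-\bar L)$ for all $y$ and $u_+(x)=\sup_y(u_+(y)-S(x,y)+\bar L)$ for all $x$. Put $\bar S=S-\bar L$ and $\bar{\mathcal F}(x_m,\dots,x_\ell)=\sum_{i=m+1}^{\ell}\bar S(x_{i-1},x_i)$. A configuration $(x_k)_{k\in\mathbb{Z}}$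 of points of $\mathbb{R}^n$ is strongly minimizing if for all $m<\ell$, $m'<\ell'$ and every configuration $(y_k)_{k\in\mathbb{Z}}$ with $y_{m'}-x_m\in\mathbb{Z}^n$, $y_{\ell'}-x_\ell\in\mathbb{Z}^n$ one has $\bar{\mathcal F}(x_m,\dots,x_\ell)\le\bar{\mathcal F}(y_{m'},\dots,y_{\ell'})$; the corresponding orbit of $f$ is then called strongly minimizing. A strongly minimizing measure is an $f$-invariant Borel probability measure whose support is filled by strongly minimizing orbits. The Lyapunov exponents of $\mu$ are those of $Df$. For $A\subset\mathbb{R}^n\times\mathbb{R}^n$ and $a\in A$, the contingent cone $C_aA$ is the set of all limit points of sequences $t_k(a_k-a)$ with $t_k\in\mathbb{R}$, $a_k\in A$, $a_k\to a$. The limit contingent cone $\widetilde C_aA$ is the set of limit points of sequences $v_k\in C_{a_k}A$, where $(a_k)$ is any sequence of points of $A$ converging to $a$. For subsets of $\mathbb{A}_n$ these are computed in the universal cover $\mathbb{R}^n\times\mathbb{R}^n$. A set $A$ is $C^1$-isotropic at $a\in A$ if $\widetilde C_aA$ is contained in some Lagrangian subspace. *)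

theory Defs
  imports "HOL-Probability.Probability"
begin

definition int_vecs :: "(real^'n) set" where
  "int_vecs = {x. \<forall>i. x $ i \<in> \<int>}"

definition torus_rel :: "real^'n \<Rightarrow> real^'n \<Rightarrow> bool" where
  "torus_rel x y \<longleftrightarrow> x - y \<in> int_vecs"

lemma equivp_torus_rel: "equivp torus_rel"
proof (rule equivpI)
  show "reflp torus_rel"
    by (simp add: reflp_def torus_rel_def int_vecs_def)
  show "symp torus_rel"
  proof (rule sympI)
    fix x y :: "real^'n"
    assume "torus_rel x y"
    then have "- (x $ i - y $ i) \<in> \<int>" for i
      unfolding torus_rel_def int_vecs_def by (auto intro: Ints_minus simp del: minus_diff_eq)
    then show "torus_rel y x"
      by (simp add: torus_rel_def int_vecs_def)
  qed
  show "transp torus_rel"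
  proof (rule transpI)
    fix x y z :: "real^'n"
    assume "torus_rel x y" "torus_rel y z"
    then have "(x $ i - y $ i) + (y $ i - z $ i) \<in> \<int>" for i
      unfolding torus_rel_def int_vecs_def by (intro Ints_add) auto
    then show "torus_rel x z"
      by (simp add: torus_rel_def int_vecs_def)
  qed
qed

quotient_type 'n torus = "real^('n::finite)" / torus_rel
  by (rule equivp_torus_rel)

instantiation torus :: (finite) topological_space
begin

definition open_torus :: "'a torus set \<Rightarrow> bool" where
  "open_torus U \<longleftrightarrow> open (abs_torus -` U)"

instance
proof
  show "open (UNIV :: 'a torus set)"
    by (simp add: open_torus_def)
next
  fix S T :: "'a torus set"
  assume "open S" "open T"
  then show "open (S \<inter> T)"
    by (simp add: open_torus_def open_Int)
next
  fix K :: "'a torus set set"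
  assume "\<forall>S\<in>K. open S"
  then show "open (\<Union>K)"
    by (auto simp add: open_torus_def vimage_Union)
qed

end

type_synonym 'n phase = "(real^'n) \<times> (real^'n)"
type_synonym 'n annulus = "'n torus \<times> (real^'n)"

definition annulus_proj :: "'n::finite phase \<Rightarrow> 'n annulus" where
  "annulus_proj = map_prod abs_torus id"

text \<open>The standard form \<open>\<Sum>\<^sub>i dq\<^sub>i \<and> dp\<^sub>i\<close>.\<close>

definition symplectic_form :: "'n::finite phase \<Rightarrow> 'n phase \<Rightarrow> real" where
  "symplectic_form v w = fst v \<bullet> snd w - snd v \<bullet> fst w"

definition lagrangian :: "'n::finite phase set \<Rightarrow> bool" where
  "lagrangian V \<longleftrightarrow> subspace V \<and> dim V = CARD('n) \<and> (\<forall>v\<in>V. \<forall>w\<in>V. symplectic_form v w = 0)"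

definition C1_map :: "('a::real_normed_vector \<Rightarrow> 'b::real_normed_vector) \<Rightarrow> bool" where
  "C1_map g \<longleftrightarrow> (\<exists>g' :: 'a \<Rightarrow> 'a \<Rightarrow>\<^sub>L 'b.
     (\<forall>x. (g has_derivative blinfun_apply (g' x)) (at x)) \<and> continuous_on UNIV g')"

definition C2_map :: "('a::real_normed_vector \<Rightarrow> 'b::real_normed_vector) \<Rightarrow> bool" where
  "C2_map g \<longleftrightarrow> (\<exists>g' :: 'a \<Rightarrow> 'a \<Rightarrow>\<^sub>L 'b.
     (\<forall>x. (g has_derivative blinfun_apply (g' x)) (at x)) \<and> C1_map g')"

definition lift_of :: "('n::finite phase \<Rightarrow> 'n phase) \<Rightarrow> ('n annulus \<Rightarrow> 'n annulus) \<Rightarrow> bool" where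
  "lift_of F f \<longleftrightarrow> continuous_on UNIV F \<and> annulus_proj \<circ> F = f \<circ> annulus_proj"

text \<open>Local sections of \<^const>\<open>annulus_proj\<close> are the charts of the annulus.  A continuous
  self-map of the annulus has a continuous lift, unique up to translation by an integer vector in
  the first factor, and it is of class \<open>C\<^sup>1\<close> if and only if its lifts are.\<close>

definition C1_annulus_map :: "('n::finite annulus \<Rightarrow> 'n annulus) \<Rightarrow> bool" where
  "C1_annulus_map f \<longleftrightarrow> (\<exists>F. lift_of F f \<and> C1_map F)"

definition C1_annulus_diffeo :: "('n::finite annulus \<Rightarrow> 'n annulus) \<Rightarrow> bool" where
  "C1_annulus_diffeo f \<longleftrightarrow> bij f \<and> C1_annulus_map f \<and> C1_annulus_map (inv f)"

text \<open>The charts identify every tangent space of the annulus with \<open>\<real>\<^sup>n \<times> \<real>\<^sup>n\<close>.  For a \<open>C\<^sup>1\<close> map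
  the derivative below depends neither on the lift \<open>F\<close> nor on the point \<open>z\<close> above \<open>x\<close>.\<close>

definition tangent_map :: "('n::finite annulus \<Rightarrow> 'n annulus) \<Rightarrow> 'n annulus \<Rightarrow> 'n phase \<Rightarrow> 'n phase" where
  "tangent_map f x = (THE A. \<exists>F z. lift_of F f \<and> annulus_proj z = x \<and> (F has_derivative A) (at z))"

definition symplectic_diffeo :: "('n::finite annulus \<Rightarrow> 'n annulus) \<Rightarrow> bool" where
  "symplectic_diffeo f \<longleftrightarrow> C1_annulus_diffeo f \<and>
     (\<forall>x v w. symplectic_form (tangent_map f x v) (tangent_map f x w) = symplectic_form v w)"

definition mixed_derivative :: "('n::finite phase \<Rightarrow> real) \<Rightarrow> real^'n \<Rightarrow> real^'n \<Rightarrow> real^'n \<Rightarrow> real^'n \<Rightarrow> real" where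
  "mixed_derivative S q Q v w =
     frechet_derivative (\<lambda>q'. frechet_derivative (\<lambda>Q'. S (q', Q')) (at Q) w) (at q) v"

definition positive_generating_function :: "('n::finite phase \<Rightarrow> real) \<Rightarrow> ('n phase \<Rightarrow> 'n phase) \<Rightarrow> bool" where
  "positive_generating_function S F \<longleftrightarrow>
     C2_map S \<and>
     (\<exists>\<alpha>>0. \<forall>q Q v. mixed_derivative S q Q v v \<le> - \<alpha> * (norm v)\<^sup>2) \<and>
     (\<forall>q p Q P. F (q, p) = (Q, P) \<longleftrightarrow>
        GDERIV (\<lambda>q'. S (q', Q)) q :> - p \<and> GDERIV (\<lambda>Q'. S (q, Q')) Q :> P)"

definition globally_positive :: "('n::finite annulus \<Rightarrow> 'n annulus) \<Rightarrow> bool" where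
  "globally_positive f \<longleftrightarrow>
     symplectic_diffeo f \<and>
     homotopic_with_canon (\<lambda>_. True) UNIV UNIV f id \<and>
     (\<exists>F S. lift_of F f \<and> positive_generating_function S F)"

definition int_periodic :: "(real^'n \<Rightarrow> real) \<Rightarrow> bool" where
  "int_periodic u \<longleftrightarrow> (\<forall>x. \<forall>\<nu>\<in>int_vecs. u (x + \<nu>) = u x)"

text \<open>The infimum and supremum are taken in the extended reals, so the equations also say that
  they are finite.\<close>

definition critical_constant :: "('n::finite phase \<Rightarrow> real) \<Rightarrow> real \<Rightarrow> bool" where
  "critical_constant S L \<longleftrightarrow> (\<exists>um up.
     int_periodic um \<and> continuous_on UNIV um \<and> int_periodic up \<and> continuous_on UNIV up \<and>
     (\<forall>y. ereal (um y) = (INF x. ereal (um x + S (x, y) - L))) \<and>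
     (\<forall>x. ereal (up x) = (SUP y. ereal (up y - S (x, y) + L))))"

definition action :: "('n::finite phase \<Rightarrow> real) \<Rightarrow> real \<Rightarrow> (int \<Rightarrow> real^'n) \<Rightarrow> int \<Rightarrow> int \<Rightarrow> real" where
  "action S L x m l = (\<Sum>i=m+1..l. S (x (i - 1), x i) - L)"

definition strongly_minimizing :: "('n::finite phase \<Rightarrow> real) \<Rightarrow> real \<Rightarrow> (int \<Rightarrow> real^'n) \<Rightarrow> bool" where
  "strongly_minimizing S L x \<longleftrightarrow>
     (\<forall>m l m' l' y. m < l \<and> m' < l' \<and> y m' - x m \<in> int_vecs \<and> y l' - x l \<in> int_vecs
        \<longrightarrow> action S L x m l \<le> action S L y m' l')"

text \<open>The orbit of \<open>a\<close> is represented by the full orbit \<open>z\<close> under the lift \<open>F\<close> of a point above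
  \<open>a\<close>; the corresponding configuration consists of the first components.\<close>

definition strongly_minimizing_orbit ::
    "('n::finite phase \<Rightarrow> 'n phase) \<Rightarrow> ('n phase \<Rightarrow> real) \<Rightarrow> real \<Rightarrow> 'n annulus \<Rightarrow> bool" where
  "strongly_minimizing_orbit F S L a \<longleftrightarrow>
     (\<exists>z :: int \<Rightarrow> 'n phase. (\<forall>k. z (k + 1) = F (z k)) \<and> annulus_proj (z 0) = a \<and>
        strongly_minimizing S L (\<lambda>k. fst (z k)))"

definition measure_support :: "'a::topological_space measure \<Rightarrow> 'a set" where
  "measure_support M = {x. \<forall>U. open U \<and> x \<in> U \<longrightarrow> emeasure M U > 0}"

definition invariant_prob :: "('a::topological_space \<Rightarrow> 'a) \<Rightarrow> 'a measure \<Rightarrow> bool" where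
  "invariant_prob f M \<longleftrightarrow> prob_space M \<and> sets M = sets borel \<and> f \<in> measurable M M \<and> distr M M f = M"

definition ergodic :: "('a::topological_space \<Rightarrow> 'a) \<Rightarrow> 'a measure \<Rightarrow> bool" where
  "ergodic f M \<longleftrightarrow> invariant_prob f M \<and>
     (\<forall>A\<in>sets M. f -` A = A \<longrightarrow> measure M A = 0 \<or> measure M A = 1)"

definition strongly_minimizing_measure ::
    "('n::finite annulus \<Rightarrow> 'n annulus) \<Rightarrow> ('n phase \<Rightarrow> 'n phase) \<Rightarrow> ('n phase \<Rightarrow> real) \<Rightarrow> real \<Rightarrow> 'n annulus measure \<Rightarrow> bool" where
  "strongly_minimizing_measure f F S L M \<longleftrightarrow>
     invariant_prob f M \<and> (\<forall>a\<in>measure_support M. strongly_minimizing_orbit F S L a)"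

definition lyapunov_exponent :: "('n::finite annulus \<Rightarrow> 'n annulus) \<Rightarrow> 'n annulus \<Rightarrow> 'n phase \<Rightarrow> ereal" where
  "lyapunov_exponent f x v =
     limsup (\<lambda>k. ereal (ln (norm (tangent_map (f ^^ k) x v)) / real k))"

definition lyapunov_exponents_at :: "('n::finite annulus \<Rightarrow> 'n annulus) \<Rightarrow> 'n annulus \<Rightarrow> ereal set" where
  "lyapunov_exponents_at f x = {lyapunov_exponent f x v | v. v \<noteq> 0}"

text \<open>For ergodic \<open>M\<close> the set of exponents at \<open>x\<close> is the same for almost all \<open>x\<close>, and its
  elements are the exponents of \<open>M\<close>.\<close>

definition zero_lyapunov_exponents :: "('n::finite annulus \<Rightarrow> 'n annulus) \<Rightarrow> 'n annulus measure \<Rightarrow> bool" where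
  "zero_lyapunov_exponents f M \<longleftrightarrow> (AE x in M. \<forall>c\<in>lyapunov_exponents_at f x. c = 0)"

definition limit_point_of_seq :: "(nat \<Rightarrow> 'a::topological_space) \<Rightarrow> 'a \<Rightarrow> bool" where
  "limit_point_of_seq s l \<longleftrightarrow> (\<exists>r. strict_mono r \<and> (s \<circ> r) \<longlonglongrightarrow> l)"

definition contingent_cone :: "'a::real_normed_vector set \<Rightarrow> 'a \<Rightarrow> 'a set" where
  "contingent_cone A a = {v. \<exists>(t :: nat \<Rightarrow> real) s.
     (\<forall>k. s k \<in> A) \<and> s \<longlonglongrightarrow> a \<and> limit_point_of_seq (\<lambda>k. t k *\<^sub>R (s k - a)) v}"

definition limit_contingent_cone :: "'a::real_normed_vector set \<Rightarrow> 'a \<Rightarrow> 'a set" where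
  "limit_contingent_cone A a = {v. \<exists>s w.
     (\<forall>k. s k \<in> A \<and> w k \<in> contingent_cone A (s k)) \<and> s \<longlonglongrightarrow> a \<and> limit_point_of_seq w v}"

definition C1_isotropic_at :: "'n::finite phase set \<Rightarrow> 'n phase \<Rightarrow> bool" where
  "C1_isotropic_at A a \<longleftrightarrow> a \<in> A \<and> (\<exists>V. lagrangian V \<and> limit_contingent_cone A a \<subseteq> V)"

definition annulus_C1_isotropic_at :: "'n::finite annulus set \<Rightarrow> 'n annulus \<Rightarrow> bool" where
  "annulus_C1_isotropic_at A x \<longleftrightarrow>
     (\<forall>z. annulus_proj z = x \<longrightarrow> C1_isotropic_at (annulus_proj -` A) z)"

end

theory Submission
  imports Defs
begin

text \<open>
  The support of a strongly minimizing measure consists of orbits that minimize the action, and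
  this confines its tangent directions by two invariant families of Lagrangian planes, the Green
  bundles. When all exponents vanish the two families agree almost everywhere, and their common
  value is the Lagrangian plane that contains the limit contingent cone.

  \<^emph>\<open>Calibration.\<close> Let \<open>u\<close> be a continuous periodic function with \<open>u y - u x \<le> S (x, y) - L\<close>, and
  call the difference of the two sides along one step of an orbit its excess. The action of \<open>N\<close>
  steps of a strongly minimizing orbit is at most that of a single step between points of the unit
  cube congruent to its end points, so it is bounded independently of \<open>N\<close>, and so is the sum of
  the excess. Hence the averages of the excess tend to \<open>0\<close>; being nonnegative, continuous and of
  integral \<open>0\<close>, it vanishes on the support (lemma \<open>excess_zero_on_support\<close>). The \<^emph>\<open>same\<close> function
  \<open>u\<close> thus calibrates all orbits in the support, and all later minimization arguments compare with
  \<open>u\<close>.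

  \<^emph>\<open>Green bundles.\<close> Write \<open>A\<close>, \<open>- B\<close>, \<open>C\<close> for the blocks of the Hessian of \<open>S\<close> along an orbit.
  Calibration makes the second variation of the action nonnegative for variations with fixed ends.
  The image of the vertical space under \<open>k + 1\<close> steps of the derivative of \<open>F\<close> is then the graph
  of a symmetric matrix \<open>sp k\<close>, where \<open>h \<bullet> (sp k *v h)\<close> is the least second variation of a path of
  \<open>k + 1\<close> steps from \<open>0\<close> to \<open>h\<close>. These forms decrease with \<open>k\<close> to a limit \<open>Sp\<close>; time reversal
  yields \<open>Sm\<close>, with \<open>Sm \<le> Sp\<close>. Both graphs are invariant under the derivative.

  \<^emph>\<open>Zero exponents.\<close> On the graph of \<open>Sp\<close> the derivative acts on first components by
  \<open>B\<^bsup>-1\<^esup> (Sp + A)\<close>, and on the quotient by the graph of \<open>Sm\<close> it acts by the inverse transpose of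
  \<open>B\<^bsup>-1\<^esup> (Sm + A)\<close>. The product of the two determinants is \<open>det (Sp + A) / det (Sm + A) \<ge> 1\<close>, with
  equality only if \<open>Sp = Sm\<close>. Along an orbit of length \<open>k\<close> the product of these ratios is bounded
  by norms of \<open>2 n\<close> vectors transported by the derivative, and by the size of \<open>Sm\<close> at the end
  point. With zero exponents the averages of the logarithm of the ratio therefore have no positive
  limit, and since it is nonnegative it vanishes almost everywhere (lemma
  \<open>green_bundles_coincide\<close>). The factor from \<open>Sm\<close> at the moving end point is harmless because it
  is negligible in probability, by invariance of the measure.

  \<^emph>\<open>Isotropy.\<close> Let two orbits of the support pass close to each other. Follow the first and cross
  over to the second, and also the other way round: by the calibration, the two crossed paths
  together cost at least as much as the two orbits. Expanding this to second order at a point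
  where \<open>Sp = Sm\<close> shows that every limit \<open>(d, e)\<close> of rescaled differences of support points
  satisfies \<open>e = Sp *v d\<close> (lemma \<open>paratingent_in_graph\<close>). The graph of the symmetric matrix \<open>Sp\<close>
  is Lagrangian.
\<close>

section \<open>Positive definite matrices\<close>

text \<open>Products with a transposed matrix are kept in the form \<open>transpose M *v x\<close>, so that the lemmas on
  symmetric matrices below apply to them.\<close>

declare transpose_matrix_vector [simp del] vector_transpose_matrix [simp del]

definition pos_def :: "real^'n^'n \<Rightarrow> bool" where
  "pos_def M \<longleftrightarrow> (\<forall>x. x \<noteq> 0 \<longrightarrow> 0 < x \<bullet> (M *v x))"

definition outer :: "real^'n \<Rightarrow> real^'n \<Rightarrow> real^'n^'n" where
  "outer u v = (\<chi> i j. u $ i * v $ j)"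

lemma outer_mult_vec: "outer u v *v x = (v \<bullet> x) *\<^sub>R u"
  by (simp add: outer_def matrix_vector_mult_def vec_eq_iff inner_vec_def sum_distrib_left mult.assoc
      mult.commute mult.left_commute)

lemma matrix_inv_right: "invertible (M::real^'n^'n) \<Longrightarrow> M ** matrix_inv M = mat 1"
  and matrix_inv_left: "invertible (M::real^'n^'n) \<Longrightarrow> matrix_inv M ** M = mat 1"
  unfolding invertible_def matrix_inv_def by (metis (mono_tags, lifting) someI_ex)+

lemma matrix_inv_vec: "invertible (M::real^'n^'n) \<Longrightarrow> M *v (matrix_inv M *v x) = x"
  and matrix_inv_vec': "invertible (M::real^'n^'n) \<Longrightarrow> matrix_inv M *v (M *v x) = x"
  by (simp_all add: matrix_vector_mul_assoc matrix_inv_right matrix_inv_left)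

lemma inner_transpose: "x \<bullet> (transpose (M::real^'n^'n) *v y) = (M *v x) \<bullet> y"
  by (metis dot_lmul_matrix vector_transpose_matrix transpose_transpose)

lemma inner_sym_matrix: "transpose (M::real^'n^'n) = M \<Longrightarrow> x \<bullet> (M *v y) = y \<bullet> (M *v x)"
  by (metis inner_transpose inner_commute)

lemma transpose_eqI:
  assumes "\<And>x y. x \<bullet> ((M::real^'n^'n) *v y) = y \<bullet> (M *v x)" shows "transpose M = M"
proof -
  have "M $ i $ j = M $ j $ i" for i j
    using assms[of "axis i 1" "axis j 1"]
    by (simp add: inner_axis matrix_vector_mult_basis column_def inner_axis')
  then show ?thesis by (simp add: transpose_def vec_eq_iff)
qed

lemma sym_matrix_inv:
  assumes "invertible (M::real^'n^'n)" "transpose M = M" shows "transpose (matrix_inv M) = matrix_inv M"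
  by (rule transpose_eqI) (metis assms inner_sym_matrix matrix_inv_vec inner_commute)

lemma pos_def_invertible: assumes "pos_def M" shows "invertible M"
proof -
  have "inj ((*v) M)"
  proof (rule injI)
    fix x y assume "M *v x = M *v y"
    then have "M *v (x - y) = 0" by (simp add: matrix_vector_mult_diff_distrib)
    then have "(x - y) \<bullet> (M *v (x - y)) = 0" by simp
    then show "x = y" using assms unfolding pos_def_def by (metis eq_iff_diff_eq_0 less_irrefl)
  qed
  then show ?thesis
    by (simp add: invertible_left_inverse matrix_left_invertible_injective)
qed

lemma pos_def_inv_pos:
  assumes "pos_def M" "y \<noteq> 0" shows "0 < y \<bullet> (matrix_inv M *v y)"
proof -
  let ?x = "matrix_inv M *v y"
  have y: "M *v ?x = y" by (simp add: matrix_inv_vec pos_def_invertible assms)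
  then have "?x \<noteq> 0" using assms(2) by auto
  then have "0 < ?x \<bullet> (M *v ?x)" using assms(1) unfolding pos_def_def by blast
  then show ?thesis by (simp add: y inner_commute)
qed

lemma tendsto_det:
  assumes "((\<lambda>z. M z :: real^'n^'n) \<longlongrightarrow> M0) F'" shows "((\<lambda>z. det (M z)) \<longlongrightarrow> det M0) F'"
  unfolding det_def by (intro tendsto_intros tendsto_vec_nth assms)

text \<open>Cramer's rule; it exhibits the entries of the inverse as quotients of determinants, whence
  continuity.\<close>

lemma matrix_inv_nth:
  assumes "invertible (M::real^'n^'n)"
  shows "matrix_inv M $ k $ l = det (\<chi> i j. if j = k then axis l 1 $ i else M $ i $ j) / det M"
proof -
  have "M *v column l (matrix_inv M) = axis l 1"
    using matrix_inv_vec[OF assms, of "axis l 1"] by (simp add: matrix_vector_mult_basis)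
  then have "column l (matrix_inv M) = (\<chi> k. det (\<chi> i j. if j = k then axis l 1 $ i else M $ i $ j) / det M)"
    using cramer[of M] assms by (simp add: invertible_det_nz)
  then show ?thesis by (simp add: column_def vec_eq_iff)
qed

lemma tendsto_matrix_inv:
  assumes M: "((\<lambda>z. M z :: real^'n^'n) \<longlongrightarrow> M0) F'" and inv: "invertible M0" 
    and ev: "\<forall>\<^sub>F z in F'. invertible (M z)"
  shows "((\<lambda>z. matrix_inv (M z)) \<longlongrightarrow> matrix_inv M0) F'"
proof (intro vec_tendstoI)
  fix k l
  have "((\<lambda>z. det (\<chi> i j. if j = k then axis l 1 $ i else M z $ i $ j) / det (M z)) \<longlongrightarrow> matrix_inv M0 $ k $ l) F'"
    unfolding matrix_inv_nth[OF inv]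
  proof (intro tendsto_divide tendsto_det M vec_tendstoI)
    show "det M0 \<noteq> 0" using inv by (simp add: invertible_det_nz)
    fix i j
    show "((\<lambda>z. (\<chi> i j. if j = k then axis l 1 $ i else M z $ i $ j) $ i $ j) \<longlongrightarrow>
      (\<chi> i j. if j = k then axis l 1 $ i else M0 $ i $ j) $ i $ j) F'"
      using tendsto_vec_nth[OF tendsto_vec_nth[OF M]] by simp
  qed
  then show "((\<lambda>z. matrix_inv (M z) $ k $ l) \<longlongrightarrow> matrix_inv M0 $ k $ l) F'"
    by (rule Lim_transform_eventually) (use ev in \<open>auto elim!: eventually_mono simp: matrix_inv_nth\<close>)
qed

text \<open>An orthogonal change of basis that moves \<open>v\<close> to a multiple of a basis vector turns the matrix
  into the identity with one column replaced, whose determinant is read off by Cramer's lemma.\<close>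

lemma det_one_plus_outer: "det (mat 1 + outer u v :: real^'n^'n) = 1 + u \<bullet> v"
proof (cases "v = 0")
  case True
  then have "mat 1 + outer u v = (mat 1 :: real^'n^'n)" by (simp add: outer_def vec_eq_iff)
  then show ?thesis using True by (simp only: det_I) simp
next
  case False
  fix k :: 'n
  obtain R :: "real^'n^'n" where R: "orthogonal_matrix R" "R *v axis k 1 = v /\<^sub>R norm v"
    using orthogonal_matrix_exists_basis[of "v /\<^sub>R norm v" k] False by auto
  define w where "w = transpose R *v u"
  have RR: "transpose R ** R = mat 1" "R ** transpose R = mat 1" using R(1)
      by (simp_all add: orthogonal_matrix_def)
  let ?N = "mat 1 + norm v *\<^sub>R outer w (axis k 1)"
  have "R ** ?N ** transpose R = mat 1 + outer u v"
  proof (subst matrix_eq, intro allI)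
    fix x
    have a: "axis k 1 \<bullet> (transpose R *v x) = (v \<bullet> x) / norm v"
      by (simp add: inner_transpose R(2) divide_inverse_commute)
    have "(R ** ?N ** transpose R) *v x = R *v (transpose R *v x
        + norm v *\<^sub>R (axis k 1 \<bullet> (transpose R *v x)) *\<^sub>R w)"
      by (simp add: matrix_vector_mul_assoc[symmetric] matrix_vector_mult_add_rdistrib outer_mult_vec
          scaleR_matrix_vector_assoc[symmetric])
    also have "\<dots> = x + (v \<bullet> x) *\<^sub>R (R *v w)"
      using False unfolding a by (simp add: matrix_vector_right_distrib matrix_vector_mul_assoc RR
          scaleR_vector_matrix_assoc matrix_vector_mult_scaleR)
    also have "R *v w = u" by (simp add: w_def matrix_vector_mul_assoc RR)
    finally show "(R ** ?N ** transpose R) *v x = (mat 1 + outer u v) *v x"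
      by (simp add: matrix_vector_mult_add_rdistrib outer_mult_vec)
  qed
  then have "det (mat 1 + outer u v) = det ?N * (det R * det R)"
    by (metis det_mul det_transpose mult.commute mult.left_commute)
  also have "det R * det R = 1" using RR(2) by (metis det_I det_mul det_transpose)
  also have "?N = (\<chi> i j. if j = k then ((mat 1 :: real^'n^'n) *v (axis k 1
      + norm v *\<^sub>R w)) $ i else (mat 1 :: real^'n^'n) $ i $ j)"
    unfolding matrix_vector_mul_lid by (auto simp: vec_eq_iff outer_def mat_def axis_def)
  also have "det \<dots> = (axis k 1 + norm v *\<^sub>R w) $ k * det (mat 1 :: real^'n^'n)" by (rule cramer_lemma)
  also have "w $ k = (u \<bullet> v) / norm v"
  proof -
    have "w $ k = axis k 1 \<bullet> (transpose R *v u)" by (simp add: w_def inner_axis')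
    then show ?thesis by (simp add: inner_transpose R(2) divide_inverse_commute inner_commute)
  qed
  ultimately show ?thesis using False by simp
qed

text \<open>The segment from the identity to \<open>M\<close> consists of positive definite, hence invertible, matrices,
  so the determinant cannot change sign on it.\<close>

lemma pos_def_det_pos: assumes "pos_def M" shows "0 < det M"
proof (rule ccontr)
  assume n: "\<not> 0 < det M"
  let ?M = "\<lambda>t::real. (1 - t) *\<^sub>R mat 1 + t *\<^sub>R M"
  have "continuous_on {0..1} (\<lambda>t. det (?M t))"
    unfolding continuous_on_def by (intro ballI tendsto_det tendsto_intros)
  then obtain t where t: "0 \<le> t" "t \<le> 1" "det (?M t) = 0"
    using IVT2'[of "\<lambda>t. det (?M t)" 1 0 0] n by auto
  have "pos_def (?M t)"
    unfolding pos_def_def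
  proof (intro allI impI)
    fix x :: "real^'a" assume x: "x \<noteq> 0"
    have e: "x \<bullet> (?M t *v x) = (1 - t) * (x \<bullet> x) + t * (x \<bullet> (M *v x))"
      by (simp add: matrix_vector_mult_add_rdistrib scaleR_matrix_vector_assoc[symmetric] inner_add_right)
    have "0 < x \<bullet> x" "0 < x \<bullet> (M *v x)" using x assms by (auto simp: pos_def_def)
    then show "0 < x \<bullet> (?M t *v x)" unfolding e using t(1,2)
      by (cases "t = 0") (auto intro!: add_nonneg_pos)
  qed
  then show False using t(3) pos_def_invertible invertible_det_nz by blast
qed

lemma sym_matrix_eq_0:
  assumes "transpose (N::real^'n^'n) = N" "\<And>x. x \<bullet> (N *v x) = 0" shows "N = 0"
proof -
  have "x \<bullet> (N *v y) = 0" for x y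
    using assms(2)[of "x + y"] assms(2)[of x] assms(2)[of y] inner_sym_matrix[OF assms(1), of x y]
    by (simp add: matrix_vector_right_distrib inner_add_left inner_add_right)
  then have "N *v y = 0 *v y" for y by (metis inner_eq_zero_iff matrix_vector_mult_0)
  then show ?thesis using matrix_eq by blast
qed

lemma det_add_outer:
  assumes "pos_def M"
  shows "det (M + outer w w) = det M * (1 + w \<bullet> (matrix_inv M *v w))"
proof -
  have "M + outer w w = M ** (mat 1 + outer (matrix_inv M *v w) w)"
    by (subst matrix_eq) (simp add: matrix_vector_mul_assoc[symmetric] matrix_vector_mult_add_rdistrib 
       outer_mult_vec matrix_vector_right_distrib matrix_vector_mult_scaleR matrix_inv_vec
           pos_def_invertible[OF assms])
  then show ?thesis by (simp add: det_mul det_one_plus_outer inner_commute)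
qed

text \<open>A nonzero positive semidefinite \<open>N\<close> splits off a rank one term \<open>outer w w\<close> so that the rest is
  still positive semidefinite, by Cauchy-Schwarz, and has a larger kernel. Each rank one term
  strictly increases the determinant, so induction on the codimension of the kernel applies.\<close>

lemma det_strict_mono_psd:
  fixes M N :: "real^'n^'n"
  assumes "pos_def M" "transpose N = N" "\<And>x. 0 \<le> x \<bullet> (N *v x)" "N \<noteq> 0"
  shows "det M < det (M + N)"
  using assms(2-)
proof (induction "CARD('n) - dim {x. N *v x = 0}" arbitrary: N rule: less_induct)
  case less
  obtain e where e: "0 < e \<bullet> (N *v e)"
    using sym_matrix_eq_0[OF less.prems(1)] less.prems(2,3) by (metis order_le_less)
  define c where "c = e \<bullet> (N *v e)"
  \<comment> \<open>\<open>w\<close> is scaled so that \<open>N - outer w w\<close> is Gaussian elimination of the direction \<open>e\<close>.\<close>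
  define w where "w = (1 / sqrt c) *\<^sub>R (N *v e)"
  define N' where "N' = N - outer w w"
  have c: "0 < c" "(1 / sqrt c) * (1 / sqrt c) = 1 / c" "sqrt c * sqrt c = c" using e by (auto simp: c_def)
  have N': "N' *v x = N *v x - ((x \<bullet> (N *v e)) / c) *\<^sub>R (N *v e)" for x
  proof -
    have "outer w w *v x = (((1 / sqrt c) * (1 / sqrt c)) * (x \<bullet> (N *v e))) *\<^sub>R (N *v e)"
      by (simp add: outer_mult_vec w_def inner_commute[of x] del: real_sqrt_mult_self)
    then show ?thesis by (simp add: N'_def matrix_vector_mult_diff_rdistrib c(3) less_imp_le[OF c(1)])
  qed
  have sN: "x \<bullet> (N *v y) = y \<bullet> (N *v x)" for x y by (rule inner_sym_matrix[OF less.prems(1)])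
  have sym: "transpose N' = N'"
  proof (rule transpose_eqI)
    show "x \<bullet> (N' *v y) = y \<bullet> (N' *v x)" for x y
      using sN[of x y] by (simp add: N' inner_diff_right mult.commute)
  qed
  have psd: "0 \<le> x \<bullet> (N' *v x)" for x
  proof -
    define t where "t = (x \<bullet> (N *v e)) / c"
    have "0 \<le> (x - t *\<^sub>R e) \<bullet> (N *v (x - t *\<^sub>R e))" by (rule less.prems)
    also have "\<dots> = x \<bullet> (N *v x) - 2 * t * (x \<bullet> (N *v e)) + t * t * c"
      by (simp add: matrix_vector_mult_diff_distrib matrix_vector_mult_scaleR inner_diff_left
          inner_diff_right sN[of e x] c_def algebra_simps)
    also have "t * t * c = t * (x \<bullet> (N *v e))" using c by (simp add: t_def)
    finally show ?thesis by (simp add: N' inner_diff_right t_def)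
  qed
  have "{x. N *v x = 0} \<subset> {x. N' *v x = 0}"
  proof -
    have "x \<in> {x. N' *v x = 0}" if "x \<in> {x. N *v x = 0}" for x
      using that sN[of x e] by (simp add: N')
    moreover have "N' *v e = 0" "N *v e \<noteq> 0" using c e by (auto simp: N' c_def)
    ultimately show ?thesis by blast
  qed
  moreover have ss: "subspace {x. A *v x = 0}" for A :: "real^'n^'n"
    by (auto simp: subspace_def matrix_vector_right_distrib matrix_vector_mult_scaleR)
  ultimately have "dim {x. N *v x = 0} < dim {x. N' *v x = 0}"
    by (metis dim_psubset span_eq_iff)
  moreover have "dim {x. N' *v x = 0} \<le> CARD('n)" using dim_subset_UNIV[of "{x. N' *v x = 0}"] by simp
  ultimately have lt: "CARD('n) - dim {x. N' *v x = 0} < CARD('n) - dim {x. N *v x = 0}" by linarith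
  have le: "det M \<le> det (M + N')"
    using less.hyps[OF lt sym psd] by (cases "N' = 0") auto
  have pd: "pos_def (M + N')" using assms(1) psd unfolding pos_def_def
    by (simp add: matrix_vector_mult_add_rdistrib inner_add_right add_pos_nonneg)
  have "w \<noteq> 0" using c e by (auto simp: w_def)
  then have "0 < w \<bullet> (matrix_inv (M + N') *v w)" by (rule pos_def_inv_pos[OF pd])
  then have "det (M + N') < det (M + N' + outer w w)"
    unfolding det_add_outer[OF pd] using pos_def_det_pos[OF pd] by simp
  also have "M + N' + outer w w = M + N" by (simp add: N'_def)
  finally show ?case using le by simp
qed

text \<open>A crude form of Hadamard's inequality; its constant disappears in exponential growth rates.\<close>

lemma det_le_prod_columns:
  fixes M :: "real^'n^'n"
  shows "\<bar>det M\<bar> \<le> fact CARD('n) * (\<Prod>i\<in>UNIV. norm (M *v axis i 1))"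
proof -
  have "\<bar>det M\<bar> = \<bar>det (transpose M)\<bar>" by simp
  also have "\<dots> \<le> (\<Sum>p | p permutes (UNIV::'n set). \<bar>of_int (sign p) * (\<Prod>i\<in>UNIV. transpose M $ i $ p i)\<bar>)"
    unfolding det_def by (rule sum_abs)
  also have "\<dots> \<le> (\<Sum>p | p permutes (UNIV::'n set). (\<Prod>i\<in>UNIV. norm (M *v axis i 1)))"
  proof (rule sum_mono)
    fix p :: "'n \<Rightarrow> 'n"
    have "\<bar>of_int (sign p) * (\<Prod>i\<in>UNIV. transpose M $ i $ p i)\<bar> = (\<Prod>i\<in>UNIV. \<bar>transpose M $ i $ p i\<bar>)"
      by (simp add: abs_mult abs_prod sign_def)
    also have "\<dots> \<le> (\<Prod>i\<in>UNIV. norm (M *v axis i 1))"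
    proof (intro prod_mono conjI abs_ge_zero)
      fix i
      have "transpose M $ i $ p i = (M *v axis i 1) $ p i" by (simp add: transpose_def
          matrix_vector_mult_basis column_def)
      then show "\<bar>transpose M $ i $ p i\<bar> \<le> norm (M *v axis i 1)" by (metis component_le_norm_cart)
    qed
    finally show "\<bar>of_int (sign p) * (\<Prod>i\<in>UNIV. transpose M $ i $ p i)\<bar> \<le> (\<Prod>i\<in>UNIV. norm (M *v axis i 1))" .
  qed
  also have "\<dots> = fact CARD('n) * (\<Prod>i\<in>UNIV. norm (M *v axis i 1))"
    by (simp add: card_permutations)
  finally show ?thesis .
qed

lemma inner_matrix_add: "x \<bullet> ((M + N :: real^'n^'n) *v y) = x \<bullet> (M *v y) + x \<bullet> (N *v y)"
  and inner_matrix_diff: "x \<bullet> ((M - N :: real^'n^'n) *v y) = x \<bullet> (M *v y) - x \<bullet> (N *v y)"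
  by (simp_all add: matrix_vector_mult_add_rdistrib matrix_vector_mult_diff_rdistrib inner_add_right
      inner_diff_right)

lemma inner_bilinear_matrix:
  fixes b :: "real^'n \<Rightarrow> real^'n \<Rightarrow> real"
  assumes "\<And>y. linear (\<lambda>x. b x y)" "\<And>x. linear (b x)"
  shows "x \<bullet> ((\<chi> i j. b (axis i 1) (axis j 1)) *v y) = b x y"
proof -
  have "b x y = b (\<Sum>i\<in>UNIV. x $ i *\<^sub>R axis i 1) (\<Sum>j\<in>UNIV. y $ j *\<^sub>R axis j 1)"
    by (simp add: basis_expansion flip: scalar_mult_eq_scaleR)
  also have "\<dots> = (\<Sum>i\<in>UNIV. x $ i * (\<Sum>j\<in>UNIV. y $ j * b (axis i 1) (axis j 1)))"
    by (simp add: linear_sum[OF assms(1)] linear_sum[OF assms(2)] linear_scale[OF assms(1)]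
        linear_scale[OF assms(2)]
      sum_distrib_left, subst sum.swap, simp add: mult.left_commute)
  finally show ?thesis by (simp add: inner_vec_def matrix_vector_mult_def mult.commute)
qed

lemma linear_functional_inner:
  fixes \<phi> :: "real^'n \<Rightarrow> real" assumes "linear \<phi>" shows "\<exists>D. \<forall>h. \<phi> h = h \<bullet> D"
proof -
  have "\<phi> h = h \<bullet> (\<chi> i. \<phi> (axis i 1))" for h
  proof -
    have "\<phi> h = \<phi> (\<Sum>i\<in>UNIV. h $ i *\<^sub>R axis i 1)" by (simp add: basis_expansion flip: scalar_mult_eq_scaleR)
    then show ?thesis by (simp add: linear_sum[OF assms] linear_scale[OF assms] inner_vec_def)
  qed
  then show ?thesis by blast
qed

lemma tendsto_matrix_mult:
  fixes M N :: "'b \<Rightarrow> real^'n^'n"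
  assumes "(M \<longlongrightarrow> M0) F'" "(N \<longlongrightarrow> N0) F'"
  shows "((\<lambda>z. M z ** N z) \<longlongrightarrow> M0 ** N0) F'"
  unfolding matrix_matrix_mult_def
  by (intro vec_tendstoI) (auto intro!: tendsto_intros tendsto_vec_nth assms)

lemma tendsto_inner_matrix:
  fixes M :: "'b \<Rightarrow> real^'n^'n"
  assumes "(M \<longlongrightarrow> M0) F'"
  shows "((\<lambda>z. x \<bullet> (M z *v y)) \<longlongrightarrow> x \<bullet> (M0 *v y)) F'"
proof -
  have "((\<lambda>z. M z $ i $ j) \<longlongrightarrow> M0 $ i $ j) F'" for i j
    by (intro tendsto_vec_nth assms)
  moreover have "x \<bullet> (N *v y) = (\<Sum>i\<in>UNIV. x $ i * (\<Sum>j\<in>UNIV. N $ i $ j * y $ j))" for N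
    by (simp add: inner_vec_def matrix_vector_mult_def)
  ultimately show ?thesis
    by (simp only:) (intro tendsto_sum tendsto_mult tendsto_const)
qed

lemma continuous_on_matrix_inv:
  fixes M :: "'b::topological_space \<Rightarrow> real^'n^'n"
  assumes "continuous_on X M" "\<And>z. z \<in> X \<Longrightarrow> invertible (M z)"
  shows "continuous_on X (\<lambda>z. matrix_inv (M z))"
  unfolding continuous_on_def
proof
  fix z assume z: "z \<in> X"
  then have "(M \<longlongrightarrow> M z) (at z within X)" using assms(1) by (simp add: continuous_on_def)
  then show "((\<lambda>z. matrix_inv (M z)) \<longlongrightarrow> matrix_inv (M z)) (at z within X)"
    by (rule tendsto_matrix_inv) (use assms(2) z in \<open>auto simp: eventually_at_filter\<close>)
qed

lemma continuous_on_matrix_mult: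
  fixes M N :: "'b::topological_space \<Rightarrow> real^'n^'n"
  assumes "continuous_on X M" "continuous_on X N" shows "continuous_on X (\<lambda>z. M z ** N z)"
  using assms unfolding continuous_on_def by (blast intro: tendsto_matrix_mult)

lemma continuous_on_transpose:
  fixes M :: "'b::topological_space \<Rightarrow> real^'n^'n"
  assumes "continuous_on X M" shows "continuous_on X (\<lambda>z. transpose (M z))"
  unfolding transpose_def by (intro continuous_intros assms)

text \<open>Used to follow the determinant of a frame along an orbit, where a step is given implicitly by
  \<open>M *v x = N *v y\<close>.\<close>

lemma det_columns_step:
  fixes M N :: "real^'n^'n"
  assumes "\<And>i. M *v x i = N *v y i"
  shows "det M * det (\<chi> r i. x i $ r) = det N * det (\<chi> r i. y i $ r)"
proof -
  have "M ** (\<chi> r i. x i $ r) = N ** (\<chi> r i. y i $ r)"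
    using assms by (simp add: matrix_matrix_mult_def matrix_vector_mult_def vec_eq_iff)
  then show ?thesis by (metis det_mul)
qed

lemma det_columns_le: "\<bar>det (\<chi> r i. (x :: 'n::finite \<Rightarrow> real^'n) i $ r)\<bar> \<le> fact CARD('n) * (\<Prod>i\<in>UNIV. norm (x i))"
proof -
  have "(\<chi> r i. x i $ r) *v axis i 1 = x i" for i by (simp add: matrix_vector_mult_basis column_def)
  then show ?thesis using det_le_prod_columns[of "\<chi> r i. x i $ r"] by simp
qed

text \<open>A bound for the operator norm that is evidently a continuous function of the matrix.\<close>

definition entry_sum :: "real^'n^'n \<Rightarrow> real" where "entry_sum M = (\<Sum>i\<in>UNIV. \<Sum>j\<in>UNIV. \<bar>M $ i $ j\<bar>)"

lemma entry_sum_nonneg: "0 \<le> entry_sum M" by (simp add: entry_sum_def sum_nonneg)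

lemma norm_le_entry_sum: "norm (M *v x) \<le> entry_sum M * norm x"
  unfolding entry_sum_def
  using onorm[OF matrix_vector_mul_bounded_linear, of M x] onorm_le_matrix_component_sum[of M]
  by (meson mult_right_mono norm_ge_zero order_trans)

lemma measurable_det:
  fixes h :: "'b \<Rightarrow> real^'n^'n"
  assumes "h \<in> borel_measurable M" shows "(\<lambda>a. det (h a)) \<in> borel_measurable M"
  by (rule borel_measurable_continuous_on[OF _ assms])
     (auto simp: continuous_on_def intro: tendsto_det tendsto_ident_at)

lemma measurable_entry_sum:
  fixes h :: "'b \<Rightarrow> real^'n^'n"
  assumes "h \<in> borel_measurable M" shows "(\<lambda>a. entry_sum (h a)) \<in> borel_measurable M"
  unfolding entry_sum_def
  by (rule borel_measurable_continuous_on[of "\<lambda>N. \<Sum>i\<in>UNIV. \<Sum>j\<in>UNIV. \<bar>N $ i $ j\<bar>", OF _ assms])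
     (intro continuous_intros)

section \<open>Jacobi systems and their Green bundles\<close>

lemma norm_fst_le': "norm (fst p) \<le> norm p" and norm_snd_le': "norm (snd p) \<le> norm p"
  by (metis norm_fst_le prod.collapse) (metis norm_snd_le prod.collapse)

text \<open>The Hessian, with blocks \<open>A\<close>, \<open>- B\<close>, \<open>- transpose B\<close>, \<open>C\<close>, of the action of one step.\<close>

definition step_form :: "real^'n^'n \<Rightarrow> real^'n^'n \<Rightarrow> real^'n^'n \<Rightarrow> real^'n \<Rightarrow> real^'n \<Rightarrow> real" where
  "step_form A B C x y = x \<bullet> (A *v x) - 2 * (x \<bullet> (B *v y)) + y \<bullet> (C *v y)"

text \<open>If the graph of \<open>s\<close> consists of pairs of position and momentum, one step of the linearized
  dynamics maps it to the graph of \<open>riccati A B C s\<close>.\<close>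

definition riccati :: "real^'n^'n \<Rightarrow> real^'n^'n \<Rightarrow> real^'n^'n \<Rightarrow> real^'n^'n \<Rightarrow> real^'n^'n" where
  "riccati A B C s = C - transpose B ** matrix_inv (s + A) ** B"

lemma inner_riccati:
  "x \<bullet> (riccati A B C s *v y) = x \<bullet> (C *v y) - (B *v x) \<bullet> (matrix_inv (s + A) *v (B *v y))"
  by (simp add: riccati_def inner_matrix_diff matrix_vector_mul_assoc[symmetric] inner_transpose)

text \<open>Minimizing the sum of an accumulated cost \<open>s\<close> and the cost of one more step over the
  intermediate point \<open>x\<close> gives the cost \<open>riccati A B C s\<close>, with minimizer \<open>x0\<close>. This is the
  dynamic programming principle behind all variational properties below.\<close>

lemma complete_square:
  fixes s A B C :: "real^'n^'n" and x h :: "real^'n"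
  assumes sym: "transpose s = s" "transpose A = A" and inv: "invertible (s + A)"
  defines "x0 \<equiv> matrix_inv (s + A) *v (B *v h)"
  shows "x \<bullet> (s *v x) + step_form A B C x h = h \<bullet> (riccati A B C s *v h) + (x - x0) \<bullet> ((s + A) *v (x - x0))"
proof -
  have M: "(s + A) *v x0 = B *v h" by (simp add: x0_def matrix_inv_vec[OF inv])
  have "x0 \<bullet> ((s + A) *v x) = x \<bullet> ((s + A) *v x0)"
    using inner_sym_matrix[OF sym(1), of x x0] inner_sym_matrix[OF sym(2), of x x0]
        by (simp add: inner_matrix_add)
  then have "(x - x0) \<bullet> ((s + A) *v (x - x0)) = x \<bullet> ((s + A) *v x) - 2 * (x \<bullet> (B *v h)) + x0 \<bullet> (B *v h)"
    by (simp add: matrix_vector_mult_diff_distrib M inner_diff_left inner_diff_right)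
  then show ?thesis
    by (simp add: inner_riccati step_form_def inner_matrix_add x0_def[symmetric] inner_commute)
qed

lemma sym_riccati:
  assumes "transpose s = s" "transpose A = A" "transpose C = C" "invertible (s + A)"
  shows "transpose (riccati A B C s) = riccati A B C s"
proof (rule transpose_eqI)
  have "transpose (s + A) = s + A" using assms(1,2) by (simp add: transpose_def vec_eq_iff)
  then have "transpose (matrix_inv (s + A)) = matrix_inv (s + A)" using assms(4)
      by (rule sym_matrix_inv[rotated])
  then show "x \<bullet> (riccati A B C s *v y) = y \<bullet> (riccati A B C s *v x)" for x y
    using inner_sym_matrix[of "matrix_inv (s + A)" "B *v x" "B *v y"] inner_sym_matrix[OF assms(3), of x y]
    by (simp add: inner_riccati)
qed

text \<open>The graph of \<open>push G A B C k z\<close> is the image at \<open>z\<close> of the vertical space \<open>k + 1\<close> steps earlier;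
  \<open>G\<close> is one step backwards, and \<open>A\<close>, \<open>B\<close>, \<open>C\<close> at a point belong to the step that starts there.\<close>

primrec push :: "('a \<Rightarrow> 'a) \<Rightarrow> ('a \<Rightarrow> real^'n^'n) \<Rightarrow> ('a \<Rightarrow> real^'n^'n) \<Rightarrow> ('a \<Rightarrow> real^'n^'n) \<Rightarrow> nat \<Rightarrow> 'a \<Rightarrow>
    real^'n^'n" where
  "push G A B C 0 = (\<lambda>z. C (G z))"
| "push G A B C (Suc k) = (\<lambda>z. riccati (A (G z)) (B (G z)) (C (G z)) (push G A B C k (G z)))"

definition green_bundle :: "('a \<Rightarrow> 'a) \<Rightarrow> ('a \<Rightarrow> real^'n^'n) \<Rightarrow> ('a \<Rightarrow> real^'n^'n) \<Rightarrow> ('a \<Rightarrow> real^'n^'n) \<Rightarrow> 'a \<Rightarrow>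
    real^'n^'n" where
  "green_bundle G A B C z = lim (\<lambda>k. push G A B C k z)"

definition path_form :: "('a \<Rightarrow> 'a) \<Rightarrow> ('a \<Rightarrow> real^'n^'n) \<Rightarrow> ('a \<Rightarrow> real^'n^'n) \<Rightarrow> ('a \<Rightarrow> real^'n^'n)
    \<Rightarrow> 'a \<Rightarrow> (nat \<Rightarrow> real^'n) \<Rightarrow> nat \<Rightarrow> real" where
  "path_form T A B C z \<xi> k =
     (\<Sum>i<k. step_form (A ((T ^^ i) z)) (B ((T ^^ i) z)) (C ((T ^^ i) z)) (\<xi> i) (\<xi> (Suc i)))"

definition join_paths :: "nat \<Rightarrow> (nat \<Rightarrow> 'b) \<Rightarrow> (nat \<Rightarrow> 'b) \<Rightarrow> nat \<Rightarrow> 'b" where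
  "join_paths m \<xi> \<eta> i = (if i \<le> m then \<xi> i else \<eta> (i - m))"

lemma path_form_join:
  assumes "\<xi> m = \<eta> 0"
  shows "path_form T A B C z (join_paths m \<xi> \<eta>) (m + l) = path_form T A B C z \<xi> m
      + path_form T A B C ((T ^^ m) z) \<eta> l"
proof -
  have s: "join_paths m \<xi> \<eta> (m + i) = \<eta> i" for i using assms by (cases i) (auto simp: join_paths_def)
  have s': "join_paths m \<xi> \<eta> (Suc (m + i)) = \<eta> (Suc i)" for i using s[of "Suc i"] by simp
  have "path_form T A B C z (join_paths m \<xi> \<eta>) (m + l) = path_form T A B C z (join_paths m \<xi> \<eta>) m +
    (\<Sum>i<l. step_form (A ((T ^^ (m + i)) z)) (B ((T ^^ (m + i)) z)) (C ((T ^^ (m + i)) z)) 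
      (join_paths m \<xi> \<eta> (m + i)) (join_paths m \<xi> \<eta> (Suc (m + i))))"
    unfolding path_form_def by (induction l) (auto simp: algebra_simps)
  also have "path_form T A B C z (join_paths m \<xi> \<eta>) m = path_form T A B C z \<xi> m"
    unfolding path_form_def by (rule sum.cong) (auto simp: join_paths_def)
  finally show ?thesis unfolding s s' path_form_def by (simp add: funpow_add add.commute[of m])
qed

text \<open>The deviation \<open>y - s *v x\<close> represents the vector \<open>(x, y)\<close> in the quotient by the graph of \<open>s\<close>,
  so this is the action of one step on that quotient.\<close>

lemma graph_deviation_step:
  fixes A B C s :: "real^'n^'n"
  assumes inv: "invertible (s + A)" and x': "B *v x' = y + A *v x" and y': "y' = C *v x' - transpose B *v x"
  shows "y' - riccati A B C s *v x' = transpose B *v (matrix_inv (s + A) *v (y - s *v x))"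
proof -
  let ?I = "matrix_inv (s + A)"
  have "y' - riccati A B C s *v x' = transpose B *v (?I *v (B *v x') - x)"
    by (simp add: y' riccati_def matrix_vector_mult_diff_rdistrib matrix_vector_mult_diff_distrib
       matrix_vector_mul_assoc matrix_mul_assoc)
  also have "x = ?I *v (s *v x + A *v x)"
    using matrix_inv_vec'[OF inv, of x] by (simp add: matrix_vector_mult_add_rdistrib)
  then have "?I *v (B *v x') - x = ?I *v (B *v x' - (s *v x + A *v x))"
    by (simp add: matrix_vector_mult_diff_distrib)
  also have "B *v x' - (s *v x + A *v x) = y - s *v x" by (simp add: x')
  finally show ?thesis .
qed

lemma continuous_on_push:
  fixes G :: "'b::topological_space \<Rightarrow> 'b" and A B C :: "'b \<Rightarrow> real^'n^'n"
  assumes G: "continuous_on X G" "G ` X \<subseteq> X" and ABC: "continuous_on X A" "continuous_on X B"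
      "continuous_on X C"
    and inv: "\<And>k z. z \<in> X \<Longrightarrow> invertible (push G A B C k z + A z)"
  shows "continuous_on X (push G A B C k)"
proof (induction k)
  case 0
  show ?case using continuous_on_compose2[OF ABC(3) G] by simp
next
  case (Suc k)
  note c = continuous_on_compose2[OF _ G]
  have "invertible (push G A B C k (G z) + A (G z))" if "z \<in> X" for z using G(2) that by (intro inv) auto
  then show ?case
    unfolding push.simps riccati_def
    by (intro continuous_on_diff continuous_on_matrix_mult continuous_on_matrix_inv
        continuous_on_transpose continuous_on_add
      c[OF ABC(1)] c[OF ABC(2)] c[OF ABC(3)] c[OF Suc])
qed

text \<open>The second variation of the action along the orbits of an invertible map \<open>T\<close> with inverse \<open>G\<close>.
  On the invariant set \<open>X\<close> it is nonnegative for variations that vanish at both ends.\<close>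

locale jacobi_system =
  fixes T G :: "'a \<Rightarrow> 'a" and X :: "'a set" and A B C :: "'a \<Rightarrow> real^'n^'n"
  assumes TG: "T (G z) = z" and GT: "G (T z) = z"
    and TX: "z \<in> X \<Longrightarrow> T z \<in> X" and GX: "z \<in> X \<Longrightarrow> G z \<in> X"
    and symA: "transpose (A z) = A z" and symC: "transpose (C z) = C z" and posB: "pos_def (B z)"
    and nonneg: "z \<in> X \<Longrightarrow> \<xi> 0 = 0 \<Longrightarrow> \<xi> k = 0 \<Longrightarrow> 0 \<le> path_form T A B C z \<xi> k"
begin

abbreviation "sp \<equiv> push G A B C"

lemma TG_pow: "(T ^^ k) ((G ^^ k) z) = z" and GT_pow: "(G ^^ k) ((T ^^ k) z) = z"
  by (induction k arbitrary: z) (simp_all add: funpow_swap1 TG GT)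

lemma GX_pow: "z \<in> X \<Longrightarrow> (G ^^ k) z \<in> X" and TX_pow: "z \<in> X \<Longrightarrow> (T ^^ k) z \<in> X"
  by (induction k) (auto simp: GX TX)

text \<open>Let a path of cost \<open>a\<close> end at \<open>h\<close>. If \<open>a + h \<bullet> (A z *v h) \<le> 0\<close>, continuing it to \<open>0\<close> in one step
  costs at most \<open>0\<close>; moving the next point instead a little in direction \<open>h\<close> changes the cost to
  first order by \<open>- 2 * (h \<bullet> (B z *v h)) < 0\<close>, so it would become negative.\<close>

lemma endpoint_form_pos:
  assumes z: "z \<in> X" and \<xi>: "\<xi> 0 = 0" "\<xi> k = h" "path_form T A B C ((G ^^ k) z) \<xi> k = a" and h: "h \<noteq> 0"
  shows "0 < a + h \<bullet> (A z *v h)"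
proof (rule ccontr)
  assume n: "\<not> 0 < a + h \<bullet> (A z *v h)"
  define b where "b = h \<bullet> (B z *v h)"
  define c where "c = h \<bullet> (C z *v h) + h \<bullet> (A (T z) *v h)"
  \<comment> \<open>small enough for the linear gain \<open>2 e b\<close> to exceed the quadratic term \<open>e\<^sup>2 c\<close>\<close>
  define e where "e = b / (\<bar>c\<bar> + 1)"
  have b: "0 < b" using posB[of z] h by (simp add: b_def pos_def_def)
  then have e: "0 < e" "e * \<bar>c\<bar> < b" by (auto simp: e_def field_simps)
  define \<eta> where "\<eta> = (\<lambda>i::nat. if i = 0 then h else if i = 1 then e *\<^sub>R h else 0)"
  have "0 \<le> path_form T A B C ((G ^^ k) z) (join_paths k \<xi> \<eta>) (k + 2)"
    using \<xi> by (intro nonneg GX_pow z) (auto simp: join_paths_def \<eta>_def)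
  also have "\<dots> = a + path_form T A B C z \<eta> 2"
    using \<xi> by (subst path_form_join) (auto simp: \<eta>_def TG_pow)
  also have "path_form T A B C z \<eta> 2 = h \<bullet> (A z *v h) - 2 * e * b + e * e * c"
    by (simp add: path_form_def numeral_2_eq_2 \<eta>_def step_form_def matrix_vector_mult_scaleR b_def c_def
        algebra_simps)
  finally have "2 * e * b \<le> e * (e * c)" using n by (simp add: algebra_simps)
  then have "2 * b \<le> e * c" using e by (simp add: mult.assoc mult.left_commute[of 2])
  also have "e * c \<le> e * \<bar>c\<bar>" using e by (intro mult_left_mono) auto
  finally show False using e b by linarith
qed

text \<open>The three properties are proved together: a path that attains the form at time \<open>k\<close> gives, by the
  previous lemma, the definiteness that makes the next Riccati step well defined.\<close>

lemma sp_props: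
  assumes "z \<in> X"
  shows "transpose (sp k z) = sp k z \<and> pos_def (sp k z + A z) \<and>
    (\<forall>h. \<exists>\<xi>. \<xi> 0 = 0 \<and> \<xi> (Suc k) = h \<and> path_form T A B C ((G ^^ Suc k) z) \<xi> (Suc k) = h \<bullet> (sp k z *v h))"
  using assms
proof (induction k arbitrary: z)
  case 0
  have *: "\<exists>\<xi>. \<xi> 0 = 0 \<and> \<xi> (Suc 0) = h \<and> path_form T A B C ((G ^^ Suc 0) z) \<xi> (Suc 0) = h \<bullet> (sp 0 z *v h)" for h
    by (rule exI[of _ "\<lambda>i. if i = 0 then 0 else h"]) (simp add: path_form_def step_form_def)
  have "pos_def (sp 0 z + A z)" unfolding pos_def_def inner_matrix_add
    using * endpoint_form_pos[OF 0] by metis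
  then show ?case using * symC by simp
next
  case (Suc k)
  note IH = Suc.IH[OF GX[OF Suc.prems]]
  have inv: "invertible (sp k (G z) + A (G z))" using IH pos_def_invertible by blast
  have *: "\<exists>\<xi>. \<xi> 0 = 0 \<and> \<xi> (Suc (Suc k)) = h \<and> 
     path_form T A B C ((G ^^ Suc (Suc k)) z) \<xi> (Suc (Suc k)) = h \<bullet> (sp (Suc k) z *v h)" for h
  proof -
    define x where "x = matrix_inv (sp k (G z) + A (G z)) *v (B (G z) *v h)"
    obtain \<xi> where \<xi>: "\<xi> 0 = 0" "\<xi> (Suc k) = x" 
      "path_form T A B C ((G ^^ Suc k) (G z)) \<xi> (Suc k) = x \<bullet> (sp k (G z) *v x)" using IH by blast
    define \<eta> where "\<eta> = (\<lambda>i::nat. if i = 0 then x else h)"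
    have "path_form T A B C ((G ^^ Suc k) (G z)) (join_paths (Suc k) \<xi> \<eta>) (Suc k + 1) = x \<bullet> (sp k (G z) *v x) 
       + path_form T A B C (G z) \<eta> 1"
      using \<xi> by (subst path_form_join) (auto simp: \<eta>_def TG_pow simp del: funpow.simps)
    also have "\<dots> = x \<bullet> (sp k (G z) *v x) + step_form (A (G z)) (B (G z)) (C (G z)) x h"
      by (simp add: path_form_def \<eta>_def)
    also have "\<dots> = h \<bullet> (sp (Suc k) z *v h)"
      by (subst complete_square) (use IH in \<open>simp_all add: symA inv x_def\<close>)
    finally show ?thesis using \<xi>
      by (intro exI[of _ "join_paths (Suc k) \<xi> \<eta>"]) (auto simp: join_paths_def \<eta>_def funpow_swap1)
  qed
  have "pos_def (sp (Suc k) z + A z)" unfolding pos_def_def inner_matrix_add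
    using * endpoint_form_pos[OF Suc.prems] by metis
  moreover have "transpose (sp (Suc k) z) = sp (Suc k) z"
    using IH inv by (simp add: sym_riccati symA symC)
  ultimately show ?case using * by blast
qed

text \<open>Together with the paths of \<open>sp_props\<close> this says that \<open>sp k z\<close> is the least cost of reaching a
  point from \<open>0\<close> in \<open>k + 1\<close> steps.\<close>

lemma sp_minimal:
  assumes "z \<in> X" "\<xi> 0 = 0"
  shows "\<xi> (Suc k) \<bullet> (sp k z *v \<xi> (Suc k)) \<le> path_form T A B C ((G ^^ Suc k) z) \<xi> (Suc k)"
  using assms
proof (induction k arbitrary: z)
  case 0
  then show ?case by (simp add: path_form_def step_form_def)
next
  case (Suc k)
  let ?x = "\<xi> (Suc k)" and ?h = "\<xi> (Suc (Suc k))" and ?M = "sp k (G z) + A (G z)"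
  have P: "transpose (sp k (G z)) = sp k (G z)" "pos_def ?M" using sp_props[OF GX[OF Suc.prems(1)]] by blast+
  have "0 \<le> v \<bullet> (?M *v v)" for v using P(2) unfolding pos_def_def by (cases "v = 0") (auto simp: less_imp_le)
  then have "?h \<bullet> (sp (Suc k) z *v ?h) \<le> ?x \<bullet> (sp k (G z) *v ?x)
      + step_form (A (G z)) (B (G z)) (C (G z)) ?x ?h"
    by (subst complete_square) (use P in \<open>simp_all add: symA pos_def_invertible\<close>)
  also have "\<dots> \<le> path_form T A B C ((G ^^ Suc k) (G z)) \<xi> (Suc k)
      + step_form (A (G z)) (B (G z)) (C (G z)) ?x ?h"
    using Suc.IH[OF GX[OF Suc.prems(1)] Suc.prems(2)] by simp
  also have "\<dots> = path_form T A B C ((G ^^ Suc k) (G z)) \<xi> (Suc (Suc k))"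
    using TG_pow[of "Suc k" "G z"] by (simp add: path_form_def del: funpow.simps)
  finally show ?case by (simp add: funpow_swap1)
qed

text \<open>A path can be prolonged at its start by staying at \<open>0\<close> for one step, at no cost.\<close>

lemma sp_decreasing:
  assumes "z \<in> X" shows "h \<bullet> (sp (Suc k) z *v h) \<le> h \<bullet> (sp k z *v h)"
proof -
  obtain \<xi> where \<xi>: "\<xi> 0 = 0" "\<xi> (Suc k) = h" 
      "path_form T A B C ((G ^^ Suc k) z) \<xi> (Suc k) = h \<bullet> (sp k z *v h)" using sp_props[OF assms] by blast
  let ?\<xi> = "join_paths 1 (\<lambda>_. 0) \<xi>"
  have "?\<xi> (Suc (Suc k)) = h" "?\<xi> 0 = 0" using \<xi> by (auto simp: join_paths_def)
  then have "h \<bullet> (sp (Suc k) z *v h) \<le> path_form T A B C ((G ^^ Suc (Suc k)) z) ?\<xi> (1 + Suc k)"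
    using sp_minimal[OF assms, of ?\<xi> "Suc k"] by simp
  also have "\<dots> = h \<bullet> (sp k z *v h)"
    using \<xi> by (subst path_form_join) (simp_all add: TG path_form_def[of _ _ _ _ _ "\<lambda>_. 0"] step_form_def)
  finally show ?thesis .
qed

text \<open>For each \<open>h\<close> the values of the forms decrease and are bounded below by \<open>- (h \<bullet> (A z *v h))\<close>;
  polarization recovers the matrix entries.\<close>

lemma sp_convergent:
  assumes z: "z \<in> X" shows "(\<lambda>k. sp k z) \<longlonglongrightarrow> green_bundle G A B C z"
proof -
  have conv: "convergent (\<lambda>k. h \<bullet> (sp k z *v h))" for h
  proof -
    have "- (h \<bullet> (A z *v h)) \<le> h \<bullet> (sp k z *v h)" for k
      using sp_props[OF z, of k] unfolding pos_def_def inner_matrix_add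
      by (cases "h = 0") (auto simp: algebra_simps intro: less_imp_le dest!: spec[of _ h])
    moreover have "decseq (\<lambda>k. h \<bullet> (sp k z *v h))" using sp_decreasing[OF z] by (rule decseq_SucI)
    ultimately obtain a where "(\<lambda>k. h \<bullet> (sp k z *v h)) \<longlonglongrightarrow> a"
      using decseq_convergent[of "\<lambda>k. h \<bullet> (sp k z *v h)"] by blast
    then show ?thesis by (rule convergentI)
  qed
  have e: "sp k z $ i $ j = ((axis i 1 + axis j 1) \<bullet> (sp k z *v (axis i 1
      + axis j 1)) - axis i 1 \<bullet> (sp k z *v axis i 1) 
     - axis j 1 \<bullet> (sp k z *v axis j 1)) / 2" for k i j
  proof -
    have "sp k z $ i $ j = axis i 1 \<bullet> (sp k z *v axis j 1)" for i j
      by (simp add: matrix_vector_mult_basis column_def inner_axis')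
    moreover have "axis i 1 \<bullet> (sp k z *v axis j 1) = axis j 1 \<bullet> (sp k z *v axis i 1)"
      using sp_props[OF z] inner_sym_matrix by blast
    ultimately show ?thesis by (simp add: matrix_vector_right_distrib inner_add_left inner_add_right)
  qed
  have "convergent (\<lambda>k. sp k z $ i $ j)" for i j
  proof -
    obtain a b c where "(\<lambda>k. (axis i 1 + axis j 1) \<bullet> (sp k z *v (axis i 1 + axis j 1))) \<longlonglongrightarrow> a"
      "(\<lambda>k. axis i 1 \<bullet> (sp k z *v axis i 1)) \<longlonglongrightarrow> b" "(\<lambda>k. axis j 1 \<bullet> (sp k z *v axis j 1)) \<longlonglongrightarrow> c"
      using conv unfolding convergent_def by meson
    then show ?thesis unfolding e by (intro convergentI[of _ "(a - b - c) / 2"] tendsto_intros) auto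
  qed
  then have "\<exists>l. \<forall>i j. (\<lambda>k. sp k z $ i $ j) \<longlonglongrightarrow> l i j" unfolding convergent_def by metis
  then obtain l where "\<And>i j. (\<lambda>k. sp k z $ i $ j) \<longlonglongrightarrow> l i j" by blast
  then have "(\<lambda>k. sp k z) \<longlonglongrightarrow> (\<chi> i j. l i j)" by (intro vec_tendstoI) simp
  then show ?thesis unfolding green_bundle_def by (simp add: limI)
qed

lemma sp_form_tendsto: "z \<in> X \<Longrightarrow> (\<lambda>k. h \<bullet> (sp k z *v h')) \<longlonglongrightarrow> h \<bullet> (green_bundle G A B C z *v h')"
  by (intro tendsto_inner_matrix sp_convergent)

lemma green_bundle_le: assumes "z \<in> X" shows "h \<bullet> (green_bundle G A B C z *v h) \<le> h \<bullet> (sp k z *v h)"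
proof -
  have "decseq (\<lambda>k. h \<bullet> (sp k z *v h))" using sp_decreasing[OF assms] by (rule decseq_SucI)
  then show ?thesis using sp_form_tendsto[OF assms] by (rule decseq_ge)
qed

lemma sym_green_bundle: assumes "z \<in> X" shows "transpose (green_bundle G A B C z) = green_bundle G A B C z"
proof (rule transpose_eqI)
  fix x y
  have "(\<lambda>k. x \<bullet> (sp k z *v y)) = (\<lambda>k. y \<bullet> (sp k z *v x))"
    using sp_props[OF assms] inner_sym_matrix by blast
  then show "x \<bullet> (green_bundle G A B C z *v y) = y \<bullet> (green_bundle G A B C z *v x)"
    using sp_form_tendsto[OF assms, of x y] sp_form_tendsto[OF assms, of y x] LIMSEQ_unique by metis
qed

text \<open>The same system with time reversed. The step from \<open>z\<close> to \<open>G z\<close> is the step from \<open>G z\<close> to \<open>z\<close> run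
  backwards, so \<open>A\<close> and \<open>C\<close> exchange their roles and \<open>B\<close> is transposed.\<close>

abbreviation "Ar \<equiv> \<lambda>z. C (G z)"
abbreviation "Br \<equiv> \<lambda>z. transpose (B (G z))"
abbreviation "Cr \<equiv> \<lambda>z. A (G z)"
abbreviation "rp \<equiv> push T Ar Br Cr"

lemma path_form_reverse:
  "path_form G Ar Br Cr z \<xi> k = path_form T A B C ((G ^^ k) z) (\<lambda>i. \<xi> (k - i)) k"
proof -
  have "(T ^^ i) ((G ^^ k) z) = (G ^^ (k - i)) z" if "i \<le> k" for i
  proof -
    have "(G ^^ k) z = (G ^^ i) ((G ^^ (k - i)) z)" using that
        by (simp add: funpow_add[symmetric, unfolded o_def] flip: comp_apply[of "G ^^ i"] funpow_add)
    then show ?thesis by (simp add: TG_pow)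
  qed
  then have "path_form T A B C ((G ^^ k) z) (\<lambda>i. \<xi> (k - i)) k = 
    (\<Sum>i<k. (\<lambda>j. step_form (A ((G ^^ Suc j) z)) (B ((G ^^ Suc j) z)) (C ((G ^^ Suc j) z)) (\<xi> (Suc j)) (\<xi>
        j)) (k - Suc i))"
    unfolding path_form_def by (intro sum.cong) (auto simp: Suc_diff_Suc simp del: funpow.simps)
  also have "\<dots> = (\<Sum>j<k. step_form (A ((G ^^ Suc j) z)) (B ((G ^^ Suc j) z)) (C ((G ^^ Suc j) z)) (\<xi> (Suc
      j)) (\<xi> j))"
    by (rule sum.nat_diff_reindex)
  also have "\<dots> = path_form G Ar Br Cr z \<xi> k"
    unfolding path_form_def by (intro sum.cong) (auto simp: step_form_def inner_transpose inner_commute)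
  finally show ?thesis ..
qed

lemma reverse: "jacobi_system G T X Ar Br Cr"
proof
  fix z and \<xi> :: "nat \<Rightarrow> real^'n" and k assume "z \<in> X" "\<xi> 0 = 0" "\<xi> k = 0"
  then show "0 \<le> path_form G Ar Br Cr z \<xi> k"
    unfolding path_form_reverse by (intro nonneg GX_pow) auto
next
  fix z show "pos_def (Br z)" using posB[of "G z"] by (simp add: pos_def_def inner_transpose inner_commute)
qed (auto simp: TG GT TX GX symA symC)

lemma rp_path:
  assumes z: "z \<in> X"
  shows "\<exists>\<zeta>. \<zeta> 0 = h \<and> \<zeta> (Suc j) = 0 \<and> path_form T A B C z \<zeta> (Suc j) = h \<bullet> (rp j z *v h)"
proof -
  interpret rev: jacobi_system G T X Ar Br Cr by (rule reverse)
  obtain \<eta> where \<eta>: "\<eta> 0 = 0" "\<eta> (Suc j) = h"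
      "path_form G Ar Br Cr ((T ^^ Suc j) z) \<eta> (Suc j) = h \<bullet> (rp j z *v h)"
    using rev.sp_props[OF z] by blast
  show ?thesis
  proof (intro exI conjI)
    show "path_form T A B C z (\<lambda>i. \<eta> (Suc j - i)) (Suc j) = h \<bullet> (rp j z *v h)"
      using \<eta>(3) unfolding path_form_reverse GT_pow .
  qed (use \<eta> in auto)
qed

text \<open>An optimal path from \<open>0\<close> to \<open>h\<close> followed by an optimal path from \<open>h\<close> to \<open>0\<close> has vanishing ends.\<close>

lemma sp_rp_nonneg:
  assumes z: "z \<in> X" shows "0 \<le> h \<bullet> (sp k z *v h) + h \<bullet> (rp j z *v h)"
proof -
  obtain \<xi> where \<xi>: "\<xi> 0 = 0" "\<xi> (Suc k) = h"
      "path_form T A B C ((G ^^ Suc k) z) \<xi> (Suc k) = h \<bullet> (sp k z *v h)" using sp_props[OF z] by blast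
  obtain \<zeta> where \<zeta>: "\<zeta> 0 = h" "\<zeta> (Suc j) = 0"
      "path_form T A B C z \<zeta> (Suc j) = h \<bullet> (rp j z *v h)" using rp_path[OF z] by blast
  have "0 \<le> path_form T A B C ((G ^^ Suc k) z) (join_paths (Suc k) \<xi> \<zeta>) (Suc k + Suc j)"
    using \<xi> \<zeta> by (intro nonneg GX_pow z) (auto simp: join_paths_def)
  also have "\<dots> = h \<bullet> (sp k z *v h) + h \<bullet> (rp j z *v h)"
    using \<xi> \<zeta> by (subst path_form_join) (auto simp: TG_pow simp del: funpow.simps)
  finally show ?thesis .
qed

text \<open>The graphs of \<open>Sp\<close> and \<open>Sm\<close> are the Green bundles: the limits of the images of the vertical
  spaces from the far past and from the far future. The sign in \<open>Sm\<close> comes from the reversal of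
  momentum with time.\<close>

abbreviation "Sp \<equiv> green_bundle G A B C"
abbreviation "Sm \<equiv> \<lambda>z. - green_bundle T Ar Br Cr z"

lemma Sm_le_Sp: assumes z: "z \<in> X" shows "h \<bullet> (Sm z *v h) \<le> h \<bullet> (Sp z *v h)"
proof -
  interpret rev: jacobi_system G T X Ar Br Cr by (rule reverse)
  have "(\<lambda>k. h \<bullet> (sp k z *v h) + h \<bullet> (rp k z *v h)) \<longlonglongrightarrow> h \<bullet> (Sp z *v h) + h \<bullet> (green_bundle T Ar Br Cr z *v h)"
    by (intro tendsto_add sp_form_tendsto rev.sp_form_tendsto z)
  then have "0 \<le> h \<bullet> (Sp z *v h) + h \<bullet> (green_bundle T Ar Br Cr z *v h)"
    by (rule LIMSEQ_le_const) (use sp_rp_nonneg[OF z] in auto)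
  moreover have "h \<bullet> (Sm z *v h) = - (h \<bullet> (green_bundle T Ar Br Cr z *v h))" 
    using inner_matrix_diff[of h 0] by simp
  ultimately show ?thesis by linarith
qed

lemma sym_Sm: "z \<in> X \<Longrightarrow> transpose (Sm z) = Sm z"
proof -
  assume z: "z \<in> X"
  interpret rev: jacobi_system G T X Ar Br Cr by (rule reverse)
  show ?thesis using rev.sym_green_bundle[OF z] by (simp add: transpose_def vec_eq_iff)
qed

text \<open>The bound \<open>- A\<close> for \<open>Sm\<close> is the zeroth approximation \<open>- rp 0\<close>; the first one, \<open>- rp 1\<close>, is
  already strictly larger, by \<open>B N\<^bsup>-1\<^esup> (transpose B)\<close> with \<open>N\<close> positive definite.\<close>

lemma pos_def_Sm: assumes z: "z \<in> X" shows "pos_def (Sm z + A z)"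
  unfolding pos_def_def
proof (intro allI impI)
  fix h :: "real^'n" assume h: "h \<noteq> 0"
  interpret rev: jacobi_system G T X Ar Br Cr by (rule reverse)
  let ?N = "rp 0 (T z) + C z"
  have N: "pos_def ?N" using rev.sp_props[OF TX[OF z], of 0] GT by metis
  have "transpose (B z) *v h \<noteq> 0"
    using rev.posB[of "T z"] h unfolding pos_def_def GT by (metis inner_zero_right less_irrefl)
  then have "0 < (transpose (B z) *v h) \<bullet> (matrix_inv ?N *v (transpose (B z) *v h))" using N
      by (rule pos_def_inv_pos[rotated])
  also have "\<dots> = h \<bullet> (A z *v h) - h \<bullet> (rp 1 z *v h)" by (simp add: inner_riccati GT)
  also have "\<dots> \<le> h \<bullet> ((Sm z + A z) *v h)"
    using rev.green_bundle_le[OF z, of h 1] inner_matrix_diff[of h 0 "green_bundle T Ar Br Cr z" h]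
    unfolding inner_matrix_add by simp
  finally show "0 < h \<bullet> ((Sm z + A z) *v h)" .
qed

lemma pos_def_Sp: assumes z: "z \<in> X" shows "pos_def (Sp z + A z)"
  unfolding pos_def_def
proof (intro allI impI)
  fix h :: "real^'n" assume "h \<noteq> 0"
  then have "0 < h \<bullet> ((Sm z + A z) *v h)" using pos_def_Sm[OF z] unfolding pos_def_def by blast
  then show "0 < h \<bullet> ((Sp z + A z) *v h)" using Sm_le_Sp[OF z, of h] unfolding inner_matrix_add by linarith
qed

lemma Sp_riccati: assumes z: "z \<in> X" shows "Sp (T z) = riccati (A z) (B z) (C z) (Sp z)"
proof -
  have "(\<lambda>k. sp (Suc k) (T z)) \<longlonglongrightarrow> Sp (T z)" using sp_convergent[OF TX[OF z]] by (rule LIMSEQ_Suc)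
  have "\<forall>\<^sub>F k in sequentially. invertible (sp k z + A z)"
    using sp_props[OF z] pos_def_invertible by (intro always_eventually) blast
  then have "(\<lambda>k. sp (Suc k) (T z)) \<longlonglongrightarrow> riccati (A z) (B z) (C z) (Sp z)"
    unfolding push.simps riccati_def GT
    by (intro tendsto_diff tendsto_const tendsto_add tendsto_matrix_mult tendsto_matrix_inv
      sp_convergent z pos_def_invertible pos_def_Sp)
  then show ?thesis using LIMSEQ_unique \<open>_ \<longlonglongrightarrow> Sp (T z)\<close> by blast
qed

text \<open>The reversed system expresses \<open>Sm z\<close> through \<open>Sm (T z)\<close>; solving that equation for \<open>Sm (T z)\<close>
  gives the Riccati equation in forward time.\<close>

lemma Sm_riccati: assumes z: "z \<in> X" shows "Sm (T z) = riccati (A z) (B z) (C z) (Sm z)"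
proof -
  interpret rev: jacobi_system G T X Ar Br Cr by (rule reverse)
  let ?N = "green_bundle T Ar Br Cr (T z) + C z"
  have N: "invertible ?N" using rev.pos_def_Sp[OF TX[OF z]] GT pos_def_invertible by metis
  have B: "inj ((*v) (B z))" using posB[of z] pos_def_invertible inj_matrix_vector_mult by blast
  have AS: "Sm z + A z = B z ** matrix_inv ?N ** transpose (B z)"
    using rev.Sp_riccati[OF TX[OF z]] by (simp add: GT riccati_def)
  have inv: "invertible (Sm z + A z)" using pos_def_Sm[OF z] by (rule pos_def_invertible)
  have "transpose (B z) ** matrix_inv (Sm z + A z) ** B z = ?N"
  proof (subst matrix_eq, intro allI)
    fix v
    define w where "w = matrix_inv (Sm z + A z) *v (B z *v v)"
    have "B z *v v = (B z ** matrix_inv ?N ** transpose (B z)) *v w"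
      unfolding AS[symmetric] w_def matrix_inv_vec[OF inv] ..
    then have "B z *v v = B z *v (matrix_inv ?N *v (transpose (B z) *v w))"
        by (simp add: matrix_vector_mul_assoc matrix_mul_assoc)
    then have "v = matrix_inv ?N *v (transpose (B z) *v w)" using B by (simp add: inj_eq)
    then have "?N *v v = transpose (B z) *v w" by (simp add: matrix_inv_vec[OF N])
    then show "(transpose (B z) ** matrix_inv (Sm z + A z) ** B z) *v v = ?N *v v"
      by (simp add: w_def matrix_vector_mul_assoc matrix_mul_assoc)
  qed
  then show ?thesis by (simp add: riccati_def)
qed

text \<open>The quotient of the determinants by which one step acts on the two Green bundles; the common
  factor \<open>det (B z)\<close> cancels.\<close>

definition det_ratio :: "'a \<Rightarrow> real" where
  "det_ratio z = det (Sp z + A z) / det (Sm z + A z)"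

lemma det_ratio_ge_1: "z \<in> X \<Longrightarrow> 1 \<le> det_ratio z"
  and det_ratio_eq_1: "z \<in> X \<Longrightarrow> det_ratio z = 1 \<Longrightarrow> Sp z = Sm z"
proof -
  assume z: "z \<in> X"
  let ?N = "Sp z - Sm z"
  have pos: "0 < det (Sm z + A z)" by (rule pos_def_det_pos[OF pos_def_Sm[OF z]])
  have "transpose ?N = ?N" using sym_green_bundle[OF z] sym_Sm[OF z] by (simp add: transpose_def vec_eq_iff)
  moreover have "0 \<le> x \<bullet> (?N *v x)" for x unfolding inner_matrix_diff using Sm_le_Sp[OF z, of x] by simp
  ultimately have "det (Sm z + A z) < det (Sm z + A z + ?N)" if "?N \<noteq> 0"
    using that by (intro det_strict_mono_psd pos_def_Sm z)
  moreover have "Sm z + A z + ?N = Sp z + A z" by simp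
  ultimately have lt: "det (Sm z + A z) < det (Sp z + A z)" if "Sp z \<noteq> Sm z"
    using that by (metis right_minus_eq)
  then show "1 \<le> det_ratio z" using pos by (cases "Sp z = Sm z") (auto simp: det_ratio_def)
  show "Sp z = Sm z" if "det_ratio z = 1" using lt pos that by (fastforce simp: det_ratio_def)
qed

text \<open>Orbits of the linearized dynamics, in coordinates of position and momentum.\<close>

definition jacobi_field :: "'a \<Rightarrow> (nat \<Rightarrow> (real^'n) \<times> (real^'n)) \<Rightarrow> bool" where
  "jacobi_field z v \<longleftrightarrow> (\<forall>k. B ((T ^^ k) z) *v fst (v (Suc k)) = snd (v k) + A ((T ^^ k) z) *v fst (v k) \<and>
     snd (v (Suc k)) = C ((T ^^ k) z) *v fst (v (Suc k)) - transpose (B ((T ^^ k) z)) *v fst (v k))"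

lemma jacobi_field_deviation:
  assumes z: "z \<in> X" and v: "jacobi_field z v"
  shows "snd (v (Suc k)) - Sm ((T ^^ Suc k) z) *v fst (v (Suc k)) = transpose (B ((T ^^ k) z)) *v
      (matrix_inv (Sm ((T ^^ k) z) + A ((T ^^ k) z)) *v (snd (v k) - Sm ((T ^^ k) z) *v fst (v k)))"
    and "snd (v (Suc k)) - Sp ((T ^^ Suc k) z) *v fst (v (Suc k)) = transpose (B ((T ^^ k) z)) *v
      (matrix_inv (Sp ((T ^^ k) z) + A ((T ^^ k) z)) *v (snd (v k) - Sp ((T ^^ k) z) *v fst (v k)))"
proof -
  let ?z = "(T ^^ k) z"
  have z': "?z \<in> X" by (rule TX_pow[OF z])
  note * = graph_deviation_step[of _ "A ?z" "B ?z" "fst (v (Suc k))" "snd (v k)" "fst (v k)" "snd (v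
      (Suc k))" "C ?z"]
  have v': "B ?z *v fst (v (Suc k)) = snd (v k) + A ?z *v fst (v k)"
     "snd (v (Suc k)) = C ?z *v fst (v (Suc k)) - transpose (B ?z) *v fst (v k)"
    using v unfolding jacobi_field_def by blast+
  show "snd (v (Suc k)) - Sm ((T ^^ Suc k) z) *v fst (v (Suc k)) = transpose (B ?z) *v
      (matrix_inv (Sm ?z + A ?z) *v (snd (v k) - Sm ?z *v fst (v k)))"
    using *[OF pos_def_invertible[OF pos_def_Sm[OF z']] v'] Sm_riccati[OF z'] by simp
  show "snd (v (Suc k)) - Sp ((T ^^ Suc k) z) *v fst (v (Suc k)) = transpose (B ?z) *v
      (matrix_inv (Sp ?z + A ?z) *v (snd (v k) - Sp ?z *v fst (v k)))"
    using *[OF pos_def_invertible[OF pos_def_Sp[OF z']] v'] Sp_riccati[OF z'] by simp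
qed

lemma jacobi_field_in_Sp:
  assumes z: "z \<in> X" and v: "jacobi_field z v" and v0: "snd (v 0) = Sp z *v fst (v 0)"
  shows "snd (v k) = Sp ((T ^^ k) z) *v fst (v k)"
proof (induction k)
  case (Suc k)
  then show ?case using jacobi_field_deviation(2)[OF z v, of k] by simp
qed (simp add: v0)

text \<open>The fields \<open>v i\<close> start from a basis of the graph of \<open>Sp\<close>, the fields \<open>w i\<close> from a basis of the
  vertical space, which is a complement of the graph of \<open>Sm\<close>. The determinant of the positions of
  the former, times the determinant of the deviations of the latter from \<open>Sm\<close>, is exactly the
  product of the ratios.\<close>

lemma prod_det_ratio_le:
  assumes z: "z \<in> X"
    and v: "\<And>i. jacobi_field z (v i)" "\<And>i. v i 0 = (axis i 1, Sp z *v axis i 1)"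
    and w: "\<And>i. jacobi_field z (w i)" "\<And>i. w i 0 = (0, axis i 1)"
  shows "(\<Prod>j<k. det_ratio ((T ^^ j) z)) \<le> (fact CARD('n))\<^sup>2 * (\<Prod>i\<in>UNIV. norm (v i k)) *
      (\<Prod>i\<in>UNIV. norm (snd (w i k) - Sm ((T ^^ k) z) *v fst (w i k)))"
proof -
  let ?d = "\<lambda>i k. snd (w i k) - Sm ((T ^^ k) z) *v fst (w i k)"
  define V where "V k = det (\<chi> r i. fst (v i k) $ r)" for k
  define W where "W k = det (\<chi> r i. ?d i k $ r)" for k
  have id: "(\<chi> r i. axis i 1 $ r) = (mat 1 :: real^'n^'n)" by (simp add: mat_def axis_def vec_eq_iff)
  have "V k * W k = (\<Prod>j<k. det_ratio ((T ^^ j) z))"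
  proof (induction k)
    case 0
    show ?case by (simp add: V_def W_def v w id)
  next
    case (Suc k)
    let ?z = "(T ^^ k) z"
    have z': "?z \<in> X" by (rule TX_pow[OF z])
    have B0: "det (B ?z) > 0" by (rule pos_def_det_pos[OF posB])
    have Sm0: "det (Sm ?z + A ?z) > 0" by (rule pos_def_det_pos[OF pos_def_Sm[OF z']])
    have "B ?z *v fst (v i (Suc k)) = (Sp ?z + A ?z) *v fst (v i k)" for i
      using v(1)[of i] jacobi_field_in_Sp[OF z v(1), of i k] v(2)[of i]
      by (simp add: jacobi_field_def matrix_vector_mult_add_rdistrib)
    from det_columns_step[OF this] have 1: "det (B ?z) * V (Suc k) = det (Sp ?z + A ?z) * V k"
      by (simp add: V_def)
    have "mat 1 *v ?d i (Suc k) = (transpose (B ?z) ** matrix_inv (Sm ?z + A ?z)) *v ?d i k" for i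
      using jacobi_field_deviation(1)[OF z w(1)] by (simp add: matrix_vector_mul_assoc del: funpow.simps)
    from det_columns_step[OF this] have "W (Suc k) = det (B ?z) * det (matrix_inv (Sm ?z + A ?z)) * W k"
      unfolding W_def det_mul det_transpose det_I by simp
    moreover have "det (matrix_inv (Sm ?z + A ?z)) * det (Sm ?z + A ?z) = 1"
      using matrix_inv_left[OF pos_def_invertible[OF pos_def_Sm[OF z']]] by (metis det_I det_mul)
    then have "det (matrix_inv (Sm ?z + A ?z)) = 1 / det (Sm ?z + A ?z)" using Sm0 by (simp add: field_simps)
    ultimately have "V (Suc k) * W (Suc k) = det_ratio ?z * (V k * W k)"
      using 1 B0 by (simp add: det_ratio_def field_simps)
    then show ?case by (simp add: Suc.IH)
  qed
  then have "(\<Prod>j<k. det_ratio ((T ^^ j) z)) \<le> \<bar>V k\<bar> * \<bar>W k\<bar>"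
    by (metis abs_ge_self abs_mult)
  also have "\<dots> \<le> (fact CARD('n) * (\<Prod>i\<in>UNIV. norm (fst (v i k)))) * (fact CARD('n) * (\<Prod>i\<in>UNIV. norm (?d i k)))"
    unfolding V_def W_def by (intro mult_mono det_columns_le) (auto intro!: mult_nonneg_nonneg prod_nonneg)
  also have "\<dots> \<le> (fact CARD('n) * (\<Prod>i\<in>UNIV. norm (v i k))) * (fact CARD('n) * (\<Prod>i\<in>UNIV. norm (?d i k)))"
    by (intro mult_right_mono mult_left_mono prod_mono) (auto intro!: mult_nonneg_nonneg prod_nonneg
        norm_fst_le')
  finally show ?thesis by (simp add: power2_eq_square mult_ac)
qed

lemma sum_ln_det_ratio_le:
  assumes z: "z \<in> X"
    and v: "\<And>i. jacobi_field z (v i)" "\<And>i. v i 0 = (axis i 1, Sp z *v axis i 1)"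
    and w: "\<And>i. jacobi_field z (w i)" "\<And>i. w i 0 = (0, axis i 1)"
    and growth: "\<And>i. ln (norm (v i k)) \<le> a" "\<And>i. ln (norm (w i k)) \<le> a"
  shows "(\<Sum>j<k. ln (det_ratio ((T ^^ j) z))) \<le> 2 * ln (fact CARD('n)) + 2 * real CARD('n) * a +
      real CARD('n) * ln (1 + entry_sum (Sm ((T ^^ k) z)))"
proof -
  let ?d = "\<lambda>i. snd (w i k) - Sm ((T ^^ k) z) *v fst (w i k)" and ?e = "entry_sum (Sm ((T ^^ k) z))"
  have factors: "b \<noteq> 0 \<and> c \<noteq> 0" if "0 < x * b * c" for x b c :: real using that by auto
  have ratio: "0 < det_ratio ((T ^^ j) z)" for j using det_ratio_ge_1[OF TX_pow[OF z]] less_le_trans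
      zero_less_one by blast
  have ratio0: "det_ratio ((T ^^ j) z) \<noteq> 0" for j using ratio[of j] by simp
  have d: "norm (?d i) \<le> (1 + ?e) * norm (w i k)" for i
  proof -
    have "norm (?d i) \<le> norm (snd (w i k)) + ?e * norm (fst (w i k))"
      using norm_triangle_ineq4[of "snd (w i k)"] norm_le_entry_sum by (meson add_left_mono order_trans)
    also have "\<dots> \<le> norm (w i k) + ?e * norm (w i k)"
      by (intro add_mono mult_left_mono norm_fst_le' norm_snd_le' entry_sum_nonneg)
    finally show ?thesis by (simp add: algebra_simps)
  qed
  have "0 < (\<Prod>j<k. det_ratio ((T ^^ j) z))" using ratio by (intro prod_pos) auto
  also note P = prod_det_ratio_le[OF z v w, of k]
  finally have "(\<Prod>i\<in>UNIV. norm (v i k)) \<noteq> 0 \<and> (\<Prod>i\<in>UNIV. norm (?d i)) \<noteq> 0"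
    by (rule factors)
  then have v0: "v i k \<noteq> 0" and d0: "?d i \<noteq> 0" for i by (auto simp: prod_zero_iff)
  have w0: "w i k \<noteq> 0" for i using d0[of i] by auto
  have "(\<Sum>j<k. ln (det_ratio ((T ^^ j) z))) = ln (\<Prod>j<k. det_ratio ((T ^^ j) z))"
    using ratio0 by (subst ln_prod) auto
  also have "\<dots> \<le> ln ((fact CARD('n))\<^sup>2 * (\<Prod>i\<in>UNIV. norm (v i k)) * (\<Prod>i\<in>UNIV. norm (?d i)))"
    using P ratio by (intro ln_mono) (auto intro!: prod_pos simp: v0 d0)
  also have "\<dots> = 2 * ln (fact CARD('n)) + (\<Sum>i\<in>UNIV. ln (norm (v i k))) + (\<Sum>i\<in>UNIV. ln (norm (?d i)))"
    using v0 d0 by (simp add: ln_mult ln_prod ln_realpow prod_pos zero_less_mult_iff)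
  also have "(\<Sum>i\<in>UNIV. ln (norm (v i k))) \<le> (\<Sum>i\<in>(UNIV::'n set). a)" by (intro sum_mono growth)
  also have "(\<Sum>i\<in>UNIV. ln (norm (?d i))) \<le> (\<Sum>i\<in>(UNIV::'n set). ln (1 + ?e) + a)"
  proof (intro sum_mono)
    fix i
    have "ln (norm (?d i)) \<le> ln ((1 + ?e) * norm (w i k))"
      using d[of i] d0[of i] w0[of i] entry_sum_nonneg[of "Sm ((T ^^ k) z)"]
          by (intro ln_mono) (auto intro: mult_pos_pos)
    also have "\<dots> = ln (1 + ?e) + ln (norm (w i k))"
      using w0[of i] entry_sum_nonneg[of "Sm ((T ^^ k) z)"] by (subst ln_mult) auto
    finally show "ln (norm (?d i)) \<le> ln (1 + ?e) + a" using growth(2)[of i] by linarith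
  qed
  finally show ?thesis by (simp add: algebra_simps)
qed

end

section \<open>Functions with vanishing averages\<close>

lemma funpow_measurable: "T \<in> measurable M M \<Longrightarrow> T ^^ k \<in> measurable M M"
  by (induction k) (auto intro: measurable_comp)

lemma distr_funpow:
  assumes "T \<in> measurable M M" "distr M M T = M" shows "distr M M (T ^^ k) = M"
proof (induction k)
  case 0
  show ?case by (simp add: distr_id[unfolded id_def] id_def)
next
  case (Suc k)
  have "distr M M (T ^^ Suc k) = distr (distr M M (T ^^ k)) M T"
    by (subst distr_distr) (auto simp: assms funpow_measurable)
  then show ?case unfolding Suc assms(2) .
qed

lemma integral_funpow:
  fixes h :: "'a \<Rightarrow> real"
  assumes "T \<in> measurable M M" "distr M M T = M" "h \<in> borel_measurable M"
  shows "(\<integral>x. h ((T ^^ k) x) \<partial>M) = (\<integral>x. h x \<partial>M)"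
  using integral_distr[OF funpow_measurable[OF assms(1), of k] assms(3)] distr_funpow[OF assms(1,2)] by simp

text \<open>If the averages of a nonnegative function have no positive limit, its integral, which equals
  that of its averages, is \<open>0\<close>. Truncation at \<open>1\<close> replaces integrability. The error \<open>\<phi>\<close> at the
  moving end point need not be \<open>o(k)\<close> pointwise: the distribution of \<open>\<phi> \<circ> T ^^ k\<close> is that of \<open>\<phi>\<close>,
  so \<open>(\<phi> \<circ> T ^^ k) / k\<close> tends to \<open>0\<close> in probability, and this suffices.\<close>

lemma (in prob_space) AE_zero_if_averages_le:
  fixes g \<phi> :: "'a \<Rightarrow> real"
  assumes T: "T \<in> measurable M M" "distr M M T = M"
    and g: "g \<in> borel_measurable M" "\<And>x. 0 \<le> g x" and \<phi>: "\<phi> \<in> borel_measurable M"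
    and small: "AE x in M. \<forall>\<epsilon>>0. \<forall>\<^sub>F k in sequentially. (\<Sum>i<k. g ((T ^^ i) x)) \<le> \<epsilon> * real k + \<phi> ((T ^^ k) x)"
  shows "AE x in M. g x = 0"
proof -
  note [measurable] = funpow_measurable[OF T(1)] g(1) \<phi>
  define g1 where "g1 x = min 1 (g x)" for x
  define avg where "avg k x = (\<Sum>i<k. g1 ((T ^^ i) x)) / real k" for k x
  define \<psi> where "\<psi> k x = min 1 (\<bar>\<phi> x\<bar> / real k)" for k :: nat and x
  \<comment> \<open>the part of the average that tends to \<open>0\<close> pointwise\<close>
  define c where "c k x = max 0 (avg k x - \<psi> k ((T ^^ k) x))" for k x
  have [measurable]: "g1 \<in> borel_measurable M" "\<psi> k \<in> borel_measurable M" 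
     "avg k \<in> borel_measurable M" "c k \<in> borel_measurable M" for k
    unfolding c_def[abs_def] avg_def[abs_def] \<psi>_def[abs_def] g1_def[abs_def] by measurable
  have g1: "0 \<le> g1 x" "g1 x \<le> 1" "g1 x \<le> g x" for x using g by (auto simp: g1_def)
  have avg: "0 \<le> avg k x" "avg k x \<le> 1" for k x
  proof -
    show "0 \<le> avg k x" unfolding avg_def by (intro divide_nonneg_nonneg sum_nonneg g1) auto
    have "(\<Sum>i<k. g1 ((T ^^ i) x)) \<le> (\<Sum>i<k. 1)" by (intro sum_mono g1)
    then show "avg k x \<le> 1" unfolding avg_def by (cases "k = 0") (auto simp: divide_le_eq)
  qed
  have \<psi>: "0 \<le> \<psi> k x" "\<psi> k x \<le> 1" for k x by (auto simp: \<psi>_def)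
  have c: "0 \<le> c k x" "c k x \<le> 1" for k x using avg[of k x] \<psi>[of k "(T ^^ k) x"] by (auto simp: c_def)
  have int: "integrable M h" if "h \<in> borel_measurable M" "\<And>x. 0 \<le> h x" "\<And>x. h x \<le> (1::real)" for h
    by (rule integrable_const_bound[where B = 1]) (use that in auto)
  have "(\<lambda>k. \<integral>x. c k x \<partial>M) \<longlonglongrightarrow> (\<integral>x. 0 \<partial>M)"
  proof (rule integral_dominated_convergence[where w = "\<lambda>_. 1"])
    show "AE x in M. (\<lambda>k. c k x) \<longlonglongrightarrow> 0"
      using small
    proof eventually_elim
      case (elim x)
      show ?case
      proof (rule order_tendstoI)
        fix a :: real assume "a < 0"
        then show "\<forall>\<^sub>F k in sequentially. a < c k x" using c(1)
            by (intro always_eventually) (meson less_le_trans)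
      next
        fix a :: real assume a: "0 < a"
        have "\<forall>\<^sub>F k in sequentially. (\<Sum>i<k. g ((T ^^ i) x)) \<le> (a/2) * real k + \<phi> ((T ^^ k) x)"
          using elim a half_gt_zero by blast
        then show "\<forall>\<^sub>F k in sequentially. c k x < a"
          using eventually_gt_at_top[of 0]
        proof eventually_elim
          case (elim k)
          have "(\<Sum>i<k. g1 ((T ^^ i) x)) \<le> (\<Sum>i<k. g ((T ^^ i) x))" by (intro sum_mono g1)
          also note elim(1)
          finally have "(\<Sum>i<k. g1 ((T ^^ i) x)) \<le> (a/2) * real k + \<bar>\<phi> ((T ^^ k) x)\<bar>" by linarith
          then have "avg k x \<le> a/2 + \<bar>\<phi> ((T ^^ k) x)\<bar> / real k"
            using elim(2) by (simp add: avg_def field_simps)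
          then show "c k x < a" using a avg(2)[of k x] by (auto simp: c_def \<psi>_def)
        qed
      qed
    qed
  qed (use c in auto)
  moreover have "(\<lambda>k. \<integral>x. \<psi> k x \<partial>M) \<longlonglongrightarrow> (\<integral>x. 0 \<partial>M)"
  proof (rule integral_dominated_convergence[where w = "\<lambda>_. 1"])
    have "(\<lambda>k. \<psi> k x) \<longlonglongrightarrow> min 1 0" for x
      unfolding \<psi>_def by (intro tendsto_min tendsto_const real_tendsto_divide_at_top[OF tendsto_const
          filterlim_real_sequentially])
    then show "AE x in M. (\<lambda>k. \<psi> k x) \<longlonglongrightarrow> 0" by simp
  qed (use \<psi> in auto)
  ultimately have lim: "(\<lambda>k. (\<integral>x. c k x \<partial>M) + (\<integral>x. \<psi> k x \<partial>M)) \<longlonglongrightarrow> 0"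
    using tendsto_add by fastforce
  have "(\<integral>x. g1 x \<partial>M) \<le> (\<integral>x. c k x \<partial>M) + (\<integral>x. \<psi> k x \<partial>M)" if "0 < k" for k
  proof -
    have "(\<integral>x. avg k x \<partial>M) = (\<Sum>i<k. \<integral>x. g1 ((T ^^ i) x) \<partial>M) / real k"
      unfolding avg_def by (simp add: int g1)
    also have "\<dots> = (\<integral>x. g1 x \<partial>M)" using that by (simp add: integral_funpow[OF T])
    finally have "(\<integral>x. g1 x \<partial>M) = (\<integral>x. avg k x \<partial>M)" ..
    also have "\<dots> \<le> (\<integral>x. c k x + \<psi> k ((T ^^ k) x) \<partial>M)"
      by (intro integral_mono Bochner_Integration.integrable_add int) (use avg c \<psi> in \<open>auto simp: c_def\<close>)
    also have "\<dots> = (\<integral>x. c k x \<partial>M) + (\<integral>x. \<psi> k ((T ^^ k) x) \<partial>M)"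
      by (intro Bochner_Integration.integral_add int) (use c \<psi> in auto)
    also have "(\<integral>x. \<psi> k ((T ^^ k) x) \<partial>M) = (\<integral>x. \<psi> k x \<partial>M)" by (rule integral_funpow[OF T]) simp
    finally show ?thesis .
  qed
  then have "(\<integral>x. g1 x \<partial>M) \<le> 0"
    by (intro LIMSEQ_le_const[OF lim]) (auto intro!: exI[of _ 1])
  moreover have "0 \<le> (\<integral>x. g1 x \<partial>M)" using g1 by simp
  ultimately have "AE x in M. g1 x = 0"
    using integral_nonneg_eq_0_iff_AE[OF int[of g1]] g1 by (simp add: antisym)
  then show ?thesis by (rule AE_mp) (auto simp: g1_def min_def split: if_splits)
qed

section \<open>The annulus, lifts, and supports of invariant measures\<close>

lemma abs_torus_eq_iff: "abs_torus x = abs_torus y \<longleftrightarrow> x - y \<in> int_vecs"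
  using torus.abs_eq_iff[of x y] by (simp add: torus_rel_def)

lemma abs_rep_torus: "abs_torus (rep_torus x) = x"
  using Quotient_abs_rep[OF Quotient_torus] .

text \<open>The saturation of an open set is the union of its integer translates.\<close>

lemma open_abs_torus_image:
  assumes "open U" shows "open (abs_torus ` U)"
proof -
  have "abs_torus -` abs_torus ` U = (\<Union>\<nu>\<in>int_vecs. (+) \<nu> ` U)"
  proof (intro set_eqI iffI)
    fix x assume "x \<in> abs_torus -` abs_torus ` U"
    then obtain y where "y \<in> U" "x - y \<in> int_vecs" by (auto simp: abs_torus_eq_iff)
    then show "x \<in> (\<Union>\<nu>\<in>int_vecs. (+) \<nu> ` U)" by (auto intro!: bexI[of _ "x - y"] image_eqI[of _ _ y])
  next
    fix x assume "x \<in> (\<Union>\<nu>\<in>int_vecs. (+) \<nu> ` U)"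
    then show "x \<in> abs_torus -` abs_torus ` U"
      by (auto simp: image_iff abs_torus_eq_iff intro!: bexI)
  qed
  then show ?thesis using assms by (auto simp: open_torus_def intro: open_translation)
qed

lemma continuous_on_abs_torus: "continuous_on UNIV abs_torus"
  by (subst continuous_on_open_vimage) (auto simp: open_torus_def)

lemma topological_basis_image:
  fixes f :: "'a::topological_space \<Rightarrow> 'b::topological_space"
  assumes B: "topological_basis B" and "continuous_on UNIV f" "surj f" "\<And>U. open U \<Longrightarrow> open (f ` U)"
  shows "topological_basis ((`) f ` B)"
proof (rule topological_basisI)
  fix U assume "U \<in> (`) f ` B" then show "open U" using assms topological_basis_open by auto
next
  fix U :: "'b set" and y assume U: "open U" "y \<in> U"
  obtain x where x: "y = f x" using assms(3) by auto
  have "open (f -` U)" using assms(2) U(1) by (simp add: continuous_on_open_vimage)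
  moreover have "x \<in> f -` U" using U(2) x by simp
  ultimately obtain b where "b \<in> B" "x \<in> b" "b \<subseteq> f -` U" by (rule topological_basisE[OF B])
  then show "\<exists>B'\<in>(`) f ` B. y \<in> B' \<and> B' \<subseteq> U"
    unfolding x by (intro bexI[of _ "f ` b"]) auto
qed

text \<open>Second countability makes supports of full measure.\<close>

instance torus :: (finite) second_countable_topology
proof
  obtain B :: "(real^'a) set set" where B: "countable B" "topological_basis B"
    using ex_countable_basis by blast
  have "topological_basis ((`) abs_torus ` B)"
    by (rule topological_basis_image[OF B(2) continuous_on_abs_torus _ open_abs_torus_image]) (metis
        abs_rep_torus surjI)
  then show "\<exists>B :: 'a torus set set. countable B \<and> open = generate_topology B"
    using B(1) topological_basis_imp_subbasis by blast
qed

lemma annulus_proj_apply: "annulus_proj z = (abs_torus (fst z), snd z)"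
  by (simp add: annulus_proj_def map_prod_def split_beta)

lemma annulus_proj_eq_iff: "annulus_proj z = annulus_proj z' \<longleftrightarrow> (\<exists>\<nu>\<in>int_vecs. z = z' + (\<nu>, 0))"
proof
  assume "annulus_proj z = annulus_proj z'"
  then have "fst z - fst z' \<in> int_vecs" "snd z = snd z'"
    by (simp_all add: annulus_proj_apply abs_torus_eq_iff)
  then show "\<exists>\<nu>\<in>int_vecs. z = z' + (\<nu>, 0)" by (intro bexI[of _ "fst z - fst z'"]) (simp_all add: prod_eq_iff)
next
  assume "\<exists>\<nu>\<in>int_vecs. z = z' + (\<nu>, 0)"
  then show "annulus_proj z = annulus_proj z'" by (auto simp: annulus_proj_apply abs_torus_eq_iff)
qed

lemma annulus_proj_translate [simp]: "\<nu> \<in> int_vecs \<Longrightarrow> annulus_proj (z + (\<nu>, 0)) = annulus_proj z"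
  unfolding annulus_proj_eq_iff by blast

lemma continuous_on_annulus_proj: "continuous_on UNIV (annulus_proj :: 'n::finite phase \<Rightarrow> _)"
proof -
  have "continuous_on UNIV (\<lambda>z::'n phase. (abs_torus (fst z), snd z))"
    by (intro continuous_on_Pair continuous_on_snd continuous_on_id continuous_on_compose2[OF
        continuous_on_abs_torus] continuous_on_fst) auto
  then show ?thesis by (simp add: annulus_proj_apply[abs_def])
qed

lemma open_annulus_proj_image:
  fixes U :: "'n::finite phase set"
  assumes "open U" shows "open (annulus_proj ` U)"
proof (subst open_subopen, intro ballI)
  fix a assume "a \<in> annulus_proj ` U"
  then obtain z where z: "z \<in> U" "a = annulus_proj z" by auto
  obtain V W where VW: "open V" "open W" "fst z \<in> V" "snd z \<in> W" "V \<times> W \<subseteq> U"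
    using open_prod_elim[OF assms z(1)] by (metis mem_Times_iff)
  show "\<exists>T. open T \<and> a \<in> T \<and> T \<subseteq> annulus_proj ` U"
  proof (intro exI conjI)
    show "open ((abs_torus ` V) \<times> W)" by (intro open_Times open_abs_torus_image VW)
    show "a \<in> (abs_torus ` V) \<times> W" using VW z by (auto simp: annulus_proj_apply)
    show "(abs_torus ` V) \<times> W \<subseteq> annulus_proj ` U"
    proof
      fix b assume "b \<in> (abs_torus ` V) \<times> W"
      then obtain x where "x \<in> V" "fst b = abs_torus x" "snd b \<in> W" by auto
      then show "b \<in> annulus_proj ` U" using VW(5)
        by (auto simp: annulus_proj_apply prod_eq_iff intro!: image_eqI[of _ _ "(x, snd b)"])
    qed
  qed
qed

text \<open>Not continuous; it only serves to turn periodic functions on the universal cover into functions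
  on the annulus.\<close>

definition annulus_section :: "'n::finite annulus \<Rightarrow> 'n phase" where "annulus_section a
    = (rep_torus (fst a), snd a)"

lemma annulus_proj_section [simp]: "annulus_proj (annulus_section a) = a"
  by (simp add: annulus_proj_apply annulus_section_def abs_rep_torus)

text \<open>The projection is open and \<open>h\<close> is constant on its fibres.\<close>

lemma continuous_on_descend:
  assumes h: "continuous_on (annulus_proj -` K) h" and inv: "\<And>z z'. annulus_proj z
      = annulus_proj z' \<Longrightarrow> h z = h z'"
  shows "continuous_on K (\<lambda>a. h (annulus_section a))"
  unfolding continuous_on_open_invariant
proof (intro allI impI)
  fix B :: "'b set" assume "open B"
  then obtain V where V: "open V" "V \<inter> annulus_proj -` K = h -` B \<inter> annulus_proj -` K"
    using h unfolding continuous_on_open_invariant by blast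
  have hs: "h (annulus_section (annulus_proj z)) = h z" for z
    by (rule inv) simp
  have "annulus_proj ` V \<inter> K = (\<lambda>a. h (annulus_section a)) -` B \<inter> K"
  proof (intro set_eqI iffI)
    fix a assume "a \<in> annulus_proj ` V \<inter> K"
    then obtain z where "z \<in> V" "a = annulus_proj z" "z \<in> annulus_proj -` K" by auto
    then show "a \<in> (\<lambda>a. h (annulus_section a)) -` B \<inter> K" using V(2) hs by auto
  next
    fix a assume a: "a \<in> (\<lambda>a. h (annulus_section a)) -` B \<inter> K"
    then have "annulus_section a \<in> V" using V(2) by auto
    then have "annulus_proj (annulus_section a) \<in> annulus_proj ` V" by (rule imageI)
    then show "a \<in> annulus_proj ` V \<inter> K" using a by simp
  qed
  then show "\<exists>A. open A \<and> A \<inter> K = (\<lambda>a. h (annulus_section a)) -` B \<inter> K"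
    using open_annulus_proj_image[OF V(1)] by blast
qed

lemma int_valued_constant:
  fixes h :: "'a::real_normed_vector \<Rightarrow> real^'n"
  assumes "continuous_on UNIV h" "\<And>z. h z \<in> int_vecs" shows "h z = h z'"
proof -
  have "h z $ i = h z' $ i" for i
  proof -
    have "(\<lambda>z. h z $ i) constant_on UNIV"
    proof (rule continuous_discrete_range_constant[OF connected_UNIV])
      show "continuous_on UNIV (\<lambda>z. h z $ i)" by (intro continuous_intros assms)
      fix x
      have "1 \<le> norm (h y $ i - h x $ i)" if "h y $ i \<noteq> h x $ i" for y
        using Ints_nonzero_abs_ge1[of "h y $ i - h x $ i"] assms(2) that by (auto simp: int_vecs_def)
      then show "\<exists>e>0. \<forall>y. y \<in> UNIV \<and> h y $ i \<noteq> h x $ i \<longrightarrow> e \<le> norm (h y $ i - h x $ i)"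
        by (auto intro!: exI[of _ 1])
    qed
    then show ?thesis unfolding constant_on_def by auto
  qed
  then show ?thesis by (simp add: vec_eq_iff)
qed

text \<open>The difference of the two maps is continuous with values in the discrete group \<open>int_vecs\<close>.\<close>

lemma same_projection_translate:
  assumes "continuous_on UNIV F" "continuous_on UNIV F'" "\<And>z. annulus_proj (F z) = annulus_proj (F' z)"
  shows "\<exists>\<nu>\<in>int_vecs. \<forall>z. F (z :: 'n::finite phase) = F' z + (\<nu>, 0)"
proof -
  let ?h = "\<lambda>z. fst (F z) - fst (F' z)"
  have "continuous_on UNIV ?h" by (intro continuous_intros assms)
  moreover have h: "?h z \<in> int_vecs \<and> F z = F' z + (?h z, 0)" for z
    using assms(3)[of z] unfolding annulus_proj_eq_iff by auto
  ultimately have "?h z = ?h 0" for z by (intro int_valued_constant) auto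
  then show ?thesis using h by metis
qed

lemma lift_of_cont: "lift_of F f \<Longrightarrow> continuous_on UNIV F"
  and lift_of_proj: "lift_of F f \<Longrightarrow> annulus_proj (F z) = f (annulus_proj z)"
proof -
  show "lift_of F f \<Longrightarrow> continuous_on UNIV F" by (simp add: lift_of_def)
  assume "lift_of F f"
  then have "annulus_proj \<circ> F = f \<circ> annulus_proj" by (simp add: lift_of_def)
  from fun_cong[OF this, of z] show "annulus_proj (F z) = f (annulus_proj z)" by simp
qed

lemma continuous_on_translate: "continuous_on UNIV F \<Longrightarrow> continuous_on UNIV (\<lambda>z. F (z + c))"
  for F :: "'a::real_normed_vector \<Rightarrow> 'b::topological_space"
  by (rule continuous_on_compose2[of UNIV F]) (auto intro: continuous_intros)

lemma lift_of_unique: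
  assumes "lift_of F f" "lift_of F' f" shows "\<exists>\<nu>\<in>int_vecs. \<forall>z. F z = F' z + (\<nu>, 0)"
  by (rule same_projection_translate[OF lift_of_cont[OF assms(1)] lift_of_cont[OF assms(2)]])
     (simp only: lift_of_proj[OF assms(1)] lift_of_proj[OF assms(2)])

lemma lift_of_translate:
  assumes "lift_of F f" "\<nu> \<in> int_vecs" shows "\<exists>\<nu>'\<in>int_vecs. \<forall>z. F (z + (\<nu>, 0)) = F z + (\<nu>', 0)"
  by (rule same_projection_translate[OF continuous_on_translate[OF lift_of_cont[OF assms(1)]]
      lift_of_cont[OF assms(1)]])
     (simp only: lift_of_proj[OF assms(1)] annulus_proj_translate[OF assms(2)])

lemma lift_of_compose: "lift_of F f \<Longrightarrow> lift_of G g \<Longrightarrow> lift_of (F \<circ> G) (f \<circ> g)"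
proof -
  assume F: "lift_of F f" and G: "lift_of G g"
  have "continuous_on UNIV (F \<circ> G)"
    by (rule continuous_on_compose[OF lift_of_cont[OF G]]) (rule continuous_on_subset[OF lift_of_cont[OF
        F] subset_UNIV])
  moreover have "annulus_proj \<circ> (F \<circ> G) = f \<circ> g \<circ> annulus_proj"
    using lift_of_proj[OF F] lift_of_proj[OF G] by (intro ext) simp
  ultimately show ?thesis by (simp add: lift_of_def)
qed

lemma lift_of_id: "lift_of id id" by (auto simp: lift_of_def)

lemma lift_of_funpow: "lift_of F f \<Longrightarrow> lift_of (F ^^ k) (f ^^ k)"
  by (induction k) (auto simp: lift_of_id lift_of_compose)

text \<open>A lift of the inverse composed with \<open>F\<close> lifts the identity, hence is a deck transformation,
  which can be divided out.\<close>

lemma lift_of_inverse: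
  assumes "bij f" "lift_of F f" "lift_of F' (inv f)"
  shows "\<exists>G. lift_of G (inv f) \<and> (\<forall>z. F (G z) = z) \<and> (\<forall>z. G (F z) = z)"
proof -
  have "f \<circ> inv f = id" "inv f \<circ> f = id" 
    using surj_iff[THEN iffD1, OF bij_is_surj[OF assms(1)]] inv_o_cancel[OF bij_is_inj[OF assms(1)]] .
  then obtain \<nu> \<nu>' where n: "\<nu> \<in> int_vecs" "\<And>z. F (F' z) = z + (\<nu>, 0)" "\<nu>' \<in> int_vecs" "\<And>z. F' (F z) = z
      + (\<nu>', 0)"
    using lift_of_unique[OF _ lift_of_id, of "F \<circ> F'"] lift_of_unique[OF _ lift_of_id, of "F' \<circ> F"]
      lift_of_compose[OF assms(2,3)] lift_of_compose[OF assms(3,2)] by (metis comp_apply id_apply)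
  define G where "G z = F' (z - (\<nu>, 0))" for z
  have FG: "F (G z) = z" for z using n by (simp add: G_def)
  have inj: "inj F" by (rule injI) (metis n(4) add_right_cancel)
  have "G (F z) = z" for z using FG inj by (metis injD)
  moreover have "lift_of G (inv f)"
    unfolding lift_of_def G_def
  proof
    show "continuous_on UNIV (\<lambda>z. F' (z - (\<nu>, 0)))"
      using continuous_on_translate[OF lift_of_cont[OF assms(3)], of "- (\<nu>, 0)"]
      by (simp del: uminus_Pair)
    have "annulus_proj (z - (\<nu>, 0)) = annulus_proj z" for z
      by (metis annulus_proj_translate diff_add_cancel n(1))
    then show "annulus_proj \<circ> (\<lambda>z. F' (z - (\<nu>, 0))) = inv f \<circ> annulus_proj"
      using lift_of_proj[OF assms(3)] by (auto simp: fun_eq_iff)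
  qed
  ultimately show ?thesis using FG by blast
qed

text \<open>Two lifts at two points of a fibre differ by translations in source and target, which do not
  affect the derivative.\<close>

lemma tangent_map_eq:
  assumes "lift_of F f" "annulus_proj z = x" "(F has_derivative A) (at z)"
  shows "tangent_map f x = A"
  unfolding tangent_map_def
proof (rule the_equality)
  show "\<exists>F z. lift_of F f \<and> annulus_proj z = x \<and> (F has_derivative A) (at z)" using assms by blast
  fix A' assume "\<exists>F z. lift_of F f \<and> annulus_proj z = x \<and> (F has_derivative A') (at z)"
  then obtain F' z' where F': "lift_of F' f" "annulus_proj z' = x" "(F' has_derivative A') (at z')" by blast
  obtain \<nu> where \<nu>: "\<nu> \<in> int_vecs" "z' = z + (\<nu>, 0)" using F'(2) assms(2) annulus_proj_eq_iff by metis
  obtain c where c: "\<And>z. F z = F' z + c" using lift_of_unique[OF assms(1) F'(1)] by blast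
  obtain d where d: "\<And>z. F (z + (\<nu>, 0)) = F z + d" using lift_of_translate[OF assms(1) \<nu>(1)] by blast
  have e: "F w = F' (w + (\<nu>, 0)) + (c - d)" for w using c[of "w + (\<nu>, 0)"] d[of w] by (simp add: algebra_simps)
  have "((\<lambda>w. F' (w + (\<nu>, 0)) + (c - d)) has_derivative A') (at z)"
    using F'(3) unfolding \<nu>(2)
    by (intro has_derivative_add_const has_derivative_compose[of "\<lambda>w. w + (\<nu>, 0)" "\<lambda>h. h"] has_derivative_ident)
  then have "(F has_derivative A') (at z)" unfolding e[abs_def, symmetric] by (simp add: e[symmetric, abs_def])
  then show "A' = A" using assms(3) has_derivative_unique by blast
qed

lemma closed_measure_support: "closed (measure_support M)"
proof -
  have "- measure_support M = \<Union>{U. open U \<and> emeasure M U = 0}"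
    by (auto simp: measure_support_def zero_less_iff_neq_zero)
  then show ?thesis unfolding closed_def by (simp only:) (rule open_Union, simp)
qed

text \<open>The complement of the support is covered by the null sets among countably many basic open sets.\<close>

lemma AE_in_measure_support:
  fixes M :: "'a::second_countable_topology measure"
  assumes "sets M = sets borel" shows "AE x in M. x \<in> measure_support M"
proof -
  obtain B :: "'a set set" where B: "countable B" "topological_basis B" using ex_countable_basis by blast
  have "(\<Union>U\<in>{U \<in> B. emeasure M U = 0}. U) \<in> null_sets M"
  proof (intro null_sets_UN')
    show "countable {U \<in> B. emeasure M U = 0}" using B(1) by simp
    fix U assume "U \<in> {U \<in> B. emeasure M U = 0}"
    then show "U \<in> null_sets M" using B(2) by (auto simp: assms null_sets_def intro!: borel_open
        topological_basis_open)
  qed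
  moreover
    have "{x \<in> space M. x \<notin> measure_support M} \<subseteq> (\<Union>U\<in>{U \<in> B. emeasure M U = 0}. U)"
    proof
      fix x assume "x \<in> {x \<in> space M. x \<notin> measure_support M}"
      then obtain U where U: "open U" "x \<in> U" "emeasure M U = 0"
        by (auto simp: measure_support_def zero_less_iff_neq_zero)
      then obtain b where b: "b \<in> B" "x \<in> b" "b \<subseteq> U" using topological_basisE[OF B(2)] by metis
      have "emeasure M b \<le> emeasure M U" using b U by (intro emeasure_mono) (auto simp: assms)
      then show "x \<in> (\<Union>U\<in>{U \<in> B. emeasure M U = 0}. U)" using b U by auto
    qed
  ultimately show ?thesis by (rule AE_I')
qed

lemma measure_support_invariant:
  assumes inv: "invariant_prob f M" and f: "bij f" "continuous_on UNIV f" "continuous_on UNIV (inv f)"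
  shows "f x \<in> measure_support M \<longleftrightarrow> x \<in> measure_support M"
proof -
  have sets: "sets M = sets borel" and fM: "f \<in> measurable M M" "distr M M f = M" 
    using inv by (auto simp: invariant_prob_def)
  have e: "emeasure M (f -` U) = emeasure M U" if "open U" for U
  proof -
    have "space M = UNIV" using sets_eq_imp_space_eq[OF sets] by simp
    then show ?thesis using emeasure_distr[OF fM(1), of U] that fM(2) by (simp add: sets)
  qed
  show ?thesis
  proof
    assume s: "x \<in> measure_support M"
    show "f x \<in> measure_support M"
      unfolding measure_support_def
    proof (intro CollectI allI impI)
      fix U assume U: "open U \<and> f x \<in> U"
      have "open (f -` U)" using f(2) U by (simp add: continuous_on_open_vimage)
      then show "0 < emeasure M U" using s U e[of U] by (auto simp: measure_support_def)
    qed
  next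
    assume s: "f x \<in> measure_support M"
    show "x \<in> measure_support M"
      unfolding measure_support_def
    proof (intro CollectI allI impI)
      fix U assume U: "open U \<and> x \<in> U"
      have 1: "open (inv f -` U)" using f(3) U by (simp add: continuous_on_open_vimage)
      have "f -` inv f -` U = U" using f(1) by (auto simp: bij_is_inj)
      then show "0 < emeasure M U" using s U 1 e[OF 1] f(1) by (auto simp: measure_support_def bij_is_inj)
    qed
  qed
qed

lemma lift_of_imp_continuous:
  assumes "lift_of F f" shows "continuous_on UNIV f"
  unfolding continuous_on_open_vimage[OF open_UNIV]
proof (intro allI impI)
  fix U :: "'a annulus set" assume "open U"
  then have "open ((annulus_proj \<circ> F) -` U)"
    using continuous_on_compose[OF lift_of_cont[OF assms] continuous_on_subset[OF
        continuous_on_annulus_proj subset_UNIV]]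
    unfolding continuous_on_open_vimage[OF open_UNIV] by simp
  then have "open (annulus_proj ` ((annulus_proj \<circ> F) -` U))" by (rule open_annulus_proj_image)
  also have "annulus_proj ` ((annulus_proj \<circ> F) -` U) = f -` U"
  proof (intro set_eqI iffI)
    fix x assume "x \<in> f -` U"
    then have "annulus_section x \<in> (annulus_proj \<circ> F) -` U" using lift_of_proj[OF assms, of
        "annulus_section x"] by simp
    then have "annulus_proj (annulus_section x) \<in> annulus_proj ` ((annulus_proj \<circ> F) -` U)" by (rule imageI)
    then show "x \<in> annulus_proj ` ((annulus_proj \<circ> F) -` U)" by simp
  qed (use lift_of_proj[OF assms] in auto)
  finally show "open (f -` U \<inter> UNIV)" by simp
qed

section \<open>Second order expansion of the action\<close>

lemma has_derivative_along_line:
  fixes f :: "'a::real_normed_vector \<Rightarrow> real"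
  assumes "(f has_derivative f') (at (a + t *\<^sub>R w))"
  shows "((\<lambda>t. f (a + t *\<^sub>R w)) has_real_derivative f' w) (at t)"
proof -
  have "((\<lambda>t. f (a + t *\<^sub>R w)) has_derivative (\<lambda>s. f' (s *\<^sub>R w))) (at t)"
    by (rule has_derivative_compose[of "\<lambda>t. a + t *\<^sub>R w" "\<lambda>s. s *\<^sub>R w" t UNIV f, OF _ assms])
       (auto intro!: derivative_eq_intros)
  moreover have "f' (s *\<^sub>R w) = f' w * s" for s
    using linear_scale[OF has_derivative_linear[OF assms], of s w] by simp
  ultimately show ?thesis by (simp add: has_field_derivative_def)
qed

lemma gradient_has_derivative:
  fixes S' :: "'a::real_normed_vector \<Rightarrow> 'a \<Rightarrow>\<^sub>L 'b::real_normed_vector"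
  assumes "(S' has_derivative blinfun_apply D) (at w)"
  shows "((\<lambda>x. S' x h) has_derivative (\<lambda>v. D v h)) (at w)"
  using assms by (auto intro!: derivative_eq_intros simp: blinfun.zero_right)

context
  fixes S :: "'a::real_normed_vector \<Rightarrow> real" and S' :: "'a \<Rightarrow> 'a \<Rightarrow>\<^sub>L real" and S'' :: "'a \<Rightarrow> 'a \<Rightarrow>\<^sub>L 'a \<Rightarrow>\<^sub>L real"
  assumes S': "\<And>w. (S has_derivative blinfun_apply (S' w)) (at w)"
    and S'': "\<And>w. (S' has_derivative blinfun_apply (S'' w)) (at w)"
    and cont: "continuous_on UNIV S''"
begin

lemma second_order_mean_value:
  "\<exists>\<theta>. 0 < \<theta> \<and> \<theta> < 1 \<and> S (a + w) - S a - S' a w = S'' (a + \<theta> *\<^sub>R w) w w / 2"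
proof -
  define diff where "diff m = (if m = (0::nat) then (\<lambda>t. S (a + t *\<^sub>R w)) else if m = 1 then (\<lambda>t. S' (a
      + t *\<^sub>R w) w)
     else (\<lambda>t. S'' (a + t *\<^sub>R w) w w))" for m
  have "\<exists>t. 0 < t \<and> t < 1 \<and> diff 0 1 = (\<Sum>m<2. diff m 0 / fact m * 1 ^ m) + diff 2 t / fact 2 * 1 ^ 2"
  proof (rule Maclaurin)
    show "\<forall>m t. m < 2 \<and> 0 \<le> t \<and> t \<le> 1 \<longrightarrow> DERIV (diff m) t :> diff (Suc m) t"
      using has_derivative_along_line[OF S'] has_derivative_along_line[OF gradient_has_derivative[OF S'']]
      by (auto simp: less_2_cases_iff diff_def)
  qed auto
  then obtain t where "0 < t" "t < 1" "S (a + w) - S a - S' a w = S'' (a + t *\<^sub>R w) w w / 2"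
    by (auto simp: diff_def numeral_2_eq_2)
  then show ?thesis by blast
qed

text \<open>The base points \<open>a j\<close> may move, since the mean value form of the remainder involves \<open>S''\<close> only
  at points that converge to \<open>a0\<close>.\<close>

lemma second_order_taylor_tendsto:
  assumes a: "a \<longlonglongrightarrow> a0" and v: "v \<longlonglongrightarrow> v0" and \<tau>: "\<tau> \<longlonglongrightarrow> 0" "\<And>j. \<tau> j \<noteq> (0::real)"
  shows "(\<lambda>j. (S (a j + \<tau> j *\<^sub>R v j) - S (a j) - \<tau> j * S' (a j) (v j)) / (\<tau> j)\<^sup>2) \<longlonglongrightarrow> S'' a0 v0 v0 / 2"
proof -
  have "\<exists>\<theta>. \<forall>j. 0 < \<theta> j \<and> \<theta> j < 1 \<and> S (a j + \<tau> j *\<^sub>R v j) - S (a j) - S' (a j) (\<tau> j *\<^sub>R v j) = 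
      S'' (a j + \<theta> j *\<^sub>R (\<tau> j *\<^sub>R v j)) (\<tau> j *\<^sub>R v j) (\<tau> j *\<^sub>R v j) / 2"
    by (intro choice allI second_order_mean_value)
  then obtain \<theta> where \<theta>: "\<And>j. 0 < \<theta> j" "\<And>j. \<theta> j < 1"
     "\<And>j. S (a j + \<tau> j *\<^sub>R v j) - S (a j) - S' (a j) (\<tau> j *\<^sub>R v j) = 
      S'' (a j + \<theta> j *\<^sub>R (\<tau> j *\<^sub>R v j)) (\<tau> j *\<^sub>R v j) (\<tau> j *\<^sub>R v j) / 2" by auto
  have eq: "(S (a j + \<tau> j *\<^sub>R v j) - S (a j) - \<tau> j * S' (a j) (v j)) / (\<tau> j)\<^sup>2 = 
      S'' (a j + \<theta> j *\<^sub>R (\<tau> j *\<^sub>R v j)) (v j) (v j) / 2" for j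
    using \<theta>(3)[of j] \<tau>(2)[of j] by (simp add: blinfun.scaleR_right blinfun.scaleR_left power2_eq_square)
  have "(\<lambda>j. \<theta> j * \<tau> j) \<longlonglongrightarrow> 0"
  proof (rule Lim_null_comparison)
    show "\<forall>\<^sub>F j in sequentially. norm (\<theta> j * \<tau> j) \<le> \<bar>\<tau> j\<bar>"
      using \<theta>(1,2) by (intro always_eventually allI) (simp add: abs_mult mult_left_le_one_le less_imp_le)
    show "(\<lambda>j. \<bar>\<tau> j\<bar>) \<longlonglongrightarrow> 0" using tendsto_rabs_zero[OF \<tau>(1)] .
  qed
  then have "(\<lambda>j. a j + (\<theta> j * \<tau> j) *\<^sub>R v j) \<longlonglongrightarrow> a0 + 0 *\<^sub>R v0" by (intro tendsto_intros a v)
  then have "(\<lambda>j. S'' (a j + (\<theta> j * \<tau> j) *\<^sub>R v j)) \<longlonglongrightarrow> S'' a0"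
    by (intro continuous_on_tendsto_compose[OF cont]) auto
  then have "(\<lambda>j. S'' (a j + (\<theta> j * \<tau> j) *\<^sub>R v j) (v j) (v j) / 2) \<longlonglongrightarrow> S'' a0 v0 v0 / 2"
    by (intro tendsto_intros v) auto
  then show ?thesis unfolding eq by simp
qed

text \<open>The second difference \<open>S (a + \<tau> u + \<tau> v) - S (a + \<tau> u) - S (a + \<tau> v) + S a\<close>, divided by \<open>\<tau>\<^sup>2\<close>,
  is evaluated in two ways. Expansion at \<open>a\<close> gives the symmetrization of \<open>S'' a\<close>; expansion at the
  moving base point \<open>a + \<tau> u\<close> gives \<open>S'' a u v\<close>.\<close>

lemma second_derivative_symmetric: "S'' a u v = S'' a v u"
proof -
  define \<tau> where "\<tau> j = inverse (real (Suc j))" for j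
  have \<tau>: "\<tau> \<longlonglongrightarrow> 0" "\<And>j. \<tau> j \<noteq> 0" unfolding \<tau>_def using LIMSEQ_inverse_real_of_nat by auto
  define T where "T a w j = (S (a + \<tau> j *\<^sub>R w) - S a - \<tau> j * S' a w) / (\<tau> j)\<^sup>2" for a w j
  have T: "(\<lambda>j. T a w j) \<longlonglongrightarrow> S'' a w w / 2" for w
    unfolding T_def by (intro second_order_taylor_tendsto \<tau> tendsto_const)
  have "(\<lambda>j. a + \<tau> j *\<^sub>R u) \<longlonglongrightarrow> a + 0 *\<^sub>R u" by (intro tendsto_intros \<tau>)
  then have T': "(\<lambda>j. T (a + \<tau> j *\<^sub>R u) v j) \<longlonglongrightarrow> S'' a v v / 2"
    unfolding T_def by (intro second_order_taylor_tendsto \<tau> tendsto_const) simp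
  have "((\<lambda>t. S' (a + t *\<^sub>R u) v) has_real_derivative S'' a u v) (at 0)"
    by (rule has_derivative_along_line) (use gradient_has_derivative[where h = v, OF S''[of a]] in simp)
  then have "(\<lambda>h. (S' (a + h *\<^sub>R u) v - S' a v) / h) \<midarrow>0\<rightarrow> S'' a u v" by (simp add: DERIV_def)
  then have D: "(\<lambda>j. (S' (a + \<tau> j *\<^sub>R u) v - S' a v) / \<tau> j) \<longlonglongrightarrow> S'' a u v"
    by (rule filterlim_compose) (use \<tau> in \<open>simp add: filterlim_at\<close>)
  have "T a (u + v) j - T a u j - T (a + \<tau> j *\<^sub>R u) v j = (S' (a + \<tau> j *\<^sub>R u) v - S' a v) / \<tau> j" for j
  proof -
    have "(S' (a + \<tau> j *\<^sub>R u) v - S' a v) / \<tau> j = (\<tau> j * S' (a + \<tau> j *\<^sub>R u) v - \<tau> j * S' a v) / (\<tau> j)\<^sup>2"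
      using \<tau>(2)[of j] by (simp add: power2_eq_square field_simps)
    then show ?thesis
      unfolding T_def diff_divide_distrib[symmetric]
      by (simp add: blinfun.add_right scaleR_add_right algebra_simps)
  qed
  then have "S'' a (u + v) (u + v) / 2 - S'' a u u / 2 - S'' a v v / 2 = S'' a u v"
    using LIMSEQ_unique[OF tendsto_diff[OF tendsto_diff[OF T T] T'] ] D by simp
  then show ?thesis by (simp add: blinfun.add_right blinfun.add_left field_simps)
qed

end

lemma linear_blinfun_Pair:
  fixes \<phi> :: "('a::real_normed_vector \<times> 'c::real_normed_vector) \<Rightarrow>\<^sub>L 'b::real_normed_vector"
  shows "linear (\<lambda>x. blinfun_apply \<phi> (x, 0))" and "linear (\<lambda>x. blinfun_apply \<phi> (0, x))"
proof -
  have pairs: "(x + y, 0::'c) = (x, 0) + (y, 0)" "(c *\<^sub>R x, 0::'c) = c *\<^sub>R (x, 0)"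
    "(0::'a, v + w) = (0, v) + (0, w)" "(0::'a, c *\<^sub>R v) = c *\<^sub>R (0, v)"
    for x y :: 'a and v w :: 'c and c
    by simp_all
  show "linear (\<lambda>x. blinfun_apply \<phi> (x, 0))" "linear (\<lambda>x. blinfun_apply \<phi> (0, x))"
    unfolding linear_iff pairs by (simp_all only: blinfun.add_right blinfun.scaleR_right simp_thms)
qed

lemma partial_derivatives:
  fixes S :: "'n::finite phase \<Rightarrow> real"
  assumes "\<And>w. (S has_derivative blinfun_apply (S' w)) (at w)"
  shows "((\<lambda>q'. S (q', Q)) has_derivative (\<lambda>h. S' (q, Q) (h, 0))) (at q)"
    and "((\<lambda>Q'. S (q, Q')) has_derivative (\<lambda>h. S' (q, Q) (0, h))) (at Q)"
proof -
  have "((\<lambda>q'. (q', Q)) has_derivative (\<lambda>h. (h, 0))) (at q)" "((\<lambda>Q'. (q, Q')) has_derivative (\<lambda>h. (0,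
      h))) (at Q)"
    by (auto intro!: derivative_eq_intros)
  from has_derivative_compose[OF this(1) assms] has_derivative_compose[OF this(2) assms]
  show "((\<lambda>q'. S (q', Q)) has_derivative (\<lambda>h. S' (q, Q) (h, 0))) (at q)"
    "((\<lambda>Q'. S (q, Q')) has_derivative (\<lambda>h. S' (q, Q) (0, h))) (at Q)" .
qed

lemma mixed_derivative_eq:
  fixes S :: "'n::finite phase \<Rightarrow> real"
  assumes S': "\<And>w. (S has_derivative blinfun_apply (S' w)) (at w)"
    and S'': "\<And>w. (S' has_derivative blinfun_apply (S'' w)) (at w)"
  shows "mixed_derivative S q Q v w = S'' (q, Q) (v, 0) (0, w)"
proof -
  have inner: "frechet_derivative (\<lambda>Q'. S (q', Q')) (at Q) w = S' (q', Q) (0, w)" for q'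
    unfolding frechet_derivative_at[OF partial_derivatives(2)[OF S'], symmetric] ..
  have "((\<lambda>e. S' e (0, w)) has_derivative (\<lambda>v. S'' (q, Q) v (0, w))) (at (q, Q))"
    by (rule gradient_has_derivative[OF S''])
  moreover have "((\<lambda>q'. (q', Q)) has_derivative (\<lambda>h. (h, 0))) (at q)"
    by (auto intro!: derivative_eq_intros)
  ultimately have "((\<lambda>q'. S' (q', Q) (0, w)) has_derivative (\<lambda>v. S'' (q, Q) (v, 0) (0, w))) (at q)"
    by (rule has_derivative_compose[rotated])
  from frechet_derivative_at[OF this, symmetric] show ?thesis
    unfolding mixed_derivative_def inner by (simp only:)
qed

text \<open>A diffeomorphism \<open>F\<close> of the universal cover generated by \<open>S\<close>, with all derivatives that are used
  made explicit.\<close>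

locale twist_lift =
  fixes F G :: "'n::finite phase \<Rightarrow> 'n phase" and F' :: "'n phase \<Rightarrow> 'n phase \<Rightarrow>\<^sub>L 'n phase"
    and S :: "'n phase \<Rightarrow> real" and S' :: "'n phase \<Rightarrow> 'n phase \<Rightarrow>\<^sub>L real"
    and S'' :: "'n phase \<Rightarrow> 'n phase \<Rightarrow>\<^sub>L 'n phase \<Rightarrow>\<^sub>L real"
  assumes S': "\<And>w. (S has_derivative blinfun_apply (S' w)) (at w)"
    and S'': "\<And>w. (S' has_derivative blinfun_apply (S'' w)) (at w)"
    and cont_S'': "continuous_on UNIV S''"
    and twist: "\<And>w v. v \<noteq> 0 \<Longrightarrow> S'' w (v, 0) (0, v) < 0"
    and FG: "\<And>z. F (G z) = z" and GF: "\<And>z. G (F z) = z"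
    and cont_G: "continuous_on UNIV G"
    and F': "\<And>z. (F has_derivative blinfun_apply (F' z)) (at z)"
    and gradient: "\<And>z h h'. S' (fst z, fst (F z)) (h, h') = snd (F z) \<bullet> h' - snd z \<bullet> h"
begin

definition edge :: "'n phase \<Rightarrow> 'n phase" where "edge z = (fst z, fst (F z))"

text \<open>The blocks of the Hessian at the step that starts in \<open>z\<close>. The sign makes \<open>B\<close> positive definite.\<close>

definition A :: "'n phase \<Rightarrow> real^'n^'n" where "A z = (\<chi> i j. S'' (edge z) (axis i 1, 0) (axis j 1, 0))"
definition B :: "'n phase \<Rightarrow> real^'n^'n" where "B z = (\<chi> i j. - S'' (edge z) (axis i 1, 0) (0, axis j 1))"
definition C :: "'n phase \<Rightarrow> real^'n^'n" where "C z = (\<chi> i j. S'' (edge z) (0, axis i 1) (0, axis j 1))"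

lemma cont_F: "continuous_on UNIV F"
  using F' has_derivative_continuous_on[of UNIV F "\<lambda>z. blinfun_apply (F' z)"]
      by (simp add: has_derivative_at_withinI)

lemma cont_edge: "continuous_on UNIV edge"
  unfolding edge_def[abs_def] by (intro continuous_intros cont_F)

lemma cont_F_pow: "continuous_on UNIV (F ^^ k)" and cont_G_pow: "continuous_on UNIV (G ^^ k)"
  by (induction k) (auto intro: continuous_on_compose2[OF cont_F] continuous_on_compose2[OF cont_G] simp: o_def)

lemma inner_A: "x \<bullet> (A z *v y) = S'' (edge z) (x, 0) (y, 0)"
  and inner_B: "x \<bullet> (B z *v y) = - S'' (edge z) (x, 0) (0, y)"
  and inner_C: "x \<bullet> (C z *v y) = S'' (edge z) (0, x) (0, y)"
proof -
  have l: "linear (\<lambda>x. S'' (edge z) (x, 0) w)" "linear (\<lambda>x. S'' (edge z) (0, x) w)" for w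
    using linear_blinfun_Pair[of "S'' (edge z)"] by (auto simp: linear_iff blinfun.add_left blinfun.scaleR_left)
  show "x \<bullet> (A z *v y) = S'' (edge z) (x, 0) (y, 0)"
    unfolding A_def by (rule inner_bilinear_matrix) (auto intro: l linear_blinfun_Pair)
  show "x \<bullet> (C z *v y) = S'' (edge z) (0, x) (0, y)"
    unfolding C_def by (rule inner_bilinear_matrix) (auto intro: l linear_blinfun_Pair)
  show "x \<bullet> (B z *v y) = - S'' (edge z) (x, 0) (0, y)"
    unfolding B_def by (rule inner_bilinear_matrix[of "\<lambda>x y. - S'' (edge z) (x, 0) (0, y)"]) (auto
        intro!: linear_compose_neg l linear_blinfun_Pair)
qed

lemma S''_sym: "S'' w u v = S'' w v u"
  by (rule second_derivative_symmetric[OF S' S'' cont_S''])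

lemma S''_eq: "S'' (edge z) (x, y) (x', y') = x \<bullet> (A z *v x') - x \<bullet> (B z *v y') - x' \<bullet> (B z *v y)
    + y \<bullet> (C z *v y')"
proof -
  have "S'' (edge z) (x, y) (x', y') = S'' (edge z) ((x, 0) + (0, y)) ((x', 0) + (0, y'))" by simp
  also have "\<dots> = S'' (edge z) (x, 0) (x', 0) + S'' (edge z) (x, 0) (0, y') + S'' (edge z) (0, y) (x', 0)
      + S'' (edge z) (0, y) (0, y')"
    by (simp only: blinfun.add_left blinfun.add_right add.assoc)
  finally show ?thesis using S''_sym[of "edge z" "(0, y)" "(x', 0)"] by (simp add: inner_A inner_B inner_C)
qed

lemma S''_step_form: "S'' (edge z) (x, y) (x, y) = step_form (A z) (B z) (C z) x y"
  by (simp add: S''_eq step_form_def)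

lemma sym_A: "transpose (A z) = A z" and sym_C: "transpose (C z) = C z" and pos_def_B: "pos_def (B z)"
proof -
  show "transpose (A z) = A z" by (rule transpose_eqI) (simp only: inner_A, rule S''_sym)
  show "transpose (C z) = C z" by (rule transpose_eqI) (simp only: inner_C, rule S''_sym)
  show "pos_def (B z)" by (simp add: pos_def_def inner_B twist)
qed

lemma cont_ABC: "continuous_on UNIV A" "continuous_on UNIV B" "continuous_on UNIV C"
  unfolding A_def[abs_def] B_def[abs_def] C_def[abs_def]
  by (auto intro!: continuous_intros continuous_on_compose2[OF cont_S'' cont_edge])

text \<open>Differentiating the relations \<open>p = - \<partial>S / \<partial>q\<close> and \<open>P = \<partial>S / \<partial>Q\<close> along \<open>F\<close> gives the linearized
  dynamics.\<close>

lemma derivative_step: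
  fixes v z :: "'n phase" defines "v' \<equiv> F' z v"
  shows "B z *v fst v' = snd v + A z *v fst v" and "snd v' = C z *v fst v' - transpose (B z) *v fst v"
proof -
  have "((\<lambda>z. S' (edge z) w) has_derivative (\<lambda>v. S'' (edge z) (fst v, fst (F' z v)) w)) (at z)" for w
    unfolding edge_def
    by (rule has_derivative_compose[of "\<lambda>z. (fst z, fst (F z))" _ z UNIV "\<lambda>e. S' e w", OF _
        gradient_has_derivative[OF S'']])
       (auto intro!: derivative_eq_intros F')
  moreover have "((\<lambda>z. S' (edge z) w) has_derivative (\<lambda>v. snd (F' z v) \<bullet> snd w - snd v \<bullet> fst w)) (at z)" for w
  proof -
    have "S' (edge z) w = snd (F z) \<bullet> snd w - snd z \<bullet> fst w" for z
      using gradient[of z "fst w" "snd w"] by (simp add: edge_def)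
    then show ?thesis by (auto intro!: derivative_eq_intros F')
  qed
  ultimately have "(\<lambda>v. S'' (edge z) (fst v, fst (F' z v)) w)
      = (\<lambda>v. snd (F' z v) \<bullet> snd w - snd v \<bullet> fst w)" for w
    by (rule has_derivative_unique)
  from fun_cong[OF this, of v] have eq: "S'' (edge z) (fst v, fst v') w = snd v' \<bullet> snd w - snd v \<bullet> fst w" for w
    unfolding v'_def .
  have "h \<bullet> (B z *v fst v') = h \<bullet> (snd v + A z *v fst v)" for h
    using eq[of "(h, 0)"] inner_sym_matrix[OF sym_A, of "fst v" z h]
        by (simp add: S''_eq inner_add_right inner_commute)
  then show "B z *v fst v' = snd v + A z *v fst v" by (metis vector_eq_rdot inner_commute)
  have "h \<bullet> snd v' = h \<bullet> (C z *v fst v' - transpose (B z) *v fst v)" for h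
    using eq[of "(0, h)"] inner_sym_matrix[OF sym_C, of "fst v'" z h]
        by (simp add: S''_eq inner_diff_right inner_transpose inner_commute)
  then show "snd v' = C z *v fst v' - transpose (B z) *v fst v" by (metis vector_eq_rdot inner_commute)
qed

primrec DF_pow :: "nat \<Rightarrow> 'n phase \<Rightarrow> 'n phase \<Rightarrow> 'n phase" where
  "DF_pow 0 z v = v"
| "DF_pow (Suc k) z v = F' ((F ^^ k) z) (DF_pow k z v)"

lemma DF_pow: "((F ^^ k) has_derivative DF_pow k z) (at z)"
proof (induction k)
  case 0
  have "F ^^ 0 = (\<lambda>x. x)" "DF_pow 0 z = (\<lambda>v. v)" by auto
  then show ?case by simp
next
  case (Suc k)
  have "((\<lambda>x. F ((F ^^ k) x)) has_derivative (\<lambda>v. F' ((F ^^ k) z) (DF_pow k z v))) (at z)"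
    by (rule has_derivative_compose[OF Suc F'])
  then show ?case by (simp add: o_def)
qed

lemma F_pow_tendsto: "a \<longlonglongrightarrow> a0 \<Longrightarrow> (\<lambda>j. (F ^^ k) (a j)) \<longlonglongrightarrow> (F ^^ k) a0"
  and G_pow_tendsto: "a \<longlonglongrightarrow> a0 \<Longrightarrow> (\<lambda>j. (G ^^ k) (a j)) \<longlonglongrightarrow> (G ^^ k) a0"
  by (rule continuous_on_tendsto_compose[OF cont_F_pow]; simp) (rule continuous_on_tendsto_compose[OF
      cont_G_pow]; simp)

text \<open>The change in the action of \<open>k\<close> steps of the orbit of \<open>z\<close> when its positions are displaced by
  \<open>\<tau> *\<^sub>R \<xi>\<close>.\<close>

definition action_change :: "'n phase \<Rightarrow> real \<Rightarrow> (nat \<Rightarrow> real^'n) \<Rightarrow> nat \<Rightarrow> real" where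
  "action_change z \<tau> \<xi> k = (\<Sum>i<k. S (edge ((F ^^ i) z) + \<tau> *\<^sub>R (\<xi> i, \<xi> (Suc i))) - S (edge ((F ^^ i) z)))"

text \<open>The first order terms telescope to boundary terms, because the momentum produced by one step is
  the momentum from which the next one starts.\<close>

lemma action_change_tendsto:
  assumes a: "a \<longlonglongrightarrow> a0" and \<xi>: "\<And>i. (\<lambda>j. \<xi> j i) \<longlonglongrightarrow> \<xi>0 i" and \<tau>: "\<tau> \<longlonglongrightarrow> 0" "\<And>j. \<tau> j \<noteq> (0::real)"
  shows "(\<lambda>j. (action_change (a j) (\<tau> j) (\<xi> j) k - \<tau> j * (snd ((F ^^ k) (a j)) \<bullet> \<xi> j k - snd (a j) \<bullet> \<xi> j
      0)) / (\<tau> j)\<^sup>2)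
    \<longlonglongrightarrow> path_form F A B C a0 \<xi>0 k / 2"
proof -
  let ?w = "\<lambda>j i. (\<xi> j i, \<xi> j (Suc i))" and ?e = "\<lambda>a i. edge ((F ^^ i) a)"
  have "(\<lambda>j. \<Sum>i<k. (S (?e (a j) i + \<tau> j *\<^sub>R ?w j i) - S (?e (a j) i) - \<tau> j * S' (?e (a j) i) (?w j i)) /
      (\<tau> j)\<^sup>2)
     \<longlonglongrightarrow> (\<Sum>i<k. S'' (?e a0 i) (\<xi>0 i, \<xi>0 (Suc i)) (\<xi>0 i, \<xi>0 (Suc i)) / 2)"
    by (intro tendsto_sum second_order_taylor_tendsto[OF S' S'' cont_S''] tendsto_Pair \<xi> \<tau>
      continuous_on_tendsto_compose[OF cont_edge] F_pow_tendsto a) auto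
  also have "(\<Sum>i<k. S'' (?e a0 i) (\<xi>0 i, \<xi>0 (Suc i)) (\<xi>0 i, \<xi>0 (Suc i)) / 2) = path_form F A B C a0 \<xi>0 k / 2"
    by (simp add: path_form_def S''_step_form sum_divide_distrib)
  also have "(\<lambda>j. \<Sum>i<k. (S (?e (a j) i + \<tau> j *\<^sub>R ?w j i) - S (?e (a j) i) - \<tau> j * S' (?e (a j) i) (?w j
      i)) / (\<tau> j)\<^sup>2) =
    (\<lambda>j. (action_change (a j) (\<tau> j) (\<xi> j) k - \<tau> j * (snd ((F ^^ k) (a j)) \<bullet> \<xi> j k - snd (a j) \<bullet> \<xi> j 0))
        / (\<tau> j)\<^sup>2)"
  proof
    fix j
    have "(\<Sum>i<k. S' (?e (a j) i) (?w j i)) = (\<Sum>i<k. snd ((F ^^ Suc i) (a j)) \<bullet> \<xi> j (Suc i) - snd ((F ^^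
        i) (a j)) \<bullet> \<xi> j i)"
      by (simp add: edge_def gradient)
    also have "\<dots> = snd ((F ^^ k) (a j)) \<bullet> \<xi> j k - snd (a j) \<bullet> \<xi> j 0"
      by (subst sum_lessThan_telescope) simp
    finally show "(\<Sum>i<k. (S (?e (a j) i + \<tau> j *\<^sub>R ?w j i) - S (?e (a j) i) - \<tau> j * S' (?e (a j) i) (?w j
        i)) / (\<tau> j)\<^sup>2) =
      (action_change (a j) (\<tau> j) (\<xi> j) k - \<tau> j * (snd ((F ^^ k) (a j)) \<bullet> \<xi> j k - snd (a j) \<bullet> \<xi> j 0)) / (\<tau> j)\<^sup>2"
      by (simp add: action_change_def sum_divide_distrib[symmetric] sum_subtractf sum_distrib_left[symmetric])
  qed
  finally show ?thesis .
qed

end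

text \<open>All orbits in \<open>X\<close> are calibrated by the same function \<open>u\<close>.\<close>

locale calibrated_lift = twist_lift F G F' S S' S'' for F G :: "'n::finite phase \<Rightarrow> 'n phase" and F' S S' S'' +
  fixes X :: "'n phase set" and u :: "real^'n \<Rightarrow> real" and L :: real
  assumes FX: "z \<in> X \<Longrightarrow> F z \<in> X" and GX: "z \<in> X \<Longrightarrow> G z \<in> X"
    and subsolution: "u y - u x \<le> S (x, y) - L"
    and calibrated: "z \<in> X \<Longrightarrow> u (fst (F z)) - u (fst z) = S (edge z) - L"
begin

lemma FX_pow: "z \<in> X \<Longrightarrow> (F ^^ k) z \<in> X"
  by (induction k) (auto simp: FX)

lemma action_change_ge:
  assumes z: "z \<in> X"
  shows "u (fst ((F ^^ k) z) + \<tau> *\<^sub>R \<xi> k) - u (fst ((F ^^ k) z)) - (u (fst z + \<tau> *\<^sub>R \<xi> 0) - u (fst z))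
      \<le> action_change z \<tau> \<xi> k"
proof (induction k)
  case (Suc k)
  let ?z = "(F ^^ k) z"
  have "u (fst (F ?z) + \<tau> *\<^sub>R \<xi> (Suc k)) - u (fst ?z + \<tau> *\<^sub>R \<xi> k) \<le> S (edge ?z + \<tau> *\<^sub>R (\<xi> k, \<xi> (Suc k))) - L"
    using subsolution by (simp add: edge_def)
  moreover have "u (fst (F ?z)) - u (fst ?z) = S (edge ?z) - L" by (rule calibrated[OF FX_pow[OF z]])
  ultimately show ?case using Suc by (simp add: action_change_def)
qed (simp add: action_change_def)

lemma path_form_nonneg:
  assumes z: "z \<in> X" and \<xi>: "\<xi> 0 = 0" "\<xi> k = 0" shows "0 \<le> path_form F A B C z \<xi> k"
proof -
  define \<tau> where "\<tau> j = inverse (real (Suc j))" for j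
  have \<tau>: "\<tau> \<longlonglongrightarrow> 0" "\<And>j. \<tau> j \<noteq> 0" unfolding \<tau>_def using LIMSEQ_inverse_real_of_nat by auto
  have "(\<lambda>j. (action_change z (\<tau> j) \<xi> k - \<tau> j * (snd ((F ^^ k) z) \<bullet> \<xi> k - snd z \<bullet> \<xi> 0)) / (\<tau> j)\<^sup>2)
    \<longlonglongrightarrow> path_form F A B C z \<xi> k / 2"
    by (intro action_change_tendsto tendsto_const \<tau>)
  moreover have "0 \<le> (action_change z (\<tau> j) \<xi> k - \<tau> j * (snd ((F ^^ k) z) \<bullet> \<xi> k - snd z \<bullet> \<xi> 0)) / (\<tau> j)\<^sup>2" for j
    using action_change_ge[OF z, of k "\<tau> j" \<xi>] by (simp add: \<xi>)
  ultimately have "0 \<le> path_form F A B C z \<xi> k / 2" by (meson LIMSEQ_le_const)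
  then show ?thesis by simp
qed

sublocale jacobi_system F G X A B C
  by unfold_locales (auto simp: FG GF FX GX sym_A sym_C pos_def_B path_form_nonneg)

lemma jacobi_field_DF: "jacobi_field z (\<lambda>k. DF_pow k z v)"
  unfolding jacobi_field_def using derivative_step by simp

text \<open>Four pieces are considered: backward and forward pieces of the orbits of \<open>a j\<close> and \<open>b j\<close>. A
  backward piece of one orbit is joined to a forward piece of the other at a point close to both.
  By calibration the two joined paths do not cost less than the two orbits; dividing by \<open>(\<tau> j)\<^sup>2\<close>
  and passing to the limit gives the claim. The free vectors \<open>x\<close>, \<open>y\<close> determine the two junction
  points.\<close>

lemma exchange:
  assumes a: "a \<longlonglongrightarrow> a0" "\<And>j. a j \<in> X" and b: "b \<longlonglongrightarrow> a0" "\<And>j. b j \<in> X"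
    and \<tau>: "\<tau> \<longlonglongrightarrow> 0" "\<And>j. \<tau> j \<noteq> (0::real)" and w: "(\<lambda>j. inverse (\<tau> j) *\<^sub>R (b j - a j)) \<longlonglongrightarrow> (d, e)"
    and paths: "\<xi> 0 = 0" "\<xi> k = x" "\<eta> 0 = x + d" "\<eta> k = 0" "\<xi>' 0 = 0" "\<xi>' k = y + d" "\<eta>' 0 = y" "\<eta>' k
        = 0" and k: "0 < k"
  shows "0 \<le> e \<bullet> (x - y) + (path_form F A B C ((G ^^ k) a0) \<xi> k + path_form F A B C a0 \<eta> k
     + path_form F A B C ((G ^^ k) a0) \<xi>' k + path_form F A B C a0 \<eta>' k) / 2"
proof -
  define d' where "d' j = inverse (\<tau> j) *\<^sub>R (fst (b j) - fst (a j))" for j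
  define e' where "e' j = inverse (\<tau> j) *\<^sub>R (snd (b j) - snd (a j))" for j
  have d': "d' \<longlonglongrightarrow> d" and e': "e' \<longlonglongrightarrow> e"
    using tendsto_fst[OF w] tendsto_snd[OF w] by (simp_all add: d'_def[abs_def] e'_def[abs_def])
  have \<tau>d: "\<tau> j *\<^sub>R d' j = fst (b j) - fst (a j)" and \<tau>e: "\<tau> j *\<^sub>R e' j = snd (b j) - snd (a j)" for j
    using \<tau>(2)[of j] by (simp_all add: d'_def e'_def)
  \<comment> \<open>displacements corrected at one end, so that the pieces about \<open>a j\<close> and \<open>b j\<close> meet exactly\<close>
  define H where "H j = \<eta>(0 := x + d' j)" for j
  define H' where "H' j = \<xi>'(k := y + d' j)" for j
  let ?Gb = "\<lambda>j. (G ^^ k) (b j)" and ?Ga = "\<lambda>j. (G ^^ k) (a j)"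
  let ?q = "\<lambda>z \<tau> \<xi>. (action_change z \<tau> \<xi> k - \<tau> * (snd ((F ^^ k) z) \<bullet> \<xi> k - snd z \<bullet> \<xi> 0)) / \<tau>\<^sup>2"
  have H: "(\<lambda>j. H j i) \<longlonglongrightarrow> \<eta> i" for i
    unfolding H_def using paths by (cases "i = 0") (auto intro!: tendsto_intros d')
  have H': "(\<lambda>j. H' j i) \<longlonglongrightarrow> \<xi>' i" for i
    unfolding H'_def using paths by (cases "i = k") (auto intro!: tendsto_intros d')
  have lim: "(\<lambda>j. e' j \<bullet> (x - y) + (?q (?Gb j) (\<tau> j) \<xi> + ?q (a j) (\<tau> j) (H j) + ?q (?Ga j) (\<tau> j) (H' j)
      + ?q (b j) (\<tau> j) \<eta>'))
    \<longlonglongrightarrow> e \<bullet> (x - y) + (path_form F A B C ((G ^^ k) a0) \<xi> k / 2 + path_form F A B C a0 \<eta> k / 2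
     + path_form F A B C ((G ^^ k) a0) \<xi>' k / 2 + path_form F A B C a0 \<eta>' k / 2)"
    by (intro tendsto_add tendsto_inner e' action_change_tendsto a b \<tau> H H' tendsto_const G_pow_tendsto)
  have "0 \<le> e' j \<bullet> (x - y) + (?q (?Gb j) (\<tau> j) \<xi> + ?q (a j) (\<tau> j) (H j) + ?q (?Ga j) (\<tau> j) (H' j)
      + ?q (b j) (\<tau> j) \<eta>')" for j
  proof -
    have k0: "k \<noteq> 0" using k by simp
    have J: "fst (b j) + \<tau> j *\<^sub>R x = fst (a j) + \<tau> j *\<^sub>R (x + d' j)" "fst (b j) + \<tau> j *\<^sub>R y = fst (a j)
        + \<tau> j *\<^sub>R (y + d' j)"
      by (simp_all add: scaleR_add_right \<tau>d)
    let ?c1 = "action_change (?Gb j) (\<tau> j) \<xi> k" and ?c2 = "action_change (a j) (\<tau> j) (H j) k"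
      and ?c3 = "action_change (?Ga j) (\<tau> j) (H' j) k" and ?c4 = "action_change (b j) (\<tau> j) \<eta>' k"
    have "u (fst (b j) + \<tau> j *\<^sub>R x) - u (fst (b j)) \<le> ?c1"
      using action_change_ge[OF GX_pow[OF b(2)[of j]], of k k "\<tau> j" \<xi>] by (simp add: TG_pow paths)
    moreover have "u (fst (a j)) - u (fst (b j) + \<tau> j *\<^sub>R x) \<le> ?c2"
      unfolding J using action_change_ge[OF a(2)[of j], of k "\<tau> j" "H j"] k0 by (simp add: paths H_def)
    moreover have "u (fst (b j) + \<tau> j *\<^sub>R y) - u (fst (a j)) \<le> ?c3"
      unfolding J using action_change_ge[OF GX_pow[OF a(2)[of j]], of k k "\<tau> j" "H' j"] k0
          by (simp add: TG_pow paths H'_def)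
    moreover have "u (fst (b j)) - u (fst (b j) + \<tau> j *\<^sub>R y) \<le> ?c4"
      using action_change_ge[OF b(2)[of j], of k "\<tau> j" \<eta>'] by (simp add: paths)
    ultimately have "0 \<le> ?c1 + ?c2 + ?c3 + ?c4" by linarith
    then have "0 \<le> (?c1 + ?c2 + ?c3 + ?c4) / (\<tau> j)\<^sup>2" by simp
    also have "\<dots> = e' j \<bullet> (x - y) + (?q (?Gb j) (\<tau> j) \<xi> + ?q (a j) (\<tau> j) (H j) + ?q (?Ga j) (\<tau> j) (H' j)
        + ?q (b j) (\<tau> j) \<eta>')"
    proof -
      have "(\<tau> j)\<^sup>2 * (e' j \<bullet> (x - y)) = \<tau> j * ((snd (b j) - snd (a j)) \<bullet> (x - y))"
        unfolding \<tau>e[symmetric] by (simp add: power2_eq_square)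
      then have E: "e' j \<bullet> (x - y) = \<tau> j * ((snd (b j) - snd (a j)) \<bullet> (x - y)) / (\<tau> j)\<^sup>2"
        using \<tau>(2)[of j] by (simp add: field_simps)
      show ?thesis
        unfolding E using k0
        by (simp add: TG_pow paths H_def H'_def add_divide_distrib diff_divide_distrib inner_diff_left
            inner_diff_right
            inner_add_right right_diff_distrib distrib_left)
    qed
    finally show ?thesis .
  qed
  then have "0 \<le> e \<bullet> (x - y) + (path_form F A B C ((G ^^ k) a0) \<xi> k / 2 + path_form F A B C a0 \<eta> k / 2
     + path_form F A B C ((G ^^ k) a0) \<xi>' k / 2 + path_form F A B C a0 \<eta>' k / 2)"
    by (intro LIMSEQ_le_const[OF lim]) auto
  then show ?thesis by (simp add: add_divide_distrib)
qed

text \<open>With optimal paths in the exchange inequality and \<open>k \<rightarrow> \<infinity>\<close>, the quadratic terms in \<open>x\<close> and in \<open>y\<close>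
  cancel since \<open>Sp = Sm\<close> at \<open>a0\<close>. What remains is linear in \<open>x - y\<close> and of one sign, hence zero.\<close>

lemma paratingent_in_graph:
  assumes a: "a \<longlonglongrightarrow> a0" "\<And>j. a j \<in> X" and b: "b \<longlonglongrightarrow> a0" "\<And>j. b j \<in> X"
    and \<tau>: "\<tau> \<longlonglongrightarrow> 0" "\<And>j. \<tau> j \<noteq> (0::real)" and w: "(\<lambda>j. inverse (\<tau> j) *\<^sub>R (b j - a j)) \<longlonglongrightarrow> (d, e)"
    and a0: "a0 \<in> X" and eq: "Sp a0 = Sm a0"
  shows "e = Sp a0 *v d"
proof -
  interpret rev: jacobi_system G F X Ar Br Cr by (rule reverse)
  let ?s = "Sp a0" and ?r = "green_bundle F Ar Br Cr a0"
  have sym: "x \<bullet> (?s *v y) = y \<bullet> (?s *v x)" for x y by (rule inner_sym_matrix[OF sym_green_bundle[OF a0]])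
  have r: "x \<bullet> (?r *v x) = - (x \<bullet> (?s *v x))" for x
    using inner_matrix_diff[of x 0 ?r x] unfolding eq by simp
  have ineq: "0 \<le> (e - ?s *v d) \<bullet> (x - y)" for x y
  proof -
    have "0 \<le> e \<bullet> (x - y) + (x \<bullet> (sp k a0 *v x) + (x + d) \<bullet> (rp k a0 *v (x + d))
      + (y + d) \<bullet> (sp k a0 *v (y + d)) + y \<bullet> (rp k a0 *v y)) / 2" for k
    proof -
      obtain \<xi> \<xi>' \<eta> \<eta>' where p: "\<xi> 0 = 0" "\<xi> (Suc k) = x" "\<eta> 0 = x + d" "\<eta> (Suc k) = 0" 
        "\<xi>' 0 = 0" "\<xi>' (Suc k) = y + d" "\<eta>' 0 = y" "\<eta>' (Suc k) = 0"
        and q: "path_form F A B C ((G ^^ Suc k) a0) \<xi> (Suc k) = x \<bullet> (sp k a0 *v x)"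
        "path_form F A B C a0 \<eta> (Suc k) = (x + d) \<bullet> (rp k a0 *v (x + d))"
        "path_form F A B C ((G ^^ Suc k) a0) \<xi>' (Suc k) = (y + d) \<bullet> (sp k a0 *v (y + d))"
        "path_form F A B C a0 \<eta>' (Suc k) = y \<bullet> (rp k a0 *v y)"
        using sp_props[OF a0, of k] rp_path[OF a0, of "x + d" k] rp_path[OF a0, of y k] by metis
      show ?thesis using exchange[OF a b \<tau> w p] unfolding q by simp
    qed
    moreover have "(\<lambda>k. e \<bullet> (x - y) + (x \<bullet> (sp k a0 *v x) + (x + d) \<bullet> (rp k a0 *v (x + d))
      + (y + d) \<bullet> (sp k a0 *v (y + d)) + y \<bullet> (rp k a0 *v y)) / 2) \<longlonglongrightarrow>
       e \<bullet> (x - y) + (x \<bullet> (?s *v x) + (x + d) \<bullet> (?r *v (x + d)) + (y + d) \<bullet> (?s *v (y + d))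
           + y \<bullet> (?r *v y)) / 2"
      by (intro tendsto_intros sp_form_tendsto rev.sp_form_tendsto a0) simp
    ultimately have "0 \<le> e \<bullet> (x - y) + (x \<bullet> (?s *v x) + (x + d) \<bullet> (?r *v (x + d)) + (y + d) \<bullet> (?s *v (y
        + d)) + y \<bullet> (?r *v y)) / 2"
      by (meson LIMSEQ_le_const)
    then show ?thesis
      unfolding r using sym[of x d] sym[of y d]
      by (simp add: matrix_vector_right_distrib inner_add_left inner_add_right inner_diff_left
          inner_diff_right inner_commute
          diff_divide_distrib)
  qed
  have "0 \<le> (e - ?s *v d) \<bullet> (0 - (e - ?s *v d))" by (rule ineq)
  then have "(e - ?s *v d) \<bullet> (e - ?s *v d) \<le> 0" unfolding diff_0 inner_minus_right by linarith
  then show ?thesis by (metis inner_gt_zero_iff eq_iff_diff_eq_0 linorder_not_less)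
qed

end

text \<open>A diagonal choice replaces each contingent vector in the sequence by a rescaled difference of
  two points of \<open>A\<close>.\<close>

lemma limit_contingent_cone_paratingent:
  fixes A :: "'a::real_normed_vector set"
  assumes "v \<in> limit_contingent_cone A a" "v \<noteq> 0"
  obtains p q \<tau> where "p \<longlonglongrightarrow> a" "\<And>k. p k \<in> A" "q \<longlonglongrightarrow> a" "\<And>k. q k \<in> A"
    "\<tau> \<longlonglongrightarrow> 0" "\<And>k. \<tau> k \<noteq> (0::real)" "(\<lambda>k. inverse (\<tau> k) *\<^sub>R (q k - p k)) \<longlonglongrightarrow> v"
proof -
  obtain s w r where s: "\<And>k. s k \<in> A" "\<And>k. w k \<in> contingent_cone A (s k)" "s \<longlonglongrightarrow> a"
      and r: "strict_mono r" "(w \<circ> r) \<longlonglongrightarrow> v"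
    using assms(1) unfolding limit_contingent_cone_def limit_point_of_seq_def by blast
  have "\<exists>b t. b \<in> A \<and> norm (b - s k) < inverse (real (Suc k)) \<and> norm (t *\<^sub>R (b - s k) - w k) < inverse
      (real (Suc k))" for k
  proof -
    obtain t s' r' where c: "\<And>i. s' i \<in> A" "s' \<longlonglongrightarrow> s k" "strict_mono r'" "((\<lambda>i. t i *\<^sub>R (s' i - s k)) \<circ> r') \<longlonglongrightarrow> w k"
      using s(2)[of k] unfolding contingent_cone_def limit_point_of_seq_def by blast
    have "(s' \<circ> r') \<longlonglongrightarrow> s k" by (rule LIMSEQ_subseq_LIMSEQ[OF c(2,3)])
    then have "\<forall>\<^sub>F i in sequentially. dist ((s' \<circ> r') i) (s k) < inverse (real (Suc k))" by (rule tendstoD) simp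
    moreover have "\<forall>\<^sub>F i in sequentially. dist (((\<lambda>i. t i *\<^sub>R (s' i - s k)) \<circ> r') i) (w k) < inverse
        (real (Suc k))"
      using c(4) by (rule tendstoD) simp
    ultimately have "\<forall>\<^sub>F i in sequentially. norm (s' (r' i) - s k) < inverse (real (Suc k)) \<and> 
      norm (t (r' i) *\<^sub>R (s' (r' i) - s k) - w k) < inverse (real (Suc k))"
      by eventually_elim (simp add: dist_norm)
    then obtain i where "norm (s' (r' i) - s k) < inverse (real (Suc k)) \<and> 
      norm (t (r' i) *\<^sub>R (s' (r' i) - s k) - w k) < inverse (real (Suc k))"
      using eventually_happens'[OF sequentially_bot] by blast
    then show ?thesis using c(1) by blast
  qed
  then obtain b t where b: "\<And>k. b k \<in> A" "\<And>k. norm (b k - s k) < inverse (real (Suc k))" 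
     "\<And>k. norm (t k *\<^sub>R (b k - s k) - w k) < inverse (real (Suc k))" by metis
  have bs: "(\<lambda>k. b k - s k) \<longlonglongrightarrow> 0"
    using b(2) by (intro Lim_null_comparison[OF _ LIMSEQ_inverse_real_of_nat] always_eventually) (auto
        intro: less_imp_le)
  have tw: "(\<lambda>k. t k *\<^sub>R (b k - s k) - w k) \<longlonglongrightarrow> 0"
    using b(3) by (intro Lim_null_comparison[OF _ LIMSEQ_inverse_real_of_nat] always_eventually) (auto
        intro: less_imp_le)
  define d where "d k = b (r k) - s (r k)" for k
  have d: "d \<longlonglongrightarrow> 0" using LIMSEQ_subseq_LIMSEQ[OF bs r(1)] by (simp add: d_def[abs_def] o_def)
  have td: "(\<lambda>k. t (r k) *\<^sub>R d k) \<longlonglongrightarrow> v"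
    using tendsto_add[OF LIMSEQ_subseq_LIMSEQ[OF tw r(1)] r(2)] by (simp add: d_def o_def)
  then have "(\<lambda>k. norm (t (r k) *\<^sub>R d k)) \<longlonglongrightarrow> norm v" by (rule tendsto_norm)
  moreover have "0 < norm v" using assms(2) by simp
  ultimately have "\<forall>\<^sub>F k in sequentially. 0 < norm (t (r k) *\<^sub>R d k)" by (rule order_tendstoD)
  then have "\<forall>\<^sub>F k in sequentially. t (r k) \<noteq> 0 \<and> d k \<noteq> 0" by eventually_elim auto
  then obtain N where N: "\<And>k. k \<ge> N \<Longrightarrow> t (r k) \<noteq> 0 \<and> d k \<noteq> 0" unfolding eventually_sequentially by blast
  have sr: "(\<lambda>k. s (r k)) \<longlonglongrightarrow> a" using LIMSEQ_subseq_LIMSEQ[OF s(3) r(1)] by (simp add: o_def)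
  show thesis
  proof (rule that[of "\<lambda>k. s (r (k + N))" "\<lambda>k. b (r (k + N))" "\<lambda>k. inverse (t (r (k + N)))"])
    show "(\<lambda>k. s (r (k + N))) \<longlonglongrightarrow> a" using LIMSEQ_ignore_initial_segment[OF sr] .
    have "(\<lambda>k. s (r k) + d k) \<longlonglongrightarrow> a + 0" by (intro tendsto_add sr d)
    then have "(\<lambda>k. b (r k)) \<longlonglongrightarrow> a" by (simp add: d_def)
    then show "(\<lambda>k. b (r (k + N))) \<longlonglongrightarrow> a" by (rule LIMSEQ_ignore_initial_segment)
    have "(\<lambda>k. norm (d k) / norm (t (r k) *\<^sub>R d k)) \<longlonglongrightarrow> norm (0::'a) / norm v"
      by (intro tendsto_intros d td) (use assms(2) in simp)
    from LIMSEQ_ignore_initial_segment[OF this, of N]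
    have "(\<lambda>k. norm (d (k + N)) / norm (t (r (k + N)) *\<^sub>R d (k + N))) \<longlonglongrightarrow> 0" by simp
    moreover have "norm (d (k + N)) / norm (t (r (k + N)) *\<^sub>R d (k + N)) = norm (inverse (t (r (k + N))))" for k
      using N[of "k + N"] by (simp add: divide_inverse)
    ultimately have "(\<lambda>k. norm (inverse (t (r (k + N))))) \<longlonglongrightarrow> 0" by (simp only:)
    then show "(\<lambda>k. inverse (t (r (k + N)))) \<longlonglongrightarrow> 0" by (rule tendsto_norm_zero_cancel)
    show "inverse (t (r (k + N))) \<noteq> 0" for k using N by simp
    show "(\<lambda>k. inverse (inverse (t (r (k + N)))) *\<^sub>R (b (r (k + N)) - s (r (k + N)))) \<longlonglongrightarrow> v"
      using LIMSEQ_ignore_initial_segment[OF td, of N] by (simp add: d_def)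
  qed (auto simp: s b)
qed

lemma lagrangian_graph:
  fixes M :: "real^'n^'n"
  assumes "transpose M = M" shows "lagrangian (range (\<lambda>x. (x, M *v x)))"
  unfolding lagrangian_def
proof (intro conjI ballI)
  have l: "linear (\<lambda>x. (x, M *v x))"
    by (simp add: linear_iff matrix_vector_right_distrib matrix_vector_mult_scaleR)
  then show "subspace (range (\<lambda>x. (x, M *v x)))" using linear_subspace_image subspace_UNIV by blast
  have "inj (\<lambda>x. (x, M *v x))" by (rule injI) simp
  then have "dim (range (\<lambda>x. (x, M *v x))) = dim (UNIV :: (real^'n) set)"
    using dim_image_eq[OF l, of UNIV] by simp
  then show "dim (range (\<lambda>x. (x, M *v x))) = CARD('n)" by simp
  fix v w assume "v \<in> range (\<lambda>x. (x, M *v x))" "w \<in> range (\<lambda>x. (x, M *v x))"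
  then show "symplectic_form v w = 0"
    using inner_sym_matrix[OF assms] by (auto simp: symplectic_form_def inner_commute)
qed

section \<open>Calibration of strongly minimizing measures\<close>

lemma unit_cube_representative: "\<exists>y. y \<in> cbox 0 1 \<and> y - x \<in> int_vecs" for x :: "real^'n"
proof (intro exI conjI)
  show "(\<chi> i. frac (x $ i)) \<in> cbox 0 1" by (simp add: mem_box_cart frac_lt_1 less_imp_le)
  show "(\<chi> i. frac (x $ i)) - x \<in> int_vecs" by (auto simp: int_vecs_def frac_def)
qed

lemma int_periodic_bounded:
  fixes u :: "real^'n \<Rightarrow> real"
  assumes "int_periodic u" "continuous_on UNIV u" shows "\<exists>K. \<forall>x. \<bar>u x\<bar> \<le> K"
proof -
  have "compact (u ` cbox 0 1)" by (intro compact_continuous_image continuous_on_subset[OF assms(2)]) auto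
  then obtain K where K: "\<And>x. x \<in> cbox 0 1 \<Longrightarrow> \<bar>u x\<bar> \<le> K" by (metis bounded_real compact_imp_bounded image_eqI)
  have "\<bar>u x\<bar> \<le> K" for x
  proof -
    obtain y where y: "y \<in> cbox 0 1" "y - x \<in> int_vecs" using unit_cube_representative by blast
    then have "u y = u x" using assms(1) unfolding int_periodic_def by (metis add.commute diff_add_cancel)
    then show ?thesis using K[OF y(1)] by simp
  qed
  then show ?thesis by blast
qed

text \<open>The subsolution property is the part of the equation for \<open>u\<^sub>-\<close> that remains after dropping the
  infimum. Surjectivity of \<open>edge\<close> says that any two positions are joined by one step of an orbit.\<close>

locale weak_kam_lift = twist_lift F G F' S S' S'' for F G :: "'n::finite phase \<Rightarrow> 'n phase" and F' S S' S'' +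
  fixes f :: "'n annulus \<Rightarrow> 'n annulus" and u :: "real^'n \<Rightarrow> real" and L :: real
  assumes lift_F: "lift_of F f" and lift_G: "lift_of G (inv f)" and bij_f: "bij f"
    and edge_surj: "\<exists>z. w = edge z"
    and u_periodic: "int_periodic u" and u_cont: "continuous_on UNIV u"
    and u_sub: "u y - u x \<le> S (x, y) - L"
begin

lemma proj_F: "annulus_proj (F z) = f (annulus_proj z)" and proj_G: "annulus_proj (G z)
    = inv f (annulus_proj z)"
  by (rule lift_of_proj[OF lift_F], rule lift_of_proj[OF lift_G])

lemma proj_F_pow: "annulus_proj ((F ^^ k) z) = (f ^^ k) (annulus_proj z)"
  by (rule lift_of_proj[OF lift_of_funpow[OF lift_F]])

lemma S_cont: "continuous_on UNIV S"
  using has_derivative_continuous_on[of UNIV S "\<lambda>z. blinfun_apply (S' z)"] S'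
      by (simp add: has_derivative_at_withinI)

text \<open>Equivariance of \<open>F\<close> makes the gradient of \<open>S\<close> invariant under the translation \<open>t\<close>, so \<open>S\<close>
  changes by a constant. That constant vanishes, since iterating the translation in both
  directions would otherwise contradict the lower bound for \<open>S\<close> that the bounded function \<open>u\<close>
  provides.\<close>

lemma edge_deck:
  assumes "annulus_proj z = annulus_proj z'"
  obtains t where "edge z = edge z' + t" "\<And>w. S' (w + t) = S' w" "\<And>w. S'' (w + t) = S'' w" "\<And>w. S (w + t) = S w"
proof -
  obtain \<nu> where \<nu>: "\<nu> \<in> int_vecs" "z = z' + (\<nu>, 0)" using assms annulus_proj_eq_iff by blast
  obtain \<mu> where \<mu>: "\<mu> \<in> int_vecs" "\<And>z. F (z + (\<nu>, 0)) = F z + (\<mu>, 0)"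
      using lift_of_translate[OF lift_F \<nu>(1)] by blast
  let ?t = "(\<nu>, \<mu>)"
  have e: "edge (z + (\<nu>, 0)) = edge z + ?t" for z by (simp add: edge_def \<mu>)
  have S't: "S' (w + ?t) = S' w" for w
  proof (rule blinfun_eqI)
    fix h
    obtain z where z: "w = edge z" using edge_surj by blast
    have "S' (edge (z + (\<nu>, 0))) (fst h, snd h) = S' (edge z) (fst h, snd h)"
      unfolding edge_def gradient by (simp add: \<mu>)
    then show "S' (w + ?t) h = S' w h" by (simp add: e z)
  qed
  have shift: "((\<lambda>x. x + ?t) has_derivative (\<lambda>h. h)) (at w)" for w by (auto intro!: derivative_eq_intros)
  have S''t: "S'' (w + ?t) = S'' w" for w
  proof (rule blinfun_eqI)
    fix h
    have "((\<lambda>x. S' (x + ?t)) has_derivative (\<lambda>h. S'' (w + ?t) h)) (at w)"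
      by (rule has_derivative_compose[OF shift S''])
    then have "(S' has_derivative blinfun_apply (S'' (w + ?t))) (at w)" unfolding S't .
    then show "S'' (w + ?t) h = S'' w h" using has_derivative_unique[OF S''] by metis
  qed
  obtain c where c: "\<And>w. S (w + ?t) = S w + c"
  proof -
    have d: "((\<lambda>x. S (x + ?t) - S x) has_derivative (\<lambda>h. 0)) (at w)" for w
    proof -
      have "((\<lambda>x. S (x + ?t)) has_derivative (\<lambda>h. S' (w + ?t) h)) (at w)"
        by (rule has_derivative_compose[OF shift S'])
      from has_derivative_diff[OF this S'] show ?thesis by (simp add: S't)
    qed
    have "\<exists>c. \<forall>x\<in>UNIV. S (x + ?t) - S x = c"
      by (rule has_derivative_zero_constant) (auto intro: has_derivative_at_withinI d)
    then show thesis using that by (metis UNIV_I diff_add_cancel add.commute)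
  qed
  have ck: "S (w + real k *\<^sub>R ?t) = S w + real k * c" for w k
  proof (induction k)
    case (Suc k)
    have "w + real (Suc k) *\<^sub>R ?t = (w + real k *\<^sub>R ?t) + ?t"
      by (simp only: of_nat_Suc scaleR_left_distrib scaleR_one add_ac)
    then have "S (w + real (Suc k) *\<^sub>R ?t) = S (w + real k *\<^sub>R ?t) + c" by (simp only: c)
    also have "\<dots> = S w + real (Suc k) * c" unfolding Suc by (simp add: distrib_right)
    finally show ?case .
  qed (simp add: zero_prod_def[symmetric])
  obtain K where K: "\<And>x. \<bar>u x\<bar> \<le> K" using int_periodic_bounded[OF u_periodic u_cont] by blast
  have lower: "L - 2 * K \<le> S w" for w
    using u_sub[of "snd w" "fst w"] K[of "fst w"] K[of "snd w"] by (simp add: abs_le_iff)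
  have "c = 0"
  proof (rule ccontr)
    assume "c \<noteq> 0"
    then obtain k where k: "S 0 - (L - 2 * K) < real k * \<bar>c\<bar>" using reals_Archimedean3[of "\<bar>c\<bar>"] by auto
    show False
    proof (cases "c < 0")
      case True
      then show False using ck[of 0 k] lower[of "0 + real k *\<^sub>R ?t"] k by simp
    next
      case False
      then show False using ck[of "0 - real k *\<^sub>R ?t" k] lower[of "0 - real k *\<^sub>R ?t"] k
          by (simp add: zero_prod_def)
    qed
  qed
  then show thesis using that[of ?t] e[of z'] \<nu>(2) S't S''t c by simp
qed

definition excess :: "'n phase \<Rightarrow> real" where
  "excess z = S (edge z) - L - (u (fst (F z)) - u (fst z))"

lemma excess_nonneg: "0 \<le> excess z"
  using u_sub[of "fst (F z)" "fst z"] by (simp add: excess_def edge_def)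

lemma u_proj: "annulus_proj z = annulus_proj z' \<Longrightarrow> u (fst z) = u (fst z')"
  using u_periodic unfolding annulus_proj_eq_iff int_periodic_def by auto

lemma excess_periodic: assumes "annulus_proj z = annulus_proj z'" shows "excess z = excess z'"
proof -
  have "S (edge z) = S (edge z')" using edge_deck[OF assms] by metis
  moreover have "u (fst (F z)) = u (fst (F z'))" by (rule u_proj) (simp add: proj_F assms)
  ultimately show ?thesis using u_proj[OF assms] by (simp add: excess_def)
qed

lemma excess_cont: "continuous_on UNIV excess"
  unfolding excess_def[abs_def]
  by (intro continuous_intros continuous_on_compose2[OF S_cont] continuous_on_compose2[OF u_cont]
      cont_edge cont_F) auto

lemma ABC_periodic:
  assumes "annulus_proj z = annulus_proj z'" shows "A z = A z'" "B z = B z'" "C z = C z'"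
  by (rule edge_deck[OF assms]; simp add: A_def B_def C_def)+

text \<open>The competitor is one step between points of the unit cube that are congruent to the end points
  of the orbit segment; this uses that strong minimization allows a different number of steps.\<close>

lemma strongly_minimizing_excess_bounded:
  "\<exists>K. \<forall>N z. (\<forall>k. z (k + 1) = F (z k)) \<longrightarrow> strongly_minimizing S L (\<lambda>k::int. fst (z k)) \<longrightarrow>
     (\<Sum>i<N. excess ((F ^^ i) (z 0))) \<le> K"
proof -
  obtain K where K: "\<And>x. \<bar>u x\<bar> \<le> K" using int_periodic_bounded[OF u_periodic u_cont] by blast
  have "compact (S ` (cbox 0 1 \<times> cbox 0 1))"
    by (intro compact_continuous_image compact_Times continuous_on_subset[OF S_cont]) auto
  then obtain D where D: "\<And>x y. x \<in> cbox 0 1 \<Longrightarrow> y \<in> cbox 0 1 \<Longrightarrow> \<bar>S (x, y)\<bar> \<le> D"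
    by (metis bounded_real compact_imp_bounded image_eqI mem_Sigma_iff)
  have K0: "0 \<le> K" using K[of 0] by simp
  have D0: "0 \<le> D" using D[of 0 0] by (simp add: mem_box_cart)
  have "(\<Sum>i<N. excess ((F ^^ i) (z 0))) \<le> D + \<bar>L\<bar> + 2 * K"
    if z: "\<forall>k. z (k + 1) = F (z k)" and min: "strongly_minimizing S L (\<lambda>k::int. fst (z k))" for N z
  proof (cases "N = 0")
    case False
    have zi: "z (int i) = (F ^^ i) (z 0)" for i
    proof (induction i)
      case (Suc i)
      have "z (int (Suc i)) = z (int i + 1)" by (simp add: add.commute)
      also have "\<dots> = F (z (int i))" using z by blast
      finally show ?case using Suc by simp
    qed simp
    have "(\<Sum>i<N. excess ((F ^^ i) (z 0))) = (\<Sum>i<N. S (edge ((F ^^ i) (z 0))) - L) - (u (fst ((F ^^ N) (z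
        0))) - u (fst (z 0)))"
      by (induction N) (auto simp: excess_def)
    also have "(\<Sum>i<N. S (edge ((F ^^ i) (z 0))) - L) = action S L (\<lambda>k. fst (z k)) 0 (int N)"
      unfolding action_def
    proof (rule sum.reindex_bij_witness[of _ "\<lambda>i. nat (i - 1)" "\<lambda>i. int i + 1"])
      fix i assume "i \<in> {..<N}"
      show "S (fst (z (int i + 1 - 1)), fst (z (int i + 1))) - L = S (edge ((F ^^ i) (z 0))) - L"
        using zi[of i] z by (simp add: edge_def)
    qed auto
    also have "action S L (\<lambda>k. fst (z k)) 0 (int N) \<le> D + \<bar>L\<bar>"
    proof -
      obtain y0 where y0: "y0 \<in> cbox 0 1" "y0 - fst (z 0) \<in> int_vecs" using unit_cube_representative by blast
      obtain y1 where y1: "y1 \<in> cbox 0 1" "y1 - fst (z (int N)) \<in> int_vecs"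
          using unit_cube_representative by blast
      define y where "y k = (if k = (0::int) then y0 else y1)" for k
      have "action S L (\<lambda>k. fst (z k)) 0 (int N) \<le> action S L y 0 1"
        using min y0 y1 False unfolding strongly_minimizing_def by (auto simp: y_def)
      also have "action S L y 0 1 = S (y0, y1) - L" by (simp add: action_def y_def)
      also have "\<dots> \<le> D + \<bar>L\<bar>" using D[OF y0(1) y1(1)] by linarith
      finally show ?thesis .
    qed
    finally show ?thesis using K[of "fst ((F ^^ N) (z 0))"] K[of "fst (z 0)"] by linarith
  qed (use K0 D0 in simp)
  then show ?thesis by blast
qed

text \<open>The excess has bounded sums along orbits, so it vanishes almost everywhere; by continuity the
  set where it does not vanish is open and of measure zero, hence disjoint from the support.\<close>

lemma excess_zero_on_support:
  assumes M: "strongly_minimizing_measure f F S L M" and z: "annulus_proj z \<in> measure_support M"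
  shows "excess z = 0"
proof -
  have inv: "invariant_prob f M" and min: "\<And>a. a \<in> measure_support M \<Longrightarrow> strongly_minimizing_orbit F S L a"
    using M by (auto simp: strongly_minimizing_measure_def)
  have sets: "sets M = sets borel" and f: "f \<in> measurable M M" "distr M M f = M" using inv
      by (auto simp: invariant_prob_def)
  interpret prob_space M using inv by (simp add: invariant_prob_def)
  define g where "g a = excess (annulus_section a)" for a
  have g_proj: "g (annulus_proj z) = excess z" for z unfolding g_def by (rule excess_periodic) simp
  have g_cont: "continuous_on UNIV g"
    unfolding g_def by (rule continuous_on_descend) (auto intro: excess_periodic excess_cont)
  have g_meas: "g \<in> borel_measurable M"
    using borel_measurable_continuous_onI[OF g_cont] measurable_cong_sets[OF sets refl] by blast
  obtain K where K: "\<And>N z. (\<forall>k. z (k + 1) = F (z k)) \<Longrightarrow> strongly_minimizing S L (\<lambda>k::int. fst (z k)) \<Longrightarrow>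
     (\<Sum>i<N. excess ((F ^^ i) (z 0))) \<le> K" using strongly_minimizing_excess_bounded by blast
  have "AE a in M. g a = 0"
  proof (rule AE_zero_if_averages_le[OF f g_meas, of "\<lambda>_. K"])
    show "0 \<le> g a" for a by (simp add: g_def excess_nonneg)
    show "AE a in M. \<forall>\<epsilon>>0. \<forall>\<^sub>F k in sequentially. (\<Sum>i<k. g ((f ^^ i) a)) \<le> \<epsilon> * real k + K"
      using AE_in_measure_support[OF sets]
    proof eventually_elim
      case (elim a)
      obtain y where y: "\<forall>k. y (k + 1) = F (y k)" "annulus_proj (y (0::int))
          = a" "strongly_minimizing S L (\<lambda>k. fst (y k))"
        using min[OF elim] unfolding strongly_minimizing_orbit_def by blast
      have "g ((f ^^ i) a) = excess ((F ^^ i) (y 0))" for i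
        using g_proj[of "(F ^^ i) (y 0)"] by (simp add: proj_F_pow y(2))
      then have "(\<Sum>i<k. g ((f ^^ i) a)) \<le> K" for k using K[OF y(1,3)] by simp
      then have "(\<Sum>i<k. g ((f ^^ i) a)) \<le> \<epsilon> * real k + K" if "0 < \<epsilon>" for \<epsilon> k
        using that by (simp add: add_increasing)
      then show ?case by (simp add: always_eventually)
    qed
  qed simp
  then have "emeasure M {a \<in> space M. g a \<noteq> 0} = 0"
    using AE_iff_measurable[of "{a \<in> space M. g a \<noteq> 0}" M "\<lambda>a. g a = 0"] g_meas by simp
  moreover have "space M = UNIV" using sets_eq_imp_space_eq[OF sets] by simp
  ultimately have null: "emeasure M {a. g a \<noteq> 0} = 0" by simp
  have "open {a. g a \<noteq> 0}" by (intro open_Collect_neq g_cont continuous_on_const)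
  then have "g (annulus_proj z) = 0" using z null unfolding measure_support_def by force
  then show ?thesis by (simp add: g_proj)
qed

lemma tangent_map_funpow:
  assumes "annulus_proj z = a" shows "tangent_map (f ^^ k) a = DF_pow k z"
  by (rule tangent_map_eq[OF lift_of_funpow[OF lift_F] assms DF_pow])

lemma support_invariant:
  assumes "invariant_prob f M"
  shows "f a \<in> measure_support M \<longleftrightarrow> a \<in> measure_support M"
  by (intro measure_support_invariant assms bij_f lift_of_imp_continuous[OF lift_F]
      lift_of_imp_continuous[OF lift_G])

lemma push_periodic:
  assumes "annulus_proj z = annulus_proj z'"
  shows "push F (\<lambda>z. C (G z)) (\<lambda>z. transpose (B (G z))) (\<lambda>z. A (G z)) k z
      = push F (\<lambda>z. C (G z)) (\<lambda>z. transpose (B (G z))) (\<lambda>z. A (G z)) k z'"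
    and "push G A B C k z = push G A B C k z'"
proof -
  have G: "annulus_proj (G z) = annulus_proj (G z')" "annulus_proj (F z) = annulus_proj (F z')"
    if "annulus_proj z = annulus_proj z'" for z z' by (simp_all add: proj_G proj_F that)
  show "push G A B C k z = push G A B C k z'" using assms
  proof (induction k arbitrary: z z')
    case (Suc k)
    show ?case using Suc.IH[OF G(1)[OF Suc.prems]] ABC_periodic[OF G(1)[OF Suc.prems]] by simp
  next
    case 0
    show ?case using ABC_periodic(3)[OF G(1)[OF 0]] by simp
  qed
  show "push F (\<lambda>z. C (G z)) (\<lambda>z. transpose (B (G z))) (\<lambda>z. A (G z)) k z
      = push F (\<lambda>z. C (G z)) (\<lambda>z. transpose (B (G z))) (\<lambda>z. A (G z)) k z'"
    using assms
  proof (induction k arbitrary: z z')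
    case (Suc k)
    show ?case using Suc.IH[OF G(2)[OF Suc.prems]] ABC_periodic[OF Suc.prems] by (simp add: GF)
  next
    case 0
    show ?case using ABC_periodic(1)[OF 0] by (simp add: GF)
  qed
qed

end

section \<open>Zero exponents and coincidence of the Green bundles\<close>

locale minimizing_support = weak_kam_lift F G F' S S' S'' f u L
  for F G :: "'n::finite phase \<Rightarrow> 'n phase" and F' S S' S'' f u L +
  fixes M :: "'n annulus measure"
  assumes minimizing: "strongly_minimizing_measure f F S L M"
begin

definition X :: "'n phase set" where "X = annulus_proj -` measure_support M"

lemma inv_M: "invariant_prob f M" using minimizing by (simp add: strongly_minimizing_measure_def)

lemma sets_M: "sets M = sets borel" using inv_M by (simp add: invariant_prob_def)

sublocale calibrated_lift F G F' S S' S'' X u L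
proof
  fix z assume z: "z \<in> X"
  show "F z \<in> X" using z support_invariant[OF inv_M] by (simp add: X_def proj_F)
  show "G z \<in> X" using z support_invariant[OF inv_M, of "annulus_proj (G z)"]
      by (simp add: X_def FG flip: proj_F)
  show "u (fst (F z)) - u (fst z) = S (edge z) - L"
    using excess_zero_on_support[OF minimizing, of z] z by (simp add: X_def excess_def)
qed (rule u_sub)

lemma green_periodic:
  assumes "annulus_proj z = annulus_proj z'" shows "Sp z = Sp z'" "Sm z = Sm z'"
  unfolding green_bundle_def push_periodic[OF assms] by simp_all

lemma det_ratio_periodic: assumes "annulus_proj z = annulus_proj z'" shows "det_ratio z = det_ratio z'"
  unfolding det_ratio_def green_periodic[OF assms] ABC_periodic[OF assms] ..

lemma measurable_on_support:
  fixes h :: "'n phase \<Rightarrow> real^'n^'n"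
  assumes "continuous_on X h" "\<And>z z'. annulus_proj z = annulus_proj z' \<Longrightarrow> h z = h z'"
  shows "(\<lambda>a. if a \<in> measure_support M then h (annulus_section a) else 0) \<in> borel_measurable M"
proof -
  have "(\<lambda>a. if a \<in> measure_support M then h (annulus_section a) else 0) \<in> borel_measurable borel"
    by (intro borel_measurable_continuous_on_if continuous_on_descend[OF assms(1)[unfolded X_def] assms(2)]
        continuous_on_const borel_closed closed_measure_support)
  then show ?thesis using measurable_cong_sets[OF sets_M refl] by blast
qed

lemma push_limit_measurable:
  fixes h :: "nat \<Rightarrow> 'n phase \<Rightarrow> real^'n^'n"
  assumes "\<And>k. continuous_on X (h k)" "\<And>k z z'. annulus_proj z = annulus_proj z' \<Longrightarrow> h k z = h k z'"
    "\<And>z. z \<in> X \<Longrightarrow> (\<lambda>k. h k z) \<longlonglongrightarrow> g z"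
  shows "(\<lambda>a. if a \<in> measure_support M then g (annulus_section a) else 0) \<in> borel_measurable M"
proof (rule borel_measurable_LIMSEQ_metric)
  show "(\<lambda>a. if a \<in> measure_support M then h k (annulus_section a) else 0) \<in> borel_measurable M" for k
    by (rule measurable_on_support[OF assms(1,2)])
  show "(\<lambda>k. if a \<in> measure_support M then h k (annulus_section a) else 0)
      \<longlonglongrightarrow> (if a \<in> measure_support M then g (annulus_section a) else 0)" for a
    using assms(3)[of "annulus_section a"] by (simp add: X_def)
qed

text \<open>The approximations \<open>push k\<close> are continuous on the closed set \<open>X\<close>, and their limits inherit
  measurability.\<close>

lemma green_measurable:
  "(\<lambda>a. if a \<in> measure_support M then Sp (annulus_section a) else 0) \<in> borel_measurable M"
  "(\<lambda>a. if a \<in> measure_support M then Sm (annulus_section a) else 0) \<in> borel_measurable M"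
proof -
  interpret rev: jacobi_system G F X Ar Br Cr by (rule reverse)
  have G: "continuous_on X G" "G ` X \<subseteq> X" and F: "continuous_on X F" "F ` X \<subseteq> X"
    using GX FX by (auto intro: continuous_on_subset[OF cont_F] continuous_on_subset[OF cont_G])
  have c: "continuous_on X A" "continuous_on X B" "continuous_on X C"
    by (rule continuous_on_subset[OF cont_ABC(1)] continuous_on_subset[OF cont_ABC(2)]
        continuous_on_subset[OF cont_ABC(3)]; simp)+
  have c': "continuous_on X Ar" "continuous_on X Br" "continuous_on X Cr"
    by (intro continuous_on_transpose continuous_on_compose2[OF _ G] c)+
  have "continuous_on X (sp k)" for k
    by (rule continuous_on_push[OF G c]) (use sp_props pos_def_invertible in blast)
  then show "(\<lambda>a. if a \<in> measure_support M then Sp (annulus_section a) else 0) \<in> borel_measurable M"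
    by (rule push_limit_measurable[OF _ push_periodic(2) sp_convergent])
  have "continuous_on X (rp k)" for k
    by (rule continuous_on_push[OF F c']) (use rev.sp_props pos_def_invertible in blast)
  then have "continuous_on X (\<lambda>z. - rp k z)" for k by (intro continuous_on_minus)
  then show "(\<lambda>a. if a \<in> measure_support M then Sm (annulus_section a) else 0) \<in> borel_measurable M"
  proof (rule push_limit_measurable)
    show "- rp k z = - rp k z'" if "annulus_proj z = annulus_proj z'" for k z z'
      using push_periodic(1)[OF that] by simp
    show "(\<lambda>k. - rp k z) \<longlonglongrightarrow> Sm z" if "z \<in> X" for z by (intro tendsto_minus rev.sp_convergent that)
  qed
qed

text \<open>The \<open>2 n\<close> vectors whose norms bound the determinants grow at most like \<open>exp (\<delta> k)\<close> for every
  \<open>\<delta> > 0\<close>.\<close>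

lemma sum_ln_det_ratio_eventually_le:
  assumes z: "annulus_proj z = a" "z \<in> X" and exps: "\<forall>c\<in>lyapunov_exponents_at f a. c = 0" and \<epsilon>: "0 < \<epsilon>"
  shows "\<forall>\<^sub>F k in sequentially. (\<Sum>j<k. ln (det_ratio ((F ^^ j) z))) \<le> \<epsilon> * real k +
    (2 * ln (fact CARD('n)) + real CARD('n) * ln (1 + entry_sum (Sm ((F ^^ k) z))))"
proof -
  define \<delta> where "\<delta> = \<epsilon> / (2 * real CARD('n))"
  have \<delta>: "0 < \<delta>" "2 * real CARD('n) * \<delta> = \<epsilon>" using \<epsilon> by (auto simp: \<delta>_def)
  let ?v = "\<lambda>i k. DF_pow k z (axis i 1, Sp z *v axis i 1)" and ?w = "\<lambda>i k. DF_pow k z (0, axis i 1)"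
  have growth: "\<forall>\<^sub>F k in sequentially. ln (norm (DF_pow k z v)) \<le> \<delta> * real k" if v: "v \<noteq> 0" for v
  proof -
    have "lyapunov_exponent f a v \<in> lyapunov_exponents_at f a" using v
        unfolding lyapunov_exponents_at_def by blast
    then have "lyapunov_exponent f a v = 0" using exps by blast
    then have "limsup (\<lambda>k. ereal (ln (norm (DF_pow k z v)) / real k)) < ereal \<delta>"
      using \<delta> by (simp add: lyapunov_exponent_def tangent_map_funpow[OF z(1)])
    then have "\<forall>\<^sub>F k in sequentially. ereal (ln (norm (DF_pow k z v)) / real k) < ereal \<delta>"
        by (rule Limsup_lessD)
    then show ?thesis using eventually_gt_at_top[of 0]
      by eventually_elim (simp add: field_simps less_imp_le)
  qed
  have v0: "(axis i 1 :: real^'n, Sp z *v axis i 1) \<noteq> 0" "(0::real^'n, axis i 1 :: real^'n) \<noteq> 0" for i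
    by (simp_all add: zero_prod_def axis_eq_0_iff)
  have "\<forall>\<^sub>F k in sequentially. \<forall>i. ln (norm (?v i k)) \<le> \<delta> * real k"
    by (intro eventually_all_finite growth v0)
  moreover have "\<forall>\<^sub>F k in sequentially. \<forall>i. ln (norm (?w i k)) \<le> \<delta> * real k"
    by (intro eventually_all_finite growth v0)
  ultimately show ?thesis
  proof eventually_elim
    case (elim k)
    have "(\<Sum>j<k. ln (det_ratio ((F ^^ j) z))) \<le> 2 * ln (fact CARD('n)) + 2 * real CARD('n) * (\<delta> * real k) +
      real CARD('n) * ln (1 + entry_sum (Sm ((F ^^ k) z)))"
      by (rule sum_ln_det_ratio_le[OF z(2), of ?v ?w]) (use elim in \<open>auto intro: jacobi_field_DF\<close>)
    also have "2 * real CARD('n) * (\<delta> * real k) = \<epsilon> * real k" using \<delta>(2) by (simp add: mult.assoc[symmetric])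
    finally show ?case by simp
  qed
qed

text \<open>\<open>ln det_ratio\<close> is nonnegative and its averages have no positive limit, so it vanishes almost
  everywhere.\<close>

lemma green_bundles_coincide:
  assumes exps: "zero_lyapunov_exponents f M"
  shows "AE a in M. \<forall>z. annulus_proj z = a \<longrightarrow> z \<in> X \<and> Sp z = Sm z"
proof -
  interpret prob_space M using inv_M by (simp add: invariant_prob_def)
  have f: "f \<in> measurable M M" "distr M M f = M" using inv_M by (auto simp: invariant_prob_def)
  define SpM where "SpM a = (if a \<in> measure_support M then Sp (annulus_section a) else 0)" for a
  define SmM where "SmM a = (if a \<in> measure_support M then Sm (annulus_section a) else 0)" for a
  define AM where "AM a = (if a \<in> measure_support M then A (annulus_section a) else 0)" for a
  define g where "g a = (if a \<in> measure_support M then ln (det_ratio (annulus_section a)) else 0)" for a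
  define \<phi> where "\<phi> a = 2 * ln (fact CARD('n)) + real CARD('n) * ln (1 + entry_sum (SmM a))" for a
  have m: "SpM \<in> borel_measurable M" "SmM \<in> borel_measurable M" "AM \<in> borel_measurable M"
    unfolding SpM_def SmM_def AM_def
    using green_measurable measurable_on_support[OF continuous_on_subset[OF cont_ABC(1)]
        ABC_periodic(1)] by auto
  have supp: "measure_support M \<in> sets M" using sets_M by (simp add: borel_closed closed_measure_support)
  have "g = (\<lambda>a. if a \<in> measure_support M then ln (det (SpM a + AM a) / det (SmM a + AM a)) else 0)"
    by (auto simp: g_def SpM_def SmM_def AM_def det_ratio_def)
  also have "\<dots> \<in> borel_measurable M"
    by (intro measurable_If borel_measurable_ln borel_measurable_divide measurable_det borel_measurable_add m)
       (use supp in auto)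
  finally have g_meas: "g \<in> borel_measurable M" .
  have \<phi>_meas: "\<phi> \<in> borel_measurable M"
    unfolding \<phi>_def by (intro borel_measurable_add borel_measurable_times borel_measurable_const
        borel_measurable_ln measurable_entry_sum m)
  have g0: "0 \<le> g a" for a
    using det_ratio_ge_1[of "annulus_section a"] by (simp add: g_def X_def)
  have "AE a in M. g a = 0"
  proof (rule AE_zero_if_averages_le[OF f g_meas g0 \<phi>_meas])
    show "AE a in M. \<forall>\<epsilon>>0. \<forall>\<^sub>F k in sequentially. (\<Sum>i<k. g ((f ^^ i) a)) \<le> \<epsilon> * real k + \<phi> ((f ^^ k) a)"
      using AE_in_measure_support[OF sets_M] exps[unfolded zero_lyapunov_exponents_def]
    proof eventually_elim
      case (elim a)
      let ?z = "annulus_section a"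
      have z: "annulus_proj ?z = a" "?z \<in> X" using elim(1) by (auto simp: X_def)
      have pr: "annulus_proj (annulus_section ((f ^^ i) a)) = annulus_proj ((F ^^ i) ?z)" for i
          by (simp add: proj_F_pow)
      have s: "(f ^^ i) a \<in> measure_support M" for i
        using FX_pow[OF z(2), of i] by (simp add: X_def proj_F_pow)
      have "g ((f ^^ i) a) = ln (det_ratio ((F ^^ i) ?z))" for i
        using s det_ratio_periodic[OF pr] by (simp add: g_def)
      moreover have "\<phi> ((f ^^ k) a) = 2 * ln (fact CARD('n)) + real CARD('n) * ln (1
          + entry_sum (Sm ((F ^^ k) ?z)))" for k
        unfolding \<phi>_def SmM_def green_periodic(2)[OF pr] using s by simp
      ultimately show ?case using sum_ln_det_ratio_eventually_le[OF z elim(2)] by simp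
    qed
  qed
  then show ?thesis using AE_in_measure_support[OF sets_M]
  proof eventually_elim
    case (elim a)
    have "annulus_section a \<in> X" using elim(2) by (simp add: X_def)
    moreover have "det_ratio (annulus_section a) = 1"
      using elim det_ratio_ge_1[OF \<open>annulus_section a \<in> X\<close>] by (simp add: g_def)
    ultimately have eq: "Sp (annulus_section a) = Sm (annulus_section a)" by (rule det_ratio_eq_1)
    show ?case
    proof (intro allI impI conjI)
      fix z assume z: "annulus_proj z = a"
      then show "z \<in> X" using elim(2) by (simp add: X_def)
      have "annulus_proj z = annulus_proj (annulus_section a)" using z by simp
      then show "Sp z = Sm z" unfolding green_periodic[OF \<open>annulus_proj z
          = annulus_proj (annulus_section a)\<close>] by (intro eq)
    qed
  qed
qed

section \<open>Isotropy of the support\<close>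

lemma C1_isotropic_if_green_bundles_coincide:
  assumes z: "z \<in> X" and eq: "Sp z = Sm z" shows "C1_isotropic_at X z"
proof -
  let ?V = "range (\<lambda>x. (x, Sp z *v x))"
  have "limit_contingent_cone X z \<subseteq> ?V"
  proof
    fix v assume v: "v \<in> limit_contingent_cone X z"
    show "v \<in> ?V"
    proof (cases "v = 0")
      case True
      then show ?thesis by (auto simp: zero_prod_def intro!: image_eqI[of _ _ 0])
    next
      case False
      obtain a b \<tau> where ab: "a \<longlonglongrightarrow> z" "\<And>k. a k \<in> X" "b \<longlonglongrightarrow> z" "\<And>k. b k \<in> X"
        "\<tau> \<longlonglongrightarrow> 0" "\<And>k. \<tau> k \<noteq> (0::real)" "(\<lambda>k. inverse (\<tau> k) *\<^sub>R (b k - a k)) \<longlonglongrightarrow> v"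
        by (rule limit_contingent_cone_paratingent[OF v False]) (rule that)
      have "snd v = Sp z *v fst v"
        by (rule paratingent_in_graph[OF ab(1-6) _ z eq]) (use ab(7) in simp)
      then show ?thesis by (auto simp: prod_eq_iff)
    qed
  qed
  then show ?thesis unfolding C1_isotropic_at_def using z lagrangian_graph[OF sym_green_bundle[OF z]] by blast
qed

end

text \<open>Any pair of positions determines the two momenta by the gradient of \<open>S\<close>, whence surjectivity of
  \<open>edge\<close>. Two lifts of \<open>f\<close> differ by a translation, so \<open>F\<close> is as smooth as the lift that witnesses
  smoothness of \<open>f\<close>.\<close>

lemma weak_kam_lift_exists:
  fixes f :: "'n::finite annulus \<Rightarrow> 'n annulus"
  assumes f: "C1_annulus_diffeo f" and F: "lift_of F f" and S: "positive_generating_function S F"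
    and L: "critical_constant S L"
  shows "\<exists>G F' S' S'' u. weak_kam_lift F G F' S S' S'' f u L"
proof -
  obtain S' S'' where S': "\<And>w. (S has_derivative blinfun_apply (S' w)) (at w)"
    and S'': "\<And>w. (S' has_derivative blinfun_apply (S'' w)) (at w)" and cont_S'': "continuous_on UNIV S''"
    using S unfolding positive_generating_function_def C2_map_def C1_map_def by blast
  obtain \<alpha> where \<alpha>: "0 < \<alpha>" "\<And>q Q v. mixed_derivative S q Q v v \<le> - \<alpha> * (norm v)\<^sup>2"
    using S unfolding positive_generating_function_def by blast
  have gen: "F (q, p) = (Q, P) \<longleftrightarrow> GDERIV (\<lambda>q'. S (q', Q)) q :> - p \<and> GDERIV (\<lambda>Q'. S (q, Q')) Q :> P" for q p Q P
    using S unfolding positive_generating_function_def by blast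
  have gen': "F (q, p) = (Q, P) \<longleftrightarrow> (\<forall>h. S' (q, Q) (h, 0) = - (h \<bullet> p)) \<and> (\<forall>h. S' (q, Q) (0, h) = h \<bullet> P)"
      for q p Q P
  proof -
    have "GDERIV (\<lambda>q'. S (q', Q)) q :> - p \<longleftrightarrow> (\<forall>h. S' (q, Q) (h, 0) = h \<bullet> (- p))"
      unfolding gderiv_def using partial_derivatives(1)[OF S', of Q q]
      by (metis (no_types, lifting) ext has_derivative_unique)
    moreover have "GDERIV (\<lambda>Q'. S (q, Q')) Q :> P \<longleftrightarrow> (\<forall>h. S' (q, Q) (0, h) = h \<bullet> P)"
      unfolding gderiv_def using partial_derivatives(2)[OF S', of q Q]
      by (metis (no_types, lifting) ext has_derivative_unique)
    ultimately show ?thesis unfolding gen by simp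
  qed
  obtain F0 F0' where F0: "lift_of F0 f" "\<And>z. (F0 has_derivative blinfun_apply (F0' z)) (at z)"
    using f unfolding C1_annulus_diffeo_def C1_annulus_map_def C1_map_def by blast
  obtain c where c: "\<And>z. F z = F0 z + c" using lift_of_unique[OF F F0(1)] by blast
  have F': "(F has_derivative blinfun_apply (F0' z)) (at z)" for z
    unfolding c[abs_def] by (intro has_derivative_add_const F0(2))
  obtain F1 where F1: "lift_of F1 (inv f)" using f unfolding C1_annulus_diffeo_def C1_annulus_map_def by blast
  have bij: "bij f" using f by (simp add: C1_annulus_diffeo_def)
  obtain G where G: "lift_of G (inv f)" "\<And>z. F (G z) = z" "\<And>z. G (F z) = z"
      using lift_of_inverse[OF bij F F1] by blast
  obtain u where u: "int_periodic u" "continuous_on UNIV u" "\<And>y. ereal (u y) = (INF x. ereal (u x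
      + S (x, y) - L))"
    using L unfolding critical_constant_def by blast
  have u_sub: "u y - u x \<le> S (x, y) - L" for x y
  proof -
    have "ereal (u y) \<le> ereal (u x + S (x, y) - L)" unfolding u(3)[of y] by (rule INF_lower) simp
    then show ?thesis by simp
  qed
  have tw: "twist_lift F G F0' S S' S''"
  proof
    show "S'' w (v, 0) (0, v) < 0" if "v \<noteq> 0" for w v
    proof -
      have "S'' (fst w, snd w) (v, 0) (0, v) \<le> - \<alpha> * (norm v)\<^sup>2"
        using \<alpha>(2) unfolding mixed_derivative_eq[OF S' S''] .
      moreover have "0 < \<alpha> * (norm v)\<^sup>2" using \<alpha>(1) that by simp
      ultimately show ?thesis by simp
    qed
    show "S' (fst z, fst (F z)) (h, h') = snd (F z) \<bullet> h' - snd z \<bullet> h" for z h h'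
    proof -
      have "S' (fst z, fst (F z)) (h, h') = S' (fst z, fst (F z)) ((h, 0) + (0, h'))" by simp
      also have "\<dots> = S' (fst z, fst (F z)) (h, 0) + S' (fst z, fst (F z)) (0, h')" by (rule blinfun.add_right)
      finally show ?thesis using gen'[of "fst z" "snd z" "fst (F z)" "snd (F z)"] by (simp add: inner_commute)
    qed
  qed (use S' S'' cont_S'' G F' lift_of_cont[OF G(1)] in auto)
  interpret twist_lift F G F0' S S' S'' by (rule tw)
  have "weak_kam_lift F G F0' S S' S'' f u L"
  proof
    show "\<exists>z. w = edge z" for w
    proof -
      obtain D where D: "\<And>h. S' w (h, 0) = h \<bullet> D" using linear_functional_inner[OF
          linear_blinfun_Pair(1)] by blast
      obtain P where P: "\<And>h. S' w (0, h) = h \<bullet> P" using linear_functional_inner[OF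
          linear_blinfun_Pair(2)] by blast
      have "F (fst w, - D) = (snd w, P)" unfolding gen' by (simp add: D P)
      then show ?thesis by (intro exI[of _ "(fst w, - D)"]) (simp add: edge_def)
    qed
  qed (use F G bij u u_sub in auto)
  then show ?thesis by blast
qed

theorem corollary1:
  fixes f :: "'n::finite annulus \<Rightarrow> 'n annulus"
    and F :: "'n phase \<Rightarrow> 'n phase"
    and S :: "'n phase \<Rightarrow> real"
    and L :: real
    and \<mu> :: "'n annulus measure"
  assumes "globally_positive f"
    and "lift_of F f"
    and "positive_generating_function S F"
    and "critical_constant S L"
    and "strongly_minimizing_measure f F S L \<mu>"
    and "ergodic f \<mu>"
    and "zero_lyapunov_exponents f \<mu>"
  shows "AE x in \<mu>. annulus_C1_isotropic_at (measure_support \<mu>) x"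
proof -
  have "C1_annulus_diffeo f" using assms(1) by (simp add: globally_positive_def symplectic_diffeo_def)
  then obtain G F' S' S'' u where w: "weak_kam_lift F G F' S S' S'' f u L"
    using weak_kam_lift_exists assms(2-4) by metis
  interpret minimizing_support F G F' S S' S'' f u L \<mu>
    by (intro minimizing_support.intro w minimizing_support_axioms.intro assms)
  from green_bundles_coincide[OF assms(7)] show ?thesis
  proof eventually_elim
    case (elim a)
    then show ?case
      unfolding annulus_C1_isotropic_at_def X_def[symmetric] by (blast intro:
          C1_isotropic_if_green_bundles_coincide)
  qed
qed

end
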